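(* Let $\mathcal{I}$ be an instance of Weighted $k$-Server on the uniform metric with $k_j$ servers of weight $W_j$ for all $j\in[\ell]$. For any $\varepsilon\in(0,1)$, there is a polynomial-time (offline) algorithm for $\mathcal{I}$ that uses at most $2(1+\varepsilon)\ell\cdot k_j$ servers of weight $W_j$ for each $j\in[\ell]$ and whose server movement cost is at most $O(1/\varepsilon)$ times the optimal cost of $\mathcal{I}$.
   Context: Weighted $k$-Server on the uniform metric: there is a set of $n$ points $V=\{1,\dots,n\}$ with $d(v,v')=1$ for all $v\neq v'$, and $k$ servers, server $i$ having weight $w_i\ge 0$; the distinct weights are $W_1,\dots,W_\ell$ with $k_j$ servers of weight $W_j$. A request sequence $\sigma_1,\dots,\sigma_T\in V$ is given. A solution is a map $f:[k]\times\{0,\dots,T\}\to V$ giving each server's position at each time, with given initial positions $f(i,0)$, such that for each $t\in[T]$ some server is at $\sigma_t$ at time $t$. Its cost is $\frac12\sum_{i}w_i\sum_{t=1}^T\mathbb{1}[f(i,t)\neq f(i,t-1)]$. The optimal cost of $\mathcal{I}$ is the minimum cost of a solution using exactly the given $k_j$ servers of each weight $W_j$. *)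

theory Defs
  imports
    Complex_Main
    "HOL-Library.FuncSet"
    "HOL-Library.Log_Nat"
    "HOL-Computational_Algebra.Polynomial"
begin

section \<open>Weighted k-server on the uniform metric\<close>

text \<open>
  The point set is \<open>{1..num_points I}\<close>. Each server is given by its weight and its initial
  position; servers are indexed from 0. The request \<open>\<sigma>\<^sub>t\<close>, \<open>1 \<le> t \<le> T\<close>, is
  \<open>requests I ! (t - 1)\<close>. Weights are rational because an instance is an input to an algorithm.
\<close>

record wks_instance =
  num_points :: nat
  servers :: "(rat \<times> nat) list"
  requests :: "nat list"

definition points :: "wks_instance \<Rightarrow> nat set" where
  "points I = {1..num_points I}"

definition num_servers :: "wks_instance \<Rightarrow> nat" where
  "num_servers I = length (servers I)"

definition horizon :: "wks_instance \<Rightarrow> nat" where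
  "horizon I = length (requests I)"

definition valid_instance :: "wks_instance \<Rightarrow> bool" where
  "valid_instance I \<longleftrightarrow>
     servers I \<noteq> [] \<and>
     (\<forall>(w, p) \<in> set (servers I). w \<ge> 0 \<and> p \<in> points I) \<and>
     set (requests I) \<subseteq> points I"

definition weights :: "wks_instance \<Rightarrow> rat set" where
  "weights I = fst ` set (servers I)"

definition servers_of_weight :: "wks_instance \<Rightarrow> rat \<Rightarrow> nat" where
  "servers_of_weight I W = card {i. i < num_servers I \<and> fst (servers I ! i) = W}"

definition is_solution :: "wks_instance \<Rightarrow> (nat \<Rightarrow> nat \<Rightarrow> nat) \<Rightarrow> bool" where
  "is_solution I f \<longleftrightarrow>
     (\<forall>i < num_servers I. f i 0 = snd (servers I ! i)) \<and>
     (\<forall>i < num_servers I. \<forall>t \<le> horizon I. f i t \<in> points I) \<and>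
     (\<forall>t \<in> {1..horizon I}. \<exists>i < num_servers I. f i t = requests I ! (t - 1))"

definition cost :: "wks_instance \<Rightarrow> (nat \<Rightarrow> nat \<Rightarrow> nat) \<Rightarrow> real" where
  "cost I f = 1 / 2 * (\<Sum>i<num_servers I. of_rat (fst (servers I ! i)) *
                        (\<Sum>t = 1..horizon I. of_bool (f i t \<noteq> f i (t - 1))))"

text \<open>The infimum is a minimum, see \<open>opt_cost_attained\<close> below.\<close>

definition opt_cost :: "wks_instance \<Rightarrow> real" where
  "opt_cost I = Inf {cost I f | f. is_solution I f}"

lemma finite_costs: "finite {cost I f | f. is_solution I f}"
proof -
  let ?k = "num_servers I" and ?T = "horizon I"
  let ?m = "\<lambda>f. \<lambda>i\<in>{..<?k}. card {t \<in> {1..?T}. f i t \<noteq> f i (t - 1 :: nat)}"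
  let ?g = "\<lambda>m. 1 / 2 * (\<Sum>i<?k. of_rat (fst (servers I ! i)) * real (m i))"
  have count: "(\<Sum>t = 1..?T. of_bool (f i t \<noteq> f i (t - 1)) :: real) =
                 real (card {t \<in> {1..?T}. f i t \<noteq> f i (t - 1)})" for f :: "nat \<Rightarrow> nat \<Rightarrow> nat" and i
    by (subst sum_of_bool_eq) (auto intro!: arg_cong[where f = card])
  have "cost I f = ?g (?m f)" for f
    unfolding cost_def count by simp
  moreover have "?m f \<in> {..<?k} \<rightarrow>\<^sub>E {..?T}" for f :: "nat \<Rightarrow> nat \<Rightarrow> nat"
  proof -
    have "card {t \<in> {1..?T}. f i t \<noteq> f i (t - 1)} \<le> ?T" for i
    proof -
      have "card {t \<in> {1..?T}. f i t \<noteq> f i (t - 1)} \<le> card {1..?T}"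
        by (intro card_mono) auto
      then show ?thesis by simp
    qed
    then show ?thesis by simp
  qed
  ultimately have "{cost I f | f. is_solution I f} \<subseteq> ?g ` ({..<?k} \<rightarrow>\<^sub>E {..?T})"
    by blast
  then show ?thesis
    by (rule finite_subset) (intro finite_imageI finite_PiE; simp)
qed

lemma solution_exists:
  assumes "valid_instance I"
  shows "\<exists>f. is_solution I f"
proof -
  let ?f = "\<lambda>i t. if i = 0 \<and> t \<noteq> 0 then requests I ! (t - 1) else snd (servers I ! i)"
  have k: "0 < num_servers I" using assms by (simp add: valid_instance_def num_servers_def)
  have start: "snd (servers I ! i) \<in> points I" if "i < num_servers I" for i
    using assms nth_mem[of i "servers I"] that
    by (cases "servers I ! i") (auto simp: valid_instance_def num_servers_def)
  have req: "requests I ! (t - 1) \<in> points I" if "t \<le> horizon I" "t \<noteq> 0" for t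
  proof -
    have "t - 1 < length (requests I)" using that by (simp add: horizon_def)
    then show ?thesis using assms by (auto simp: valid_instance_def)
  qed
  have "is_solution I ?f"
    unfolding is_solution_def using start req k by auto
  then show ?thesis by blast
qed

lemma opt_cost_attained:
  assumes "valid_instance I"
  shows "\<exists>f. is_solution I f \<and> cost I f = opt_cost I"
    and "is_solution I g \<Longrightarrow> opt_cost I \<le> cost I g"
proof -
  let ?C = "{cost I f | f. is_solution I f}"
  have ne: "?C \<noteq> {}" using solution_exists[OF assms] by blast
  then have eq: "opt_cost I = Min ?C"
    unfolding opt_cost_def by (intro cInf_eq_Min finite_costs)
  then have "opt_cost I \<in> ?C" using Min_in[OF finite_costs ne] by simp
  then show "\<exists>f. is_solution I f \<and> cost I f = opt_cost I" by force
  show "is_solution I g \<Longrightarrow> opt_cost I \<le> cost I g"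
    unfolding eq by (intro Min_le finite_costs) blast
qed

text \<open>
  Resource augmentation: to the given servers, additional copies of given servers are added,
  \<open>cs\<close> listing the indices of the servers that are copied. A copy has both the weight and the
  initial position of its original, so the added servers are not placed at points of the
  algorithm's choice for free.
\<close>

definition augment :: "wks_instance \<Rightarrow> nat list \<Rightarrow> wks_instance" where
  "augment I cs = I\<lparr>servers := servers I @ map (\<lambda>c. servers I ! c) cs\<rparr>"


section \<open>Model of computation\<close>

text \<open>
  Random access machines with logarithmic cost, in the form of structured programs. The store
  consists of named arrays of natural numbers, indexed by natural numbers; a scalar variable is
  an array used at index 0 only. Evaluating an expression costs, for each of its nodes, 1 plus
  the length in bits (\<^term>\<open>floorlog 2\<close>) of the value of that node; in particular, the length of
  the address of every cell accessed is charged. Hence running time is polynomially related to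
  that of Turing machines. Subtraction is truncated at 0 and division is integer division, with
  \<^prop>\<open>(x::nat) div 0 = 0\<close>.
\<close>

type_synonym store = "string \<Rightarrow> nat \<Rightarrow> nat"

datatype expr =
    Num nat
  | Cell string expr
  | Add expr expr
  | Sub expr expr
  | Mul expr expr
  | Div expr expr

fun eval_expr :: "expr \<Rightarrow> store \<Rightarrow> nat" where
  "eval_expr (Num c) s = c"
| "eval_expr (Cell x a) s = s x (eval_expr a s)"
| "eval_expr (Add a b) s = eval_expr a s + eval_expr b s"
| "eval_expr (Sub a b) s = eval_expr a s - eval_expr b s"
| "eval_expr (Mul a b) s = eval_expr a s * eval_expr b s"
| "eval_expr (Div a b) s = eval_expr a s div eval_expr b s"

definition node_cost :: "nat \<Rightarrow> nat" where
  "node_cost v = 1 + floorlog 2 v"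

fun expr_cost :: "expr \<Rightarrow> store \<Rightarrow> nat" where
  "expr_cost (Num c) s = node_cost c"
| "expr_cost (Cell x a) s = expr_cost a s + node_cost (eval_expr (Cell x a) s)"
| "expr_cost (Add a b) s = expr_cost a s + expr_cost b s + node_cost (eval_expr (Add a b) s)"
| "expr_cost (Sub a b) s = expr_cost a s + expr_cost b s + node_cost (eval_expr (Sub a b) s)"
| "expr_cost (Mul a b) s = expr_cost a s + expr_cost b s + node_cost (eval_expr (Mul a b) s)"
| "expr_cost (Div a b) s = expr_cost a s + expr_cost b s + node_cost (eval_expr (Div a b) s)"

text \<open>\<open>Assign x a b\<close> stores the value of \<open>b\<close> in cell \<open>a\<close> of array \<open>x\<close>. Conditions hold iff they
  evaluate to a nonzero value.\<close>

datatype program =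
    Skip
  | Assign string expr expr
  | Seq program program
  | Cond expr program program
  | While expr program

text \<open>\<open>exec p s \<tau> s'\<close>: started in store \<open>s\<close>, program \<open>p\<close> halts after time \<open>\<tau>\<close> in store \<open>s'\<close>.\<close>

inductive exec :: "program \<Rightarrow> store \<Rightarrow> nat \<Rightarrow> store \<Rightarrow> bool" where
  Skip: "exec Skip s 1 s"
| Assign: "exec (Assign x a b) s (1 + expr_cost a s + expr_cost b s)
             (s(x := (s x)(eval_expr a s := eval_expr b s)))"
| Seq: "exec p s \<tau> s' \<Longrightarrow> exec q s' \<tau>' s'' \<Longrightarrow> exec (Seq p q) s (\<tau> + \<tau>') s''"
| CondTrue: "eval_expr b s \<noteq> 0 \<Longrightarrow> exec p s \<tau> s' \<Longrightarrow>
             exec (Cond b p q) s (1 + expr_cost b s + \<tau>) s'"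
| CondFalse: "eval_expr b s = 0 \<Longrightarrow> exec q s \<tau> s' \<Longrightarrow>
             exec (Cond b p q) s (1 + expr_cost b s + \<tau>) s'"
| WhileTrue: "eval_expr b s \<noteq> 0 \<Longrightarrow> exec p s \<tau> s' \<Longrightarrow> exec (While b p) s' \<tau>' s'' \<Longrightarrow>
             exec (While b p) s (1 + expr_cost b s + \<tau> + \<tau>') s''"
| WhileFalse: "eval_expr b s = 0 \<Longrightarrow> exec (While b p) s (1 + expr_cost b s) s"

lemma exec_deterministic:
  "exec p s \<tau> s' \<Longrightarrow> exec p s \<tau>' s'' \<Longrightarrow> \<tau>' = \<tau> \<and> s'' = s'"
proof (induction arbitrary: \<tau>' s'' rule: exec.induct)
  case (Skip s)
  then show ?case by (auto elim: exec.cases)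
next
  case (Assign x a b s)
  then show ?case by (auto elim: exec.cases)
next
  case (Seq p s \<tau> s1 q \<tau>1 s2)
  from Seq.prems obtain \<tau>2 s3 \<tau>3 where
    "exec p s \<tau>2 s3" "exec q s3 \<tau>3 s''" "\<tau>' = \<tau>2 + \<tau>3" by (cases, blast)
  with Seq.IH show ?case by blast
next
  case (CondTrue b s p \<tau> s1 q)
  from CondTrue.prems CondTrue.hyps obtain \<tau>2 where
    "exec p s \<tau>2 s''" "\<tau>' = 1 + expr_cost b s + \<tau>2" by (cases, auto)
  with CondTrue.IH show ?case by blast
next
  case (CondFalse b s q \<tau> s1 p)
  from CondFalse.prems CondFalse.hyps obtain \<tau>2 where
    "exec q s \<tau>2 s''" "\<tau>' = 1 + expr_cost b s + \<tau>2" by (cases, auto)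
  with CondFalse.IH show ?case by blast
next
  case (WhileTrue b s p \<tau> s1 \<tau>1 s2)
  from WhileTrue.prems WhileTrue.hyps obtain \<tau>2 s3 \<tau>3 where
    "exec p s \<tau>2 s3" "exec (While b p) s3 \<tau>3 s''" "\<tau>' = 1 + expr_cost b s + \<tau>2 + \<tau>3"
    by (cases, auto)
  with WhileTrue.IH show ?case by blast
next
  case (WhileFalse b s p)
  from WhileFalse.prems WhileFalse.hyps show ?case by (cases, auto)
qed

definition input_store :: "nat list \<Rightarrow> store" where
  "input_store xs = (\<lambda>x i. if x = ''in'' \<and> i < length xs then xs ! i else 0)"

definition outputs_in_time :: "program \<Rightarrow> nat list \<Rightarrow> nat \<Rightarrow> nat list \<Rightarrow> bool" where
  "outputs_in_time p xs \<tau> ys \<longleftrightarrow>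
     (\<exists>s. exec p (input_store xs) \<tau> s \<and> (\<forall>i < length ys. s ''out'' i = ys ! i))"


section \<open>Inputs and outputs\<close>

definition encode_server :: "rat \<times> nat \<Rightarrow> nat list" where
  "encode_server = (\<lambda>(w, p). [nat (fst (quotient_of w)), nat (snd (quotient_of w)), p])"

definition encode_instance :: "wks_instance \<Rightarrow> nat list" where
  "encode_instance I =
     [num_points I, num_servers I, horizon I] @ concat (map encode_server (servers I)) @ requests I"

text \<open>
  The length in bits of the encoding, plus the number of points, since a finite metric space
  is given by its points. The numbers of servers and of requests are bounded by the length of the
  encoding.
\<close>

definition instance_size :: "wks_instance \<Rightarrow> nat" where
  "instance_size I = num_points I + (\<Sum>x\<leftarrow>encode_instance I. 1 + floorlog 2 x)"

text \<open>
  The output consists of the number of added servers, the indices of the servers that they copy,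
  and the positions of each server of \<^term>\<open>augment I cs\<close> at the times from 0 to the horizon.
\<close>

definition encode_solution :: "wks_instance \<Rightarrow> nat list \<Rightarrow> (nat \<Rightarrow> nat \<Rightarrow> nat) \<Rightarrow> nat list" where
  "encode_solution I cs f =
     [length cs] @ cs @
     concat (map (\<lambda>i. map (f i) [0..<horizon I + 1]) [0..<num_servers (augment I cs)])"

end

(*
Integer weights are obtained by clearing denominators. On the uniform metric only the choice, for every
request, of a weight class and of "hit" (a server of this class has stayed at the page since the page's
previous request) or "fetch" matters; a fetch costs the weight of the class, and class j may hold at
most k_j pages at any time. Without the capacities an optimal choice is a shortest path for every page.

The linear program is replaced by a drift-plus-penalty scheme. In each of polynomially many rounds the
shortest paths are computed for prices that are queue lengths of the excess load. Since an optimal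
solution never exceeds the capacities, the sum of the squared queue lengths grows so slowly that on
average the rounds overload no class by more than a tenth, at a constant times the optimal cost. The
weight of the prices depends on the optimal cost, which is guessed among polynomially many values B.

The average of the rounds is a fractional solution. Class j may hold a page between two requests in the
final solution only if it does so in at least a fraction 11/(20 l) of the rounds, which bounds its load
by 2 l k_j. The shortest paths under this restriction cost at most 20/9 times the average: a unit of
service above the thresholds, of which there are at least 9/20 at every request, pays with its fetches
for the increments of the shortest path distance. This gives cost 4 OPT with 2 l k_j servers, whatever
epsilon is.

All loops of the program have bounds polynomial in the numbers of servers and requests, and all
multiplications have a factor computed from the input alone, so that every step adds few bits to the
stored numbers; this makes the running time bound a syntactic check.
*)
theory Submission
  imports Defs
begin

section \<open>Bounded loop programs\<close>

text \<open>The obstacle that the rounds avoid is a linear programming solver verified on this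
  machine: a round needs only additions, comparisons and shortest paths. Admitting class
  \<open>j\<close> where its share is at least \<open>\<theta> / l\<close> multiplies its load by at
  most \<open>l / \<theta>\<close>. Shares of total at least \<open>1 - \<theta>\<close> remain
  above the thresholds, so the cost grows by at most the factor \<open>1 / (1 - \<theta>)\<close>.
  Since the rounds may overload a class by a tenth, \<open>\<theta> = 11/20\<close> is chosen: it
  satisfies \<open>(11/10) / \<theta> = 2\<close> and leaves \<open>9/20\<close>. The penalty weight
  \<open>4 * DD\<close> bounds the average cost of the rounds by \<open>opt + B / 8\<close> for
  every \<open>B\<close>, while the queues are known to be small if \<open>opt \<le> B\<close>. Some
  guess satisfies \<open>opt \<le> B \<le> 2 * opt + 1\<close>, where the 1 covers
  \<open>opt = 0\<close>, and the saved guess is no larger. The final cost is at most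
  \<open>20/9 * (5/4 * opt + 1/8)\<close>. This is below \<open>4 * opt + 1\<close>, and integrality
  of the scaled weights gives \<open>4 * opt\<close>.\<close>

datatype cmd =
    Nop
  | Asg string expr expr
  | Sq cmd cmd
  | Ite expr cmd cmd
  | For string nat expr cmd

abbreviation put :: "string \<Rightarrow> nat \<Rightarrow> store \<Rightarrow> store" where
  "put x v s \<equiv> s(x := (s x)(0 := v))"

fun iter :: "nat \<Rightarrow> (nat \<Rightarrow> 'a \<Rightarrow> 'a) \<Rightarrow> 'a \<Rightarrow> 'a" where
  "iter 0 F s = s"
| "iter (Suc n) F s = F n (iter n F s)"

fun run :: "cmd \<Rightarrow> store \<Rightarrow> store" where
  "run Nop s = s"
| "run (Asg x a b) s = s(x := (s x)(eval_expr a s := eval_expr b s))"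
| "run (Sq c d) s = run d (run c s)"
| "run (Ite e c d) s = (if eval_expr e s \<noteq> 0 then run c s else run d s)"
| "run (For x l e c) s =
     put x (l + eval_expr e s) (iter (eval_expr e s) (\<lambda>i s. run c (put x (l + i) s)) s)"

text \<open>The loop condition evaluates \<open>e\<close> anew before every pass. As
  \<open>bound e\<close> lets \<open>e\<close> read only input cells, which well-formed commands
  never write, \<open>e\<close> keeps the value it had on entry. The truncated subtraction vanishes
  exactly when the counter has reached \<open>l\<close> plus this value.\<close>

fun compile :: "cmd \<Rightarrow> program" where
  "compile Nop = Skip"
| "compile (Asg x a b) = Assign x a b"
| "compile (Sq c d) = Seq (compile c) (compile d)"
| "compile (Ite e c d) = Cond e (compile c) (compile d)"
| "compile (For x l e c) =
     Seq (Assign x (Num 0) (Num l))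
       (While (Sub (Add e (Num l)) (Cell x (Num 0)))
          (Seq (compile c) (Assign x (Num 0) (Add (Cell x (Num 0)) (Num 1)))))"

fun writes :: "cmd \<Rightarrow> string set" where
  "writes Nop = {}"
| "writes (Asg x a b) = {x}"
| "writes (Sq c d) = writes c \<union> writes d"
| "writes (Ite e c d) = writes c \<union> writes d"
| "writes (For x l e c) = insert x (writes c)"

lemma run_frame: "x \<notin> writes c \<Longrightarrow> run c s x = s x"
proof (induction c arbitrary: s)
  case (For y l e c)
  have "iter n (\<lambda>i s. run c (put y (l + i) s)) s x = s x" for n
    using For by (induction n) auto
  then show ?case using For by auto
qed auto

text \<open>\<open>small e\<close>: the value of \<open>e\<close> has a length bounded in terms of the input alone.
  \<open>bound e\<close>: the value of \<open>e\<close> is polynomial in the numbers of points, servers and requests.\<close>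

fun small :: "expr \<Rightarrow> bool" where
  "small (Num c) = True"
| "small (Cell x a) = (x = ''in'')"
| "small (Add a b) = (small a \<and> small b)"
| "small (Sub a b) = False"
| "small (Mul a b) = (small a \<and> small b)"
| "small (Div a b) = False"

fun bound :: "expr \<Rightarrow> bool" where
  "bound (Num c) = True"
| "bound (Cell x a) = (x = ''in'' \<and> (a = Num 0 \<or> a = Num 1 \<or> a = Num 2))"
| "bound (Add a b) = (bound a \<and> bound b)"
| "bound (Sub a b) = False"
| "bound (Mul a b) = (bound a \<and> bound b)"
| "bound (Div a b) = False"

text \<open>A product may have only one factor of unbounded length, which excludes repeated
  squaring: evaluating an expression adds a number of bits that depends on the input and the
  expression, not on the numbers stored so far.\<close>

fun tame :: "expr \<Rightarrow> bool" where
  "tame (Num c) = True"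
| "tame (Cell x a) = tame a"
| "tame (Add a b) = (tame a \<and> tame b)"
| "tame (Sub a b) = (tame a \<and> tame b)"
| "tame (Mul a b) = (tame a \<and> tame b \<and> small b)"
| "tame (Div a b) = (tame a \<and> tame b)"

fun wf_cmd :: "cmd \<Rightarrow> bool" where
  "wf_cmd Nop = True"
| "wf_cmd (Asg x a b) = (x \<noteq> ''in'' \<and> tame a \<and> tame b)"
| "wf_cmd (Sq c d) = (wf_cmd c \<and> wf_cmd d)"
| "wf_cmd (Ite e c d) = (tame e \<and> wf_cmd c \<and> wf_cmd d)"
| "wf_cmd (For x l e c) = (x \<noteq> ''in'' \<and> x \<notin> writes c \<and> tame e \<and> bound e \<and> wf_cmd c)"

lemma wf_writes: "wf_cmd c \<Longrightarrow> ''in'' \<notin> writes c"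
  by (induction c) auto

lemma bound_cong: "bound e \<Longrightarrow> s ''in'' = s' ''in'' \<Longrightarrow> eval_expr e s = eval_expr e s'"
  by (induction e) auto

text \<open>The size of a constant grows with its value, so that \<open>esize\<close> bounds the
  number of nodes as well as the lengths of the constants.\<close>

fun esize :: "expr \<Rightarrow> nat" where
  "esize (Num c) = Suc c"
| "esize (Cell x a) = Suc (esize a)"
| "esize (Add a b) = Suc (esize a + esize b)"
| "esize (Sub a b) = Suc (esize a + esize b)"
| "esize (Mul a b) = Suc (esize a + esize b)"
| "esize (Div a b) = Suc (esize a + esize b)"

text \<open>The constant 40 leaves room for the code that \<open>compile\<close> adds to a loop.\<close>

fun csize :: "cmd \<Rightarrow> nat" where
  "csize Nop = 1"
| "csize (Asg x a b) = 1 + esize a + esize b"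
| "csize (Sq c d) = csize c + csize d"
| "csize (Ite e c d) = 1 + esize e + csize c + csize d"
| "csize (For x l e c) = 40 + 2 * l + esize e + csize c"

text \<open>Both branches of a conditional are charged and loop bounds are evaluated in the initial
  store. The count therefore depends on the input array only (\<open>steps_cong\<close>) and is
  fixed before the run.\<close>

fun steps :: "cmd \<Rightarrow> store \<Rightarrow> nat" where
  "steps Nop s = 1"
| "steps (Asg x a b) s = 1"
| "steps (Sq c d) s = steps c s + steps d s"
| "steps (Ite e c d) s = 1 + steps c s + steps d s"
| "steps (For x l e c) s = 2 + eval_expr e s * (2 + steps c s)"

lemma steps_cong: "wf_cmd c \<Longrightarrow> s ''in'' = s' ''in'' \<Longrightarrow> steps c s = steps c s'"
proof (induction c)
  case (For x l e c)
  then have "eval_expr e s = eval_expr e s'" by (intro bound_cong) auto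
  then show ?case using For by simp
qed auto


lemma small_bits:
  assumes "\<forall>i. s ''in'' i < 2 ^ b" "small e" "b \<ge> 1"
  shows "eval_expr e s < 2 ^ (esize e * b)"
  using assms(2)
proof (induction e)
  case (Num c)
  have "c < 2 ^ Suc c" using less_exp[of "Suc c"] by linarith
  also have "(2::nat) ^ Suc c \<le> 2 ^ (Suc c * b)" using assms(3) by (intro power_increasing) (cases b, auto)
  finally show ?case by simp
next
  case (Cell x a)
  have "eval_expr (Cell x a) s < 2 ^ b" using Cell assms(1) by simp
  also have "(2::nat) ^ b \<le> 2 ^ (esize (Cell x a) * b)" by (intro power_increasing) auto
  finally show ?case .
next
  case (Add a c)
  have "eval_expr (Add a c) s < 2 ^ (esize a * b) + 2 ^ (esize c * b)" using Add by auto
  also have "\<dots> \<le> 2 ^ (esize a * b + esize c * b) + 2 ^ (esize a * b + esize c * b)"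
    by (intro add_mono power_increasing) auto
  also have "\<dots> = 2 ^ (1 + esize a * b + esize c * b)" by simp
  also have "\<dots> \<le> 2 ^ (esize (Add a c) * b)" using assms(3)
    by (intro power_increasing) (auto simp: algebra_simps)
  finally show ?case .
next
  case (Mul a c)
  have "eval_expr (Mul a c) s < 2 ^ (esize a * b) * 2 ^ (esize c * b)" using Mul
    by (auto intro!: mult_strict_mono)
  also have "\<dots> \<le> 2 ^ (esize (Mul a c) * b)" unfolding power_add[symmetric]
    by (intro power_increasing) (auto simp: algebra_simps)
  finally show ?case .
qed auto

text \<open>The length \<open>m\<close> of the stored numbers enters with coefficient 1: a sum is
  one bit longer than its longer operand, and the right factor of a product is covered by
  \<open>small_bits\<close>. A larger coefficient would let lengths grow exponentially in the number
  of steps.\<close>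

lemma tame_bits:
  assumes "\<forall>x i. s x i < 2 ^ m" "\<forall>i. s ''in'' i < 2 ^ b" "tame e" "b \<ge> 1"
  shows "eval_expr e s < 2 ^ (m + esize e * b)"
  using assms(3)
proof (induction e)
  case (Num c)
  have "c < 2 ^ Suc c" using less_exp[of "Suc c"] by linarith
  also have "(2::nat) ^ Suc c \<le> 2 ^ (m + Suc c * b)" using assms(4)
    by (intro power_increasing) (cases b, auto)
  finally show ?case by simp
next
  case (Cell x a)
  have "eval_expr (Cell x a) s < 2 ^ m" using Cell assms(1) by simp
  also have "(2::nat) ^ m \<le> 2 ^ (m + esize (Cell x a) * b)" by (intro power_increasing) auto
  finally show ?case .
next
  case (Add a c)
  have "eval_expr (Add a c) s < 2 ^ (m + esize a * b) + 2 ^ (m + esize c * b)" using Add by auto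
  also have "\<dots> \<le> 2 ^ (m + esize a * b + esize c * b) + 2 ^ (m + esize a * b + esize c * b)"
    by (rule add_mono; rule power_increasing; simp)
  also have "\<dots> = 2 ^ (1 + (m + esize a * b + esize c * b))" by simp
  also have "\<dots> \<le> 2 ^ (m + esize (Add a c) * b)" using assms(4)
    by (intro power_increasing) (auto simp: algebra_simps)
  finally show ?case .
next
  case (Sub a c)
  have "eval_expr (Sub a c) s < 2 ^ (m + esize a * b)" using Sub by auto
  also have "\<dots> \<le> 2 ^ (m + esize (Sub a c) * b)" by (intro power_increasing) (simp_all add: algebra_simps)
  finally show ?case .
next
  case (Mul a c)
  have "eval_expr (Mul a c) s < 2 ^ (m + esize a * b) * 2 ^ (esize c * b)"
    using Mul small_bits[of s b c] assms(2,4) by (auto intro!: mult_strict_mono)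
  also have "\<dots> \<le> 2 ^ (m + esize (Mul a c) * b)" unfolding power_add[symmetric]
    by (intro power_increasing) (auto simp: algebra_simps)
  finally show ?case .
next
  case (Div a c)
  have "eval_expr (Div a c) s \<le> eval_expr a s" by (simp add: div_le_dividend)
  also have "eval_expr a s < 2 ^ (m + esize a * b)" using Div by auto
  also have "\<dots> \<le> 2 ^ (m + esize (Div a c) * b)" by (intro power_increasing) (simp_all add: algebra_simps)
  finally show ?case .
qed

lemma node_cost_le: "v < 2 ^ m \<Longrightarrow> node_cost v \<le> 1 + m"
  unfolding node_cost_def using floorlog_leI[of v 2 m] by simp

lemma tame_cost:
  assumes "\<forall>x i. s x i < 2 ^ m" "\<forall>i. s ''in'' i < 2 ^ b" "tame e" "b \<ge> 1" "esize e \<le> z"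
  shows "expr_cost e s \<le> esize e * (1 + m + z * b)"
  using assms(3,5)
proof (induction e)
  have nc: "node_cost (eval_expr e s) \<le> 1 + m + z * b" if "tame e" "esize e \<le> z" for e
  proof -
    have "node_cost (eval_expr e s) \<le> 1 + (m + esize e * b)"
      using node_cost_le[OF tame_bits[OF assms(1,2) that(1) assms(4)]] .
    also have "esize e * b \<le> z * b" using that(2) by simp
    finally show ?thesis by simp
  qed
  { case (Num c) then show ?case using nc[of "Num c"] by auto }
  { case (Cell x a) then show ?case using nc[of "Cell x a"] by auto }
  { case (Add a c) then show ?case using nc[of "Add a c"] by (auto simp: algebra_simps) }
  { case (Sub a c) then show ?case using nc[of "Sub a c"] by (auto simp: algebra_simps) }
  { case (Mul a c) then show ?case using nc[of "Mul a c"] by (auto simp: algebra_simps) }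
  { case (Div a c) then show ?case using nc[of "Div a c"] by (auto simp: algebra_simps) }
qed

lemma bits_put:
  assumes "\<forall>y i. s y i < (2::nat) ^ m" "v < 2 ^ m'" "m \<le> m'"
  shows "(s(x := (s x)(j := v))) y i < 2 ^ m'"
proof -
  have "s y i < 2 ^ m'" for y i
    using assms(1,3) by (meson order_less_le_trans power_increasing one_le_numeral)
  then show ?thesis using assms(2) by auto
qed

text \<open>Each step lengthens the stored numbers by at most \<open>z * b\<close> bits.
  \<open>M\<close> exceeds their length throughout the run, with room for the intermediate values of
  one more expression, so a step takes time at most \<open>z * M\<close>.\<close>

lemma compile_exec:
  assumes "wf_cmd c" "\<forall>x i. s x i < 2 ^ m" "\<forall>i. s ''in'' i < 2 ^ b" "b \<ge> 1" "csize c \<le> z"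
    "1 + m + z * b * (steps c s + 1) \<le> M"
  shows "\<exists>\<tau>. exec (compile c) s \<tau> (run c s) \<and> \<tau> \<le> z * M * steps c s \<and>
    (\<forall>x i. run c s x i < 2 ^ (m + z * b * steps c s))"
  using assms(1,2,3,5,6)
proof (induction c arbitrary: s m)
  case Nop
  have "\<forall>x i. s x i < 2 ^ (m + z * b)"
    using Nop by (meson order_less_le_trans power_increasing one_le_numeral le_add1)
  then show ?case using Nop by (auto intro!: exI[of _ 1] exec.Skip)
next
  case (Asg x a e)
  have a: "expr_cost a s \<le> esize a * (1 + m + z * b)" "expr_cost e s \<le> esize e * (1 + m + z * b)"
    by (rule tame_cost; use Asg assms(4) in simp)+
  have "1 + expr_cost a s + expr_cost e s \<le> csize (Asg x a e) * (1 + m + z * b)"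
    using a by (simp add: algebra_simps)
  also have "\<dots> \<le> z * M" using Asg.prems by (intro mult_mono) (auto simp: algebra_simps)
  finally have t: "1 + expr_cost a s + expr_cost e s \<le> z * M * steps (Asg x a e) s" by simp
  have "eval_expr e s < 2 ^ (m + esize e * b)" using Asg assms(4) by (intro tame_bits) auto
  also have "\<dots> \<le> 2 ^ (m + z * b)" using Asg by (intro power_increasing) auto
  finally have "\<forall>y i. run (Asg x a e) s y i < 2 ^ (m + z * b * steps (Asg x a e) s)"
    using bits_put[OF Asg.prems(2)] by simp
  with t show ?case using exec.Assign[of x a e s] by (auto simp del: fun_upd_apply)
next
  case (Sq c d)
  let ?S = "steps c s" and ?S' = "steps d s"
  have "z * b * (?S + 1) \<le> z * b * (?S + ?S' + 1)" by (intro mult_le_mono) auto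
  then have le: "1 + m + z * b * (?S + 1) \<le> M" using Sq.prems(5) unfolding steps.simps by linarith
  obtain \<tau> where 1: "exec (compile c) s \<tau> (run c s)" "\<tau> \<le> z * M * ?S"
    "\<forall>x i. run c s x i < 2 ^ (m + z * b * ?S)"
    using Sq.IH(1)[OF _ Sq.prems(2,3) _ le] Sq.prems by auto
  have i: "run c s ''in'' = s ''in''" using Sq.prems wf_writes by (simp add: run_frame)
  then have S': "steps d (run c s) = ?S'" using Sq.prems by (intro steps_cong) auto
  obtain \<tau>' where 2: "exec (compile d) (run c s) \<tau>' (run d (run c s))" "\<tau>' \<le> z * M * ?S'"
    "\<forall>x i. run d (run c s) x i < 2 ^ (m + z * b * ?S + z * b * ?S')"
    using Sq.IH(2)[of "run c s" "m + z * b * ?S"] Sq.prems 1(3) i S' by (auto simp: algebra_simps)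
  show ?case using exec.Seq[OF 1(1) 2(1)] 1(2) 2(2,3)
    by (intro exI[of _ "\<tau> + \<tau>'"]) (auto simp: algebra_simps)
next
  case (Ite e c d)
  let ?S = "steps c s" and ?S' = "steps d s"
  have "z * b * (?S + 1) \<le> z * b * (1 + ?S + ?S' + 1)" "z * b * (?S' + 1) \<le> z * b * (1 + ?S + ?S' + 1)"
    by (rule mult_le_mono; simp)+
  then have le: "1 + m + z * b * (?S + 1) \<le> M" "1 + m + z * b * (?S' + 1) \<le> M"
    using Ite.prems(5) unfolding steps.simps by linarith+
  have a: "expr_cost e s \<le> esize e * (1 + m + z * b)"
    by (rule tame_cost; use Ite assms(4) in simp)
  have "1 + expr_cost e s \<le> csize (Ite e c d) * (1 + m + z * b)"
    using a by (simp add: algebra_simps)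
  also have "\<dots> \<le> z * M" using Ite.prems by (intro mult_mono) (auto simp: algebra_simps)
  finally have t: "1 + expr_cost e s \<le> z * M" .
  have mono: "\<forall>x i. r x i < 2 ^ (m + z * b * n) \<Longrightarrow> n \<le> steps (Ite e c d) s \<Longrightarrow>
      \<forall>x i. r x i < 2 ^ (m + z * b * steps (Ite e c d) s)" for r :: store and n
    by (meson order_less_le_trans power_increasing one_le_numeral add_left_mono mult_le_mono2)
  show ?case
  proof (cases "eval_expr e s = 0")
    case False
    obtain \<tau> where 1: "exec (compile c) s \<tau> (run c s)" "\<tau> \<le> z * M * ?S"
      "\<forall>x i. run c s x i < 2 ^ (m + z * b * ?S)"
      using Ite.IH(1)[OF _ Ite.prems(2,3) _ le(1)] Ite.prems by auto
    show ?thesis using exec.CondTrue[OF False 1(1)] 1(2) t mono[OF 1(3)] False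
      by (intro exI[of _ "1 + expr_cost e s + \<tau>"]) (auto simp: algebra_simps)
  next
    case True
    obtain \<tau> where 1: "exec (compile d) s \<tau> (run d s)" "\<tau> \<le> z * M * ?S'"
      "\<forall>x i. run d s x i < 2 ^ (m + z * b * ?S')"
      using Ite.IH(2)[OF _ Ite.prems(2,3) _ le(2)] Ite.prems by auto
    show ?thesis using exec.CondFalse[OF True 1(1)] 1(2) t mono[OF 1(3)] True
      by (intro exI[of _ "1 + expr_cost e s + \<tau>"]) (auto simp: algebra_simps)
  qed
next
  case (For x l e c)
  define N where "N = eval_expr e s"
  define S where "S = steps c s"
  define st where "st i = put x (l + i) (iter i (\<lambda>i s. run c (put x (l + i) s)) s)" for i
  \<comment> \<open>Length bound before pass \<open>i\<close>: one step for setting the counter and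
    \<open>1 + S\<close> for each finished pass, the extra 1 being the increment. In
    \<open>steps\<close> a pass counts \<open>2 + S\<close>, because testing the condition also
    takes time.\<close>
  define mm where "mm i = m + z * b * (1 + i * (1 + S))" for i
  let ?cond = "Sub (Add e (Num l)) (Cell x (Num 0))"
  let ?inc = "Assign x (Num 0) (Add (Cell x (Num 0)) (Num 1))"
  have xin: "x \<noteq> ''in''" using For.prems by simp
  have steps: "steps (For x l e c) s = 2 + N * (2 + S)" by (simp add: N_def S_def)
  have mmle: "1 + mm i + z * b \<le> M" "mm i \<le> m + z * b * steps (For x l e c) s" if "i \<le> N" for i
  proof -
    have "i * (1 + S) \<le> N * (2 + S)" using that by (intro mult_mono) auto
    then have "z * b * (i * (1 + S)) \<le> z * b * (N * (2 + S))" by (rule mult_le_mono2)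
    then have *: "z * b * (1 + i * (1 + S)) + z * b \<le> z * b * (2 + N * (2 + S))"
      unfolding add_mult_distrib2[of "z * b"] by linarith
    moreover have "z * b * (2 + N * (2 + S)) + z * b + 1 + m \<le> M"
      using For.prems(5) unfolding steps by (simp add: algebra_simps)
    ultimately show "1 + mm i + z * b \<le> M" unfolding mm_def by linarith
    show "mm i \<le> m + z * b * steps (For x l e c) s" using * unfolding mm_def steps by linarith
  qed
  have zM: "(1 + esize e + 20) * (1 + mm i + z * b) \<le> z * M" if "i \<le> N" for i
    using For.prems(4) mmle(1)[OF that] by (intro mult_mono) auto
  have st0: "run (For x l e c) s = st N" by (simp add: N_def st_def)
  have fr: "run c r ''in'' = r ''in''" "run c r x = r x" for r
    using For.prems wf_writes by (simp_all add: run_frame)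
  have st_in: "st i ''in'' = s ''in''" for i
  proof -
    have "iter i (\<lambda>i s. run c (put x (l + i) s)) s ''in'' = s ''in''"
      using xin by (induction i) (simp_all add: fr(1))
    then show ?thesis using xin by (simp add: st_def)
  qed
  have N: "eval_expr e (st i) = N" for i
    unfolding N_def using For.prems st_in by (intro bound_cong) auto
  have stx: "st i x 0 = l + i" for i by (simp add: st_def)
  have st_Suc: "st (Suc i) = put x (l + Suc i) (run c (st i))" for i
    by (simp add: st_def)
  have Sc: "steps c (st i) = S" for i
    unfolding S_def using For.prems st_in by (intro steps_cong) auto
  have step: "\<exists>\<tau>. exec (Seq (compile c) ?inc) (st i) \<tau> (st (Suc i)) \<and> \<tau> \<le> z * M * (1 + S) \<and>
      (\<forall>x k. st (Suc i) x k < 2 ^ mm (Suc i))" if i: "i < N" and bits: "\<forall>x k. st i x k < 2 ^ mm i" for i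
  proof -
    have "1 + mm i + z * b * (steps c (st i) + 1) = 1 + mm (Suc i)"
      unfolding mm_def Sc by (simp add: algebra_simps)
    also have "\<dots> \<le> M" using mmle(1)[of "Suc i"] i by simp
    finally obtain \<tau> where 1: "exec (compile c) (st i) \<tau> (run c (st i))" "\<tau> \<le> z * M * S"
      "\<forall>x k. run c (st i) x k < 2 ^ (mm i + z * b * S)"
      using For.IH[of "st i" "mm i"] For.prems bits unfolding Sc by (auto simp: st_in)
    have bits_Suc: "1 + mm i + z * b * S \<le> mm (Suc i)"
    proof -
      have "1 \<le> z * b" using For.prems(4) assms(4) by (cases z; cases b) auto
      then show ?thesis unfolding mm_def by (simp add: algebra_simps)
    qed
    have "run c (st i) x 0 = l + i" by (simp add: fr(2) stx)
    then have "l + i < 2 ^ (mm i + z * b * S)" using 1(3) by metis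
    then have "l + Suc i < 2 ^ (1 + mm i + z * b * S)" by simp
    also have "(2::nat) ^ (1 + mm i + z * b * S) \<le> 2 ^ mm (Suc i)"
      using bits_Suc by (intro power_increasing) auto
    finally have "\<forall>x k. st (Suc i) x k < 2 ^ mm (Suc i)"
      unfolding st_Suc using bits_put[OF 1(3)] bits_Suc by auto
    moreover have ex: "exec ?inc (run c (st i)) (1 + expr_cost (Num 0) (run c (st i)) +
        expr_cost (Add (Cell x (Num 0)) (Num 1)) (run c (st i))) (st (Suc i))"
      using exec.Assign[of x "Num 0" "Add (Cell x (Num 0)) (Num 1)" "run c (st i)"]
      unfolding st_Suc by (simp add: fr(2) stx)
    moreover have "1 + expr_cost (Num 0) (run c (st i)) +
        expr_cost (Add (Cell x (Num 0)) (Num 1)) (run c (st i)) \<le> z * M"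
    proof -
      let ?m = "mm i + z * b * S"
      have "expr_cost (Num 0) (run c (st i)) \<le> esize (Num 0) * (1 + ?m + z * b)"
        using 1(3) For.prems st_in fr(1) by (intro tame_cost assms(4)) auto
      moreover have "expr_cost (Add (Cell x (Num 0)) (Num 1)) (run c (st i)) \<le>
          esize (Add (Cell x (Num 0)) (Num 1)) * (1 + ?m + z * b)"
        using 1(3) For.prems st_in fr(1) by (intro tame_cost assms(4)) auto
      ultimately have "1 + expr_cost (Num 0) (run c (st i)) +
        expr_cost (Add (Cell x (Num 0)) (Num 1)) (run c (st i)) \<le> 20 * (1 + ?m + z * b)"
        by simp
      also have "\<dots> \<le> 20 * (1 + mm (Suc i) + z * b)" using bits_Suc by simp
      also have "\<dots> \<le> (1 + esize e + 20) * (1 + mm (Suc i) + z * b)"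
        by (intro mult_le_mono1) simp
      also have "\<dots> \<le> z * M" using zM[of "Suc i"] i by simp
      finally show ?thesis .
    qed
    ultimately show ?thesis using exec.Seq[OF 1(1) ex] 1(2)
      by (intro exI conjI) (assumption, auto simp: algebra_simps)
  qed
  have cond: "1 + expr_cost ?cond (st i) \<le> z * M" if "i \<le> N" "\<forall>x k. st i x k < 2 ^ mm i" for i
  proof -
    have "expr_cost ?cond (st i) \<le> esize ?cond * (1 + mm i + z * b)"
      using that For.prems st_in by (intro tame_cost assms(4)) auto
    then have "1 + expr_cost ?cond (st i) \<le> (1 + esize ?cond) * (1 + mm i + z * b)" by simp
    also have "\<dots> \<le> z * M" using mmle(1)[OF that(1)] For.prems(4) by (intro mult_mono) auto
    finally show ?thesis .
  qed
  have wh: "\<exists>\<tau>. exec (While ?cond (Seq (compile c) ?inc)) (st i) \<tau> (st N) \<and>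
      \<tau> \<le> z * M * (1 + (N - i) * (2 + S)) \<and> (\<forall>x k. st N x k < 2 ^ mm N)"
    if "i \<le> N" "\<forall>x k. st i x k < 2 ^ mm i" for i
    using that
  proof (induction "N - i" arbitrary: i)
    case 0
    then have "i = N" by simp
    moreover have "eval_expr ?cond (st N) = 0" by (simp add: N stx)
    ultimately show ?case using exec.WhileFalse[of ?cond "st N" "Seq (compile c) ?inc"] cond[OF 0(2,3)] 0(3)
      by (intro exI[of _ "1 + expr_cost ?cond (st N)"]) auto
  next
    case (Suc d)
    then have iN: "i < N" by simp
    then have nz: "eval_expr ?cond (st i) \<noteq> 0" by (simp add: N stx)
    obtain \<tau> where 1: "exec (Seq (compile c) ?inc) (st i) \<tau> (st (Suc i))" "\<tau> \<le> z * M * (1 + S)"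
      "\<forall>x k. st (Suc i) x k < 2 ^ mm (Suc i)" using step[OF iN Suc.prems(2)] by blast
    obtain \<tau>' where 2: "exec (While ?cond (Seq (compile c) ?inc)) (st (Suc i)) \<tau>' (st N)"
      "\<tau>' \<le> z * M * (1 + (N - Suc i) * (2 + S))" "\<forall>x k. st N x k < 2 ^ mm N"
    proof -
      have "d = N - Suc i" "Suc i \<le> N" using Suc.hyps(2) iN by auto
      then show thesis using Suc.hyps(1)[OF _ _ 1(3)] that by blast
    qed
    have "N - i = Suc (N - Suc i)" using iN by simp
    then show ?case using exec.WhileTrue[OF nz 1(1) 2(1)] cond[OF Suc.prems] 1(2) 2(2,3)
      by (intro exI[of _ "1 + expr_cost ?cond (st i) + \<tau> + \<tau>'"]) (auto simp: algebra_simps)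
  qed
  have ex0: "exec (Assign x (Num 0) (Num l)) s (1 + expr_cost (Num 0) s + expr_cost (Num l) s) (st 0)"
    using exec.Assign[of x "Num 0" "Num l" s] by (simp add: st_def)
  have "expr_cost (Num 0) s \<le> esize (Num 0) * (1 + m + z * b)"
    "expr_cost (Num l) s \<le> esize (Num l) * (1 + m + z * b)"
    using For.prems by (intro tame_cost assms(4); simp)+
  then have "1 + expr_cost (Num 0) s + expr_cost (Num l) s \<le>
      (1 + m + z * b) + esize (Num 0) * (1 + m + z * b) + esize (Num l) * (1 + m + z * b)"
    by linarith
  also have "\<dots> = (3 + l) * (1 + m + z * b)" by (simp add: algebra_simps)
  also have "\<dots> \<le> (20 + l) * (1 + m + z * b)" by (intro mult_le_mono1) simp
  also have "\<dots> \<le> z * M" using mmle(1)[of 0] For.prems(4) unfolding mm_def by (intro mult_mono) auto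
  finally have t0: "1 + expr_cost (Num 0) s + expr_cost (Num l) s \<le> z * M" .
  have "l < 2 ^ (m + esize (Num l) * b)" using tame_bits[of s m b "Num l"] For.prems assms(4) by simp
  also have "\<dots> \<le> 2 ^ mm 0"
  proof (rule power_increasing)
    have "Suc l * b \<le> z * b" using For.prems(4) by (intro mult_le_mono1) simp
    then show "m + esize (Num l) * b \<le> mm 0" by (simp add: mm_def)
  qed simp
  finally have "\<forall>x k. st 0 x k < 2 ^ mm 0"
    using bits_put[OF For.prems(2), of l "mm 0" x 0] by (simp add: st_def mm_def)
  from wh[OF _ this] obtain \<tau> where 3: "exec (While ?cond (Seq (compile c) ?inc)) (st 0) \<tau> (st N)"
    "\<tau> \<le> z * M * (1 + N * (2 + S))" "\<forall>x k. st N x k < 2 ^ mm N" by auto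
  have "st N y k < 2 ^ (m + z * b * steps (For x l e c) s)" for y k
    using 3(3) mmle(2)[of N] by (meson order_less_le_trans power_increasing one_le_numeral le_refl)
  then show ?case using exec.Seq[OF ex0 3(1)] t0 3(2) unfolding st0 steps
    by (intro exI[of _ "1 + expr_cost (Num 0) s + expr_cost (Num l) s + \<tau>"]) (auto simp: algebra_simps)
qed

section \<open>Polynomial time in the size of an instance\<close>

abbreviation start :: "wks_instance \<Rightarrow> store" where
  "start I \<equiv> input_store (encode_instance I)"

lemma length_le_size: "length (encode_instance I) \<le> instance_size I"
proof -
  have "length xs \<le> (\<Sum>x\<leftarrow>xs. 1 + floorlog 2 x)" for xs :: "nat list"
    by (induction xs) auto
  then show ?thesis unfolding instance_size_def by (meson trans_le_add2)
qed

lemma length_encode: "length (encode_instance I) = 3 + 3 * num_servers I + horizon I"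
proof -
  have "length (concat (map encode_server xs)) = 3 * length xs" for xs
    by (induction xs) (auto simp: encode_server_def)
  then show ?thesis by (simp add: encode_instance_def num_servers_def horizon_def)
qed

lemma input_bits: "start I x i < 2 ^ instance_size I"
proof (cases "x = ''in'' \<and> i < length (encode_instance I)")
  case True
  let ?x = "encode_instance I ! i"
  have "floorlog 2 y \<le> (\<Sum>x\<leftarrow>xs. 1 + floorlog 2 x)" if "y \<in> set xs" for y and xs :: "nat list"
    using that by (induction xs) auto
  then have "floorlog 2 ?x \<le> instance_size I"
    unfolding instance_size_def using True by (meson nth_mem trans_le_add2)
  then have "?x < 2 ^ instance_size I" by (simp add: floorlog_le_iff)
  then show ?thesis using True by (simp add: input_store_def)
qed (auto simp: input_store_def)

lemma start_in [simp]:
  "start I ''in'' 0 = num_points I"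
  "start I ''in'' (Suc 0) = num_servers I"
  "start I ''in'' 2 = horizon I"
  by (simp_all add: input_store_def encode_instance_def)

lemma bound_poly: "bound e \<Longrightarrow> \<exists>q :: nat poly. \<forall>I. eval_expr e (start I) \<le> poly q (instance_size I)"
proof (induction e)
  case (Num c)
  then show ?case by (intro exI[of _ "[:c:]"]) simp
next
  case (Cell x a)
  have "num_points I \<le> instance_size I" "num_servers I \<le> instance_size I"
    "horizon I \<le> instance_size I" for I
    using length_le_size[of I] by (simp_all add: length_encode instance_size_def)
  then show ?case using Cell by (intro exI[of _ "[:0, 1:]"]) auto
next
  case (Add a c)
  then obtain q q' where "eval_expr a (start I) \<le> poly q (instance_size I)"
    "eval_expr c (start I) \<le> poly q' (instance_size I)" for I by auto
  then show ?case by (intro exI[of _ "q + q'"]) (simp add: add_mono)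
next
  case (Mul a c)
  then obtain q q' where "eval_expr a (start I) \<le> poly q (instance_size I)"
    "eval_expr c (start I) \<le> poly q' (instance_size I)" for I by auto
  then show ?case by (intro exI[of _ "q * q'"]) (simp add: mult_le_mono)
qed auto

lemma steps_poly: "wf_cmd c \<Longrightarrow> \<exists>q :: nat poly. \<forall>I. steps c (start I) \<le> poly q (instance_size I)"
proof (induction c)
  case (Sq c d)
  then obtain q q' where "steps c (start I) \<le> poly q (instance_size I)"
    "steps d (start I) \<le> poly q' (instance_size I)" for I by auto
  then show ?case by (intro exI[of _ "q + q'"]) (simp add: add_mono)
next
  case (Ite e c d)
  then obtain q q' where "steps c (start I) \<le> poly q (instance_size I)"
    "steps d (start I) \<le> poly q' (instance_size I)" for I by auto
  then show ?case by (intro exI[of _ "1 + q + q'"]) (simp add: add_mono)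
next
  case (For x l e c)
  then obtain q q' where "eval_expr e (start I) \<le> poly q (instance_size I)"
    "steps c (start I) \<le> poly q' (instance_size I)" for I
    using bound_poly[of e] by auto
  then show ?case
    by (intro exI[of _ "2 + q * (2 + q')"]) (simp add: mult_le_mono add_mono numeral_poly)
qed (auto intro: exI[of _ 1])

lemma compile_poly_time:
  assumes "wf_cmd c"
  shows "\<exists>q :: nat poly. \<forall>I. \<exists>\<tau> \<le> poly q (instance_size I).
    exec (compile c) (start I) \<tau> (run c (start I))"
proof -
  obtain q :: "nat poly" where q: "steps c (start I) \<le> poly q (instance_size I)" for I
    using steps_poly[OF assms] by blast
  let ?X = "[:0, 1:] :: nat poly" and ?z = "csize c"
  let ?Q = "[:?z:] * (1 + ?X + [:?z:] * ?X * (q + 1)) * q"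
  have "\<exists>\<tau> \<le> poly ?Q (instance_size I). exec (compile c) (start I) \<tau> (run c (start I))" for I
  proof -
    let ?b = "instance_size I"
    have "?b \<ge> 1" using length_le_size[of I] by (simp add: length_encode)
    \<comment> \<open>The size of the instance bounds the lengths of all numbers in the initial
      store, so it serves both as \<open>m\<close> and as \<open>b\<close>.\<close>
    then obtain \<tau> where \<tau>: "exec (compile c) (start I) \<tau> (run c (start I))"
      "\<tau> \<le> ?z * (1 + ?b + ?z * ?b * (steps c (start I) + 1)) * steps c (start I)"
      using compile_exec[OF assms, of "start I" ?b ?b ?z] input_bits by blast
    note \<tau>(2)
    also have "\<dots> \<le> ?z * (1 + ?b + ?z * ?b * (poly q ?b + 1)) * poly q ?b"
      using q by (intro mult_le_mono add_mono) auto
    also have "\<dots> = poly ?Q ?b" by (simp add: algebra_simps)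
    finally show ?thesis using \<tau>(1) by blast
  qed
  then show ?thesis by blast
qed

section \<open>Plans, rounds and rounding\<close>

text \<open>Requests are numbered from 1; \<open>pv t\<close> is the previous request to the page of request \<open>t\<close>,
  or 0. A class of servers is named by one of its members: \<open>cl i\<close> is the class of server \<open>i\<close>.\<close>

locale kserver =
  fixes k T :: nat and sg wt p0 cl pv :: "nat \<Rightarrow> nat"
  assumes k_pos: "0 < k"
    and cl_less: "i < k \<Longrightarrow> cl i < k"
    and wt_cl: "i < k \<Longrightarrow> wt (cl i) = wt i"
    and cl_cong: "i < k \<Longrightarrow> i' < k \<Longrightarrow> wt i = wt i' \<Longrightarrow> cl i = cl i'"
    and pv_less: "t \<in> {1..T} \<Longrightarrow> pv t < t"
    and sg_pv: "t \<in> {1..T} \<Longrightarrow> 0 < pv t \<Longrightarrow> sg (pv t) = sg t"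
    and pv_last: "t \<in> {1..T} \<Longrightarrow> pv t < \<tau> \<Longrightarrow> \<tau> < t \<Longrightarrow> sg \<tau> \<noteq> sg t"
begin

definition reps :: "nat set" where "reps = {j. j < k \<and> cl j = j}"
definition ell :: nat where "ell = card reps"
definition kk :: "nat \<Rightarrow> nat" where "kk j = card {i. i < k \<and> cl i = j}"
definition ini :: "nat \<Rightarrow> nat \<Rightarrow> bool" where "ini t j \<longleftrightarrow> (\<exists>i<k. cl i = j \<and> p0 i = sg t)"

text \<open>A plan \<open>(s, b)\<close> serves request \<open>t\<close> by class \<open>s t\<close>; \<open>b t\<close> holds iff a server of this class stays at the
  page from the previous request (or time 0) on. Otherwise a server is fetched.\<close>

definition win :: "(nat \<Rightarrow> bool) \<Rightarrow> nat \<Rightarrow> nat \<Rightarrow> bool" where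
  "win b t \<tau> \<longleftrightarrow> \<tau> \<le> t \<and> (\<tau> = t \<or> b t \<and> pv t < \<tau>)"
definition plan :: "(nat \<Rightarrow> nat) \<Rightarrow> (nat \<Rightarrow> bool) \<Rightarrow> bool" where
  "plan s b \<longleftrightarrow> (\<forall>t\<in>{1..T}. s t \<in> reps \<and> (b t \<longrightarrow> (if pv t = 0 then ini t (s t) else s (pv t) = s t)))"
text \<open>Windows are half open, \<open>(pv t, t]\<close>: at time \<open>pv t\<close> the page is
  already accounted for by request \<open>pv t\<close>, and a page that is kept is never counted
  twice.\<close>

definition load :: "(nat \<Rightarrow> nat) \<Rightarrow> (nat \<Rightarrow> bool) \<Rightarrow> nat \<Rightarrow> nat \<Rightarrow> nat" where
  "load s b j \<tau> = card {t \<in> {1..T}. s t = j \<and> win b t \<tau>}"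
definition fcost :: "(nat \<Rightarrow> nat) \<Rightarrow> (nat \<Rightarrow> bool) \<Rightarrow> nat" where
  "fcost s b = (\<Sum>t=1..T. if b t then 0 else wt (s t))"

lemma finite_reps [simp]: "finite reps" by (simp add: reps_def)

lemma cl_reps: "i < k \<Longrightarrow> cl i \<in> reps"
  unfolding reps_def using cl_less[of i] cl_cong[of "cl i" i] wt_cl[of i] by simp

lemma ell_pos: "0 < ell"
  unfolding ell_def using cl_reps[OF k_pos] by (auto simp: card_gt_0_iff)

lemma kk_pos: "j \<in> reps \<Longrightarrow> 0 < kk j"
  unfolding kk_def reps_def by (auto simp: card_gt_0_iff)

lemma kk_le: "kk j \<le> k"
proof -
  have "kk j \<le> card {..<k}" unfolding kk_def by (intro card_mono) auto
  then show ?thesis by simp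
qed

lemma load_le: "load s b j \<tau> \<le> T"
proof -
  have "load s b j \<tau> \<le> card {1..T}" unfolding load_def by (intro card_mono) auto
  then show ?thesis by simp
qed

text \<open>Of two requests to one page, the earlier is at most the predecessor \<open>pv\<close> of
  the later one. Hence the intervals \<open>(pv t, t]\<close> of the requests to one page are
  disjoint.\<close>

lemma same_window:
  assumes "t \<in> {1..T}" "t' \<in> {1..T}" "sg t = sg t'" "pv t < \<tau>" "\<tau> \<le> t" "pv t' < \<tau>" "\<tau> \<le> t'"
  shows "t = t'"
proof (rule ccontr)
  assume "t \<noteq> t'"
  then consider "t < t'" | "t' < t" by linarith
  then show False
  proof cases
    case 1 then show ?thesis using pv_last[of t' t] assms by auto
  next
    case 2 then show ?thesis using pv_last[of t t'] assms by auto
  qed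
qed

lemma pv_inj:
  assumes "t \<in> {1..T}" "t' \<in> {1..T}" "pv t = pv t'" "0 < pv t"
  shows "t = t'"
proof (rule same_window[of t t' "Suc (pv t)"])
  show "sg t = sg t'" using assms sg_pv by metis
qed (use assms pv_less[of t] pv_less[of t'] in auto)

definition ends :: "nat set" where "ends = {1..T} - pv ` {1..T}"

text \<open>\<open>pv\<close> links the requests to each page into a chain down to 0 and is
  injective where it is positive. Each chain telescopes to the value at its last request, and the
  last requests are those that are nobody's predecessor.\<close>

lemma telescope:
  fixes G :: "nat \<Rightarrow> int"
  assumes "G 0 = 0"
  shows "(\<Sum>t=1..T. G t - G (pv t)) = sum G ends"
proof -
  let ?P = "{t \<in> {1..T}. 0 < pv t}"
  have sub: "pv ` ?P \<subseteq> {1..T}" using pv_less by fastforce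
  have "(\<Sum>t=1..T. G (pv t)) = (\<Sum>t\<in>?P. G (pv t))"
    using assms by (intro sum.mono_neutral_right) auto
  also have "\<dots> = sum G (pv ` ?P)"
    using pv_inj by (subst sum.reindex) (auto simp: inj_on_def)
  finally have "(\<Sum>t=1..T. G t - G (pv t)) = sum G {1..T} - sum G (pv ` ?P)"
    by (simp add: sum_subtractf)
  also have "\<dots> = sum G ({1..T} - pv ` ?P)" using sub by (simp add: sum_diff)
  also have "{1..T} - pv ` ?P = ends" unfolding ends_def by auto
  finally show ?thesis .
qed

definition pcost :: "(nat \<Rightarrow> nat \<Rightarrow> nat) \<Rightarrow> (nat \<Rightarrow> nat \<Rightarrow> nat) \<Rightarrow> (nat \<Rightarrow> nat) \<Rightarrow> (nat \<Rightarrow> bool) \<Rightarrow> nat" where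
  "pcost F H s b = (\<Sum>t=1..T. if b t then H t (s t) else F t (s t))"

end

text \<open>What the shortest path commands compute, stated without stores. Chains of different
  pages do not interact, so \<open>D t j\<close> is the least cost of the requests up to
  \<open>t\<close> to the page of \<open>t\<close>, given that class \<open>j\<close> serves
  \<open>t\<close>; \<open>E t\<close> minimizes over the allowed classes. The plan is read off
  backwards: a hit forces the class of the preceding request, and otherwise the minimizer
  \<open>ar\<close> is taken.\<close>

locale dyn_prog = kserver +
  fixes okf okh hit :: "nat \<Rightarrow> nat \<Rightarrow> bool" and F H D :: "nat \<Rightarrow> nat \<Rightarrow> nat" and E ar s :: "nat \<Rightarrow> nat" and b :: "nat \<Rightarrow> bool"
  assumes okf_less: "t \<in> {1..T} \<Longrightarrow> okf t j \<Longrightarrow> j < k"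
    and okh_okf: "t \<in> {1..T} \<Longrightarrow> j < k \<Longrightarrow> okh t j \<Longrightarrow> okf t j"
    and okh_pv: "t \<in> {1..T} \<Longrightarrow> j < k \<Longrightarrow> okh t j \<Longrightarrow> 0 < pv t \<Longrightarrow> okf (pv t) j"
    and E0: "E 0 = 0" and D0: "j < k \<Longrightarrow> D 0 j = 0"
    and hit: "t \<in> {1..T} \<Longrightarrow> j < k \<Longrightarrow> hit t j \<longleftrightarrow> okh t j \<and> D (pv t) j + H t j < E (pv t) + F t j"
    and D: "t \<in> {1..T} \<Longrightarrow> j < k \<Longrightarrow> D t j = (if hit t j then D (pv t) j + H t j else E (pv t) + F t j)"
    and ar: "t \<in> {1..T} \<Longrightarrow> okf t (ar t) \<and> E t = D t (ar t)"
    and E_le: "t \<in> {1..T} \<Longrightarrow> okf t j \<Longrightarrow> E t \<le> D t j"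
    and b: "t \<in> {1..T} \<Longrightarrow> b t \<longleftrightarrow> hit t (s t)"
    and s_pv: "t \<in> {1..T} \<Longrightarrow> 0 < pv t \<Longrightarrow> b t \<Longrightarrow> s (pv t) = s t"
    and s_ar: "t \<in> {1..T} \<Longrightarrow> (\<And>t'. t' \<in> {1..T} \<Longrightarrow> pv t' = t \<Longrightarrow> \<not> b t') \<Longrightarrow> s t = ar t"
begin

lemma okf_s: "t \<in> {1..T} \<Longrightarrow> okf t (s t)"
proof (induction "T - t" arbitrary: t rule: less_induct)
  case less
  show ?case
  proof (cases "\<exists>t'\<in>{1..T}. pv t' = t \<and> b t'")
    case True
    then obtain t' where t': "t' \<in> {1..T}" "pv t' = t" "b t'" by blast
    have "okf t' (s t')" using less.hyps[of t'] pv_less[of t'] t' less.prems by auto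
    then have "s t' < k" using okf_less t' by blast
    then have "okh t' (s t')" using hit b t' by blast
    then have "okf t (s t')" using okh_pv[of t' "s t'"] t' \<open>s t' < k\<close> less.prems by auto
    then show ?thesis using s_pv[of t'] t' less.prems by auto
  next
    case False
    then show ?thesis using s_ar[of t] ar[of t] less.prems by auto
  qed
qed

lemma s_less: "t \<in> {1..T} \<Longrightarrow> s t < k"
  using okf_s okf_less by blast

lemma okh_s: "t \<in> {1..T} \<Longrightarrow> b t \<Longrightarrow> okh t (s t)"
  using hit[of t "s t"] b[of t] s_less by blast

text \<open>A fetch starts from \<open>E (pv t)\<close>. A hit has nonnegative cost and requires
  \<open>j\<close> to be allowed already at \<open>pv t\<close>, where \<open>E\<close> is minimal.
  The monotonicity of \<open>E\<close> along chains that follows is used for the amortization in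
  \<open>final_cost\<close>.\<close>

lemma E_pv: "t \<in> {1..T} \<Longrightarrow> okf t j \<Longrightarrow> E (pv t) \<le> D t j"
proof -
  assume t: "t \<in> {1..T}" and j: "okf t j"
  have jk: "j < k" using okf_less t j by blast
  have "E (pv t) \<le> D (pv t) j" if "okh t j"
  proof (cases "pv t = 0")
    case True then show ?thesis using E0 by simp
  next
    case False
    then have "pv t \<in> {1..T}" using pv_less[OF t] t by auto
    then show ?thesis using okh_pv[OF t jk that] E_le False by simp
  qed
  then show ?thesis using D[OF t jk] hit[OF t jk] by auto
qed

lemma E_mono: "t \<in> {1..T} \<Longrightarrow> E (pv t) \<le> E t"
  using E_pv[of t "ar t"] ar[of t] by auto

lemma D_le_fetch: "t \<in> {1..T} \<Longrightarrow> j < k \<Longrightarrow> D t j \<le> E (pv t) + F t j"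
  using D[of t j] hit[of t j] by auto

lemma D_le_hit: "t \<in> {1..T} \<Longrightarrow> j < k \<Longrightarrow> okh t j \<Longrightarrow> D t j \<le> D (pv t) j + H t j"
  using D[of t j] hit[of t j] by auto

text \<open>With \<open>D t (s t)\<close> as potential, every request pays exactly the increment.
  For a fetch this uses that no hit follows the preceding request, whose class is therefore the
  minimizer \<open>ar\<close>.\<close>

lemma pcost_eq: "int (pcost F H s b) = (\<Sum>t\<in>ends. int (E t))"
proof -
  let ?G = "\<lambda>t. if t = 0 then 0 else int (D t (s t))"
  have "(if b t then H t (s t) else F t (s t)) = ?G t - ?G (pv t)" if t: "t \<in> {1..T}" for t
  proof (cases "b t")
    case True
    have "D t (s t) = D (pv t) (s t) + H t (s t)" using D[OF t s_less[OF t]] True b[OF t] by simp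
    then show ?thesis using s_pv[OF t _ True] D0[OF s_less[OF t]] True t by auto
  next
    case False
    have "D t (s t) = E (pv t) + F t (s t)" using D[OF t s_less[OF t]] False b[OF t] by simp
    moreover have "s (pv t) = ar (pv t)" "E (pv t) = D (pv t) (ar (pv t))" if "pv t \<noteq> 0"
    proof -
      have p: "pv t \<in> {1..T}" using pv_less[OF t] t that by auto
      show "s (pv t) = ar (pv t)" using s_ar[OF p] pv_inj[OF _ t] False that by auto
      show "E (pv t) = D (pv t) (ar (pv t))" using ar[OF p] by simp
    qed
    ultimately show ?thesis using False E0 t by auto
  qed
  then have "int (pcost F H s b) = (\<Sum>t=1..T. ?G t - ?G (pv t))"
    unfolding pcost_def of_nat_sum by (intro sum.cong) auto
  also have "\<dots> = sum ?G ends" by (rule telescope) simp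
  also have "\<dots> = (\<Sum>t\<in>ends. int (E t))"
  proof (intro sum.cong refl)
    fix t assume t: "t \<in> ends"
    then have "t \<in> {1..T}" by (auto simp: ends_def)
    moreover from this have "s t = ar t" by (rule s_ar) (use t in \<open>auto simp: ends_def\<close>)
    ultimately    show "?G t = int (E t)" using ar[of t] by auto
  qed
  finally show ?thesis .
qed

text \<open>Weak duality: along any admissible plan the potential \<open>D t (s' t)\<close> rises by
  at most the cost of the request, and at the end of each chain it is at least
  \<open>E\<close>.\<close>

lemma pcost_le:
  assumes "\<And>t. t \<in> {1..T} \<Longrightarrow> okf t (s' t)"
    and "\<And>t. t \<in> {1..T} \<Longrightarrow> b' t \<Longrightarrow> okh t (s' t)"
    and "\<And>t. t \<in> {1..T} \<Longrightarrow> b' t \<Longrightarrow> 0 < pv t \<Longrightarrow> s' (pv t) = s' t"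
  shows "pcost F H s b \<le> pcost F H s' b'"
proof -
  let ?G = "\<lambda>t. if t = 0 then 0 else int (D t (s' t))"
  have "?G t - ?G (pv t) \<le> (if b' t then H t (s' t) else F t (s' t))" if t: "t \<in> {1..T}" for t
  proof -
    have k: "s' t < k" using okf_less[OF t assms(1)[OF t]] .
    have p: "E (pv t) \<le> D (pv t) (s' (pv t))" if "pv t \<noteq> 0"
      using E_le[of "pv t" "s' (pv t)"] assms(1)[of "pv t"] pv_less[OF t] t that by auto
    show ?thesis
    proof (cases "b' t")
      case True
      then show ?thesis using D_le_hit[OF t k assms(2)[OF t True]] assms(3)[OF t True] D0[OF k] t by auto
    next
      case False
      then show ?thesis using D_le_fetch[OF t k] p E0 t by auto
    qed
  qed
  then have "(\<Sum>t=1..T. ?G t - ?G (pv t)) \<le> int (pcost F H s' b')"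
    unfolding pcost_def of_nat_sum by (intro sum_mono) auto
  moreover have "(\<Sum>t=1..T. ?G t - ?G (pv t)) = sum ?G ends" by (rule telescope) simp
  moreover have "(\<Sum>t\<in>ends. int (E t)) \<le> sum ?G ends"
    using E_le assms(1) by (intro sum_mono) (auto simp: ends_def)
  ultimately show ?thesis using pcost_eq by linarith
qed

end

section \<open>Plans within the capacities from solutions\<close>

context kserver
begin

text \<open>Choosing the servers backwards in time makes every fetched server one that arrives after the
  previous request, so that no arrival pays for two fetches.\<close>

lemma backward_choice:
  assumes serve: "\<And>t. t \<in> {1..T} \<Longrightarrow> \<exists>i<k. f i t = sg t"
  shows "\<exists>a. \<forall>t\<in>{1..T}. a t < k \<and> f (a t) t = sg t \<and>
    (0 < pv t \<and> (\<forall>\<tau>\<in>{pv t..t}. f (a t) \<tau> = sg t) \<longrightarrow> a (pv t) = a t)"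
proof -
  \<comment> \<open>Only the requests after \<open>T - d\<close> are assigned so far; a request is
    tied to its predecessor only if both are assigned.\<close>
  have "\<exists>a. \<forall>t\<in>{1..T}. T < t + d \<longrightarrow> a t < k \<and> f (a t) t = sg t \<and>
    (0 < pv t \<and> T < pv t + d \<and> (\<forall>\<tau>\<in>{pv t..t}. f (a t) \<tau> = sg t) \<longrightarrow> a (pv t) = a t)" for d
  proof (induction d)
    case (Suc d)
    then obtain a where a: "a t < k" "f (a t) t = sg t"
        "0 < pv t \<Longrightarrow> T < pv t + d \<Longrightarrow> \<forall>\<tau>\<in>{pv t..t}. f (a t) \<tau> = sg t \<Longrightarrow> a (pv t) = a t"
      if "t \<in> {1..T}" "T < t + d" for t by blast
    define x where "x = T - d"
    show ?case
    proof (cases "x = 0")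
      case True
      have "pv t + d \<noteq> T" "t + d \<noteq> T" if "0 < pv t" "0 < t" for t
        using True that by (auto simp: x_def)
      then have "T < t + d" if "T < t + Suc d" "t \<in> {1..T}" for t
        using that True by (auto simp: x_def)
      moreover have "T < pv t + d" if "T < pv t + Suc d" "0 < pv t" for t
        using that True by (auto simp: x_def)
      ultimately show ?thesis using a by (intro exI[of _ a]) blast
    next
      case False
      then have xd: "x + d = T" "x \<in> {1..T}" by (auto simp: x_def)
      have "\<exists>v. v < k \<and> f v x = sg x \<and>
        (\<forall>t\<in>{1..T}. pv t = x \<and> (\<forall>\<tau>\<in>{pv t..t}. f (a t) \<tau> = sg t) \<longrightarrow> v = a t)"
      proof (cases "\<exists>t\<in>{1..T}. pv t = x \<and> (\<forall>\<tau>\<in>{pv t..t}. f (a t) \<tau> = sg t)")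
        case True
        then obtain t where t: "t \<in> {1..T}" "pv t = x" "\<forall>\<tau>\<in>{pv t..t}. f (a t) \<tau> = sg t" by blast
        have "x < t" using pv_less[OF t(1)] t(2) by simp
        then have "a t < k" "f (a t) x = sg x"
          using a(1)[of t] t xd sg_pv[of t] by auto
        \<comment> \<open>At most one request has predecessor \<open>x\<close>, so no two demands on
          the choice at \<open>x\<close> can conflict.\<close>
        moreover have "t' = t" if "t' \<in> {1..T}" "pv t' = x" for t'
          using pv_inj[of t' t] that t xd by auto
        ultimately show ?thesis by blast
      next
        case False
        then show ?thesis using serve[OF xd(2)] by blast
      qed
      then obtain v where v: "v < k" "f v x = sg x"
        "\<And>t. t \<in> {1..T} \<Longrightarrow> pv t = x \<Longrightarrow> \<forall>\<tau>\<in>{pv t..t}. f (a t) \<tau> = sg t \<Longrightarrow> v = a t" by blast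
      have "(a(x := v)) t < k \<and> f ((a(x := v)) t) t = sg t \<and>
        (0 < pv t \<and> T < pv t + Suc d \<and> (\<forall>\<tau>\<in>{pv t..t}. f ((a(x := v)) t) \<tau> = sg t) \<longrightarrow>
          (a(x := v)) (pv t) = (a(x := v)) t)" if t: "t \<in> {1..T}" "T < t + Suc d" for t
      proof (cases "t = x")
        case True
        then have "\<not> T < pv t + Suc d" using pv_less[OF t(1)] xd by auto
        then show ?thesis using True v by auto
      next
        case False
        then have "T < t + d" using t xd by auto
        then show ?thesis using a[OF t(1)] False v(3)[OF t(1)] xd by auto
      qed
      then show ?thesis by blast
    qed
  qed auto
  from this[of "Suc T"] obtain a where a: "\<forall>t\<in>{1..T}. T < t + Suc T \<longrightarrow> a t < k \<and> f (a t) t = sg t \<and>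
    (0 < pv t \<and> T < pv t + Suc T \<and> (\<forall>\<tau>\<in>{pv t..t}. f (a t) \<tau> = sg t) \<longrightarrow> a (pv t) = a t)" by blast
  show ?thesis using a by (intro exI[of _ a]) auto
qed

text \<open>A request is a hit iff its chosen server has stayed at the page since the previous
  request or time 0. Otherwise this server arrives at the page within the window of the request, and
  the fetch is charged to this arrival. Distinct requests in one class whose windows are open at the
  same time use distinct servers, whence the bound on the load.\<close>

lemma plan_of_solution:
  assumes start: "\<And>i. i < k \<Longrightarrow> f i 0 = p0 i"
    and serve: "\<And>t. t \<in> {1..T} \<Longrightarrow> \<exists>i<k. f i t = sg t"
  shows "\<exists>s b. plan s b \<and> (\<forall>j \<tau>. \<tau> \<in> {1..T} \<longrightarrow> load s b j \<tau> \<le> kk j) \<and>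
    fcost s b \<le> (\<Sum>i<k. wt i * card {t \<in> {1..T}. f i t \<noteq> f i (t - 1)})"
proof -
  obtain a where a: "a t < k" "f (a t) t = sg t"
      "0 < pv t \<Longrightarrow> \<forall>\<tau>\<in>{pv t..t}. f (a t) \<tau> = sg t \<Longrightarrow> a (pv t) = a t"
    if "t \<in> {1..T}" for t using backward_choice[of f] serve by blast
  define s where "s t = cl (a t)" for t
  define b where "b t \<longleftrightarrow> (\<forall>\<tau>\<in>{pv t..t}. f (a t) \<tau> = sg t)" for t
  have "plan s b"
    unfolding plan_def
  proof (intro ballI conjI impI)
    fix t assume t: "t \<in> {1..T}"
    show "s t \<in> reps" using a(1)[OF t] by (simp add: s_def cl_reps)
    assume bt: "b t"
    show "if pv t = 0 then ini t (s t) else s (pv t) = s t"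
      using bt a(1,3)[OF t] start[of "a t"] by (auto simp: ini_def s_def b_def)
  qed
  moreover have "load s b j \<tau> \<le> kk j" if \<tau>: "\<tau> \<in> {1..T}" for j \<tau>
    unfolding load_def kk_def
  proof (rule card_inj_on_le)
    show "inj_on a {t \<in> {1..T}. s t = j \<and> win b t \<tau>}"
    proof (rule inj_onI)
      fix t t' assume tt: "t \<in> {t \<in> {1..T}. s t = j \<and> win b t \<tau>}"
        "t' \<in> {t \<in> {1..T}. s t = j \<and> win b t \<tau>}" "a t = a t'"
      have w: "f (a t) \<tau> = sg t \<and> pv t < \<tau> \<and> \<tau> \<le> t" if "t \<in> {1..T}" "win b t \<tau>" for t
        using that a(2)[of t] pv_less[of t] unfolding win_def b_def by auto
      show "t = t'" using tt w[of t] w[of t'] by (intro same_window[of t t' \<tau>]) auto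
    qed
  qed (use a in \<open>auto simp: s_def\<close>)
  moreover have "fcost s b \<le> (\<Sum>i<k. wt i * card {t \<in> {1..T}. f i t \<noteq> f i (t - 1)})"
  proof -
    let ?A = "{t \<in> {1..T}. \<not> b t}"
    let ?M = "SIGMA i:{..<k}. {t \<in> {1..T}. f i t \<noteq> f i (t - 1)}"
    have "\<exists>\<tau>. pv t < \<tau> \<and> \<tau> \<le> t \<and> f (a t) \<tau> = sg t \<and> f (a t) (\<tau> - 1) \<noteq> sg t" if t: "t \<in> ?A" for t
    proof (rule ccontr)
      assume no: "\<not> ?thesis"
      have "f (a t) (t - d) = sg t" if "pv t + d \<le> t" for d
        using that
      proof (induction d)
        case 0 then show ?case using a t by simp
      next
        case (Suc d)
        then have "f (a t) (t - d) = sg t" "pv t < t - d" "t - d \<le> t" by auto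
        then have "f (a t) (t - d - 1) = sg t" using no by blast
        then show ?case by simp
      qed
      note bk = this
      have "f (a t) \<tau> = sg t" if "\<tau> \<in> {pv t..t}" for \<tau>
      proof -
        have "pv t + (t - \<tau>) \<le> t" "t - (t - \<tau>) = \<tau>" using that by auto
        then show ?thesis using bk[of "t - \<tau>"] by simp
      qed
      then show False using t by (auto simp: b_def)
    qed
    then have "\<forall>t\<in>?A. \<exists>\<tau>. pv t < \<tau> \<and> \<tau> \<le> t \<and> f (a t) \<tau> = sg t \<and> f (a t) (\<tau> - 1) \<noteq> sg t" by blast
    from bchoice[OF this] obtain m where
      m: "pv t < m t" "m t \<le> t" "f (a t) (m t) = sg t" "f (a t) (m t - 1) \<noteq> sg t"
      if "t \<in> ?A" for t by blast
    \<comment> \<open>Server and arrival time determine the page, and windows of one page are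
      disjoint, so they determine the request.\<close>
    have inj: "inj_on (\<lambda>t. (a t, m t)) ?A"
    proof (rule inj_onI)
      fix t t' assume tt: "t \<in> ?A" "t' \<in> ?A" "(a t, m t) = (a t', m t')"
      then have "sg t = sg t'" using m(3) by (metis prod.inject)
      then show "t = t'" using tt m(1,2)[of t] m(1,2)[of t'] by (intro same_window[of t t' "m t"]) auto
    qed
    have "fcost s b = (\<Sum>t\<in>?A. wt (s t))"
      unfolding fcost_def by (intro sum.mono_neutral_cong_right) auto
    also have "\<dots> = (\<Sum>t\<in>?A. wt (a t))"
      using a(1) by (intro sum.cong) (auto simp: s_def wt_cl)
    also have "\<dots> = (\<Sum>(i, \<tau>)\<in>(\<lambda>t. (a t, m t)) ` ?A. wt i)"
      using inj by (subst sum.reindex) auto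
    also have "\<dots> \<le> (\<Sum>(i, \<tau>)\<in>?M. wt i)"
    proof (rule sum_mono2)
      show "(\<lambda>t. (a t, m t)) ` ?A \<subseteq> ?M"
      proof
        fix y assume "y \<in> (\<lambda>t. (a t, m t)) ` ?A"
        then obtain t where t: "t \<in> ?A" "y = (a t, m t)" by blast
        then show "y \<in> ?M" using m[OF t(1)] a(1)[of t] by auto
      qed
    qed auto
    also have "\<dots> = (\<Sum>i<k. \<Sum>t\<in>{t \<in> {1..T}. f i t \<noteq> f i (t - 1)}. wt i)"
      by (subst sum.Sigma) auto
    also have "\<dots> = (\<Sum>i<k. wt i * card {t \<in> {1..T}. f i t \<noteq> f i (t - 1)})"
      by (simp add: mult.commute)
    finally show ?thesis .
  qed
  ultimately show ?thesis by blast
qed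

end

section \<open>Drift and penalty over the rounds\<close>

context kserver
begin

text \<open>\<open>U\<close> accumulates loads over the rounds: request \<open>\<tau>\<close> counts
  in every round in which \<open>j\<close> serves it, a later request with an open window only in
  the rounds in which it is a hit. \<open>TC\<close> accumulates the fetching costs.\<close>

definition U :: "(nat \<Rightarrow> nat \<Rightarrow> nat) \<Rightarrow> (nat \<Rightarrow> nat \<Rightarrow> nat) \<Rightarrow> nat \<Rightarrow> nat \<Rightarrow> nat" where
  "U y h j \<tau> = y \<tau> j + (\<Sum>t\<in>{t \<in> {1..T}. pv t < \<tau> \<and> \<tau> < t}. h t j)"
definition TC :: "(nat \<Rightarrow> nat \<Rightarrow> nat) \<Rightarrow> (nat \<Rightarrow> nat \<Rightarrow> nat) \<Rightarrow> nat" where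
  "TC y h = (\<Sum>t=1..T. \<Sum>j\<in>reps. wt j * (y t j - h t j))"
definition DD :: nat where "DD = T * k * (T + k) ^ 2"

text \<open>\<open>DD\<close> bounds the sum of the squared changes of the queues in one round, for \<open>B = 1\<close>. After
  \<open>900 * DD\<close> rounds the queues are at most a tenth of the number of rounds, see \<open>check_passes\<close>.

  \<open>y t j\<close> and \<open>h t j\<close> count the rounds in which class \<open>j\<close> serves request \<open>t\<close>, and those in which it
  does so without a fetch; \<open>Q t j\<close> is \<open>B\<close> times the queue of excess load.\<close>

definition rinv :: "nat \<Rightarrow> nat \<Rightarrow> nat \<Rightarrow> (nat \<Rightarrow> nat \<Rightarrow> nat) \<Rightarrow> (nat \<Rightarrow> nat \<Rightarrow> nat) \<Rightarrow> (nat \<Rightarrow> nat \<Rightarrow> nat) \<Rightarrow> bool" where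
  "rinv B opt r Q y h \<longleftrightarrow>
     (\<Sum>t=1..T. \<Sum>j\<in>reps. (Q t j)\<^sup>2) + 8 * DD * B * TC y h \<le> r * (8 * DD * B * opt + B\<^sup>2 * DD) \<and>
     (\<forall>\<tau>\<in>{1..T}. \<forall>j\<in>reps. B * U y h j \<tau> \<le> r * B * kk j + Q \<tau> j) \<and>
     (\<forall>t\<in>{1..T}. (\<Sum>j\<in>reps. y t j) = r) \<and>
     (\<forall>t\<in>{1..T}. \<forall>j\<in>reps. h t j \<le> y t j \<and> (0 < pv t \<longrightarrow> h t j \<le> y (pv t) j) \<and> (pv t = 0 \<longrightarrow> 0 < h t j \<longrightarrow> ini t j))"

lemma DD_pos: "0 < T \<Longrightarrow> 0 < DD"
  using k_pos by (simp add: DD_def)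

lemma load_split:
  assumes "\<tau> \<in> {1..T}"
  shows "load s b j \<tau> = of_bool (s \<tau> = j) + (\<Sum>t\<in>{t \<in> {1..T}. pv t < \<tau> \<and> \<tau> < t}. of_bool (s t = j \<and> b t))"
proof -
  have "load s b j \<tau> = (\<Sum>t=1..T. of_bool (s t = j \<and> win b t \<tau>))"
    unfolding load_def by (subst sum_of_bool_eq) (auto intro!: arg_cong[where f = card])
  also have "\<dots> = of_bool (s \<tau> = j \<and> win b \<tau> \<tau>) + (\<Sum>t\<in>{1..T}-{\<tau>}. of_bool (s t = j \<and> win b t \<tau>))"
    using assms by (intro sum.remove) auto
  also have "(\<Sum>t\<in>{1..T}-{\<tau>}. of_bool (s t = j \<and> win b t \<tau>)) =
      (\<Sum>t\<in>{t \<in> {1..T}. pv t < \<tau> \<and> \<tau> < t}. of_bool (s t = j \<and> b t) :: nat)"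
    by (intro sum.mono_neutral_cong_right) (auto simp: win_def)
  finally show ?thesis by (simp add: win_def)
qed

text \<open>Cutting off at 0 can only decrease the square, and the quadratic term is controlled
  because arrivals \<open>l\<close> and departures \<open>c\<close> are both at most
  \<open>N\<close>.\<close>

lemma queue_sq:
  fixes q B l c N :: nat
  assumes "l \<le> N" "c \<le> N"
  shows "int ((q + B * l - B * c)\<^sup>2) \<le> int (q\<^sup>2) + 2 * int B * (int (q * l) - int (q * c)) + int (B\<^sup>2 * N\<^sup>2)"
proof -
  let ?x = "int q + int B * int l - int B * int c"
  have "int (q + B * l - B * c) \<le> \<bar>?x\<bar>" by (cases "B * c \<le> q + B * l") (auto simp: of_nat_diff)
  then have "int ((q + B * l - B * c)\<^sup>2) \<le> ?x\<^sup>2"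
    by (metis abs_le_square_iff abs_of_nat of_nat_power)
  also have "?x\<^sup>2 = int (q\<^sup>2) + 2 * int B * (int (q * l) - int (q * c)) + (int B)\<^sup>2 * (int l - int c)\<^sup>2"
    by (simp add: power2_eq_square algebra_simps)
  also have "(int l - int c)\<^sup>2 \<le> (int N)\<^sup>2" using assms by (intro abs_le_square_iff[THEN iffD1]) auto
  then have "(int B)\<^sup>2 * (int l - int c)\<^sup>2 \<le> int (B\<^sup>2 * N\<^sup>2)" by (simp add: mult_left_mono)
  finally show ?thesis by simp
qed

text \<open>\<open>hyp\<close> says that at the current prices the plan of the round is no worse
  than a plan of cost \<open>opt\<close> whose loads stay within \<open>kk\<close>. Multiplied by
  \<open>2 * B\<close> it bounds the linear part of the drift of the squared queues, which is the
  source of the factor \<open>8 * DD * B\<close> in front of \<open>TC\<close> and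
  \<open>opt\<close>.\<close>

lemma rinv_step:
  assumes inv: "rinv B opt r Q y h" and p: "plan s b"
    and hyp: "4 * DD * fcost s b + (\<Sum>t=1..T. \<Sum>j\<in>reps. Q t j * load s b j t)
      \<le> 4 * DD * opt + (\<Sum>t=1..T. \<Sum>j\<in>reps. Q t j * kk j)"
    and Q': "\<And>t j. t \<in> {1..T} \<Longrightarrow> j \<in> reps \<Longrightarrow> Q' t j = Q t j + B * load s b j t - B * kk j"
    and y': "\<And>t j. t \<in> {1..T} \<Longrightarrow> j \<in> reps \<Longrightarrow> y' t j = y t j + of_bool (s t = j)"
    and h': "\<And>t j. t \<in> {1..T} \<Longrightarrow> j \<in> reps \<Longrightarrow> h' t j = h t j + of_bool (s t = j \<and> b t)"
  shows "rinv B opt (Suc r) Q' y' h'"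
proof -
  have hy: "h t j \<le> y t j" "0 < pv t \<Longrightarrow> h t j \<le> y (pv t) j" "pv t = 0 \<Longrightarrow> 0 < h t j \<Longrightarrow> ini t j"
    if "t \<in> {1..T}" "j \<in> reps" for t j using inv that unfolding rinv_def by blast+
  have s: "s t \<in> reps" if "t \<in> {1..T}" for t using p that by (auto simp: plan_def)
  have TC: "TC y' h' = TC y h + fcost s b"
  proof -
    have "(\<Sum>j\<in>reps. wt j * (y' t j - h' t j)) =
        (\<Sum>j\<in>reps. wt j * (y t j - h t j)) + (if b t then 0 else wt (s t))" if t: "t \<in> {1..T}" for t
    proof -
      have "wt j * (y' t j - h' t j) = wt j * (y t j - h t j) + (if j = s t then (if b t then 0 else wt (s t)) else 0)"
        if "j \<in> reps" for j
        using hy(1)[OF t that] y'[OF t that] h'[OF t that]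
        by (auto simp: Suc_diff_le add_mult_distrib2)
      then show ?thesis using s[OF t] by (simp add: sum.distrib)
    qed
    then show ?thesis unfolding TC_def fcost_def by (simp add: sum.distrib)
  qed
  have U: "U y' h' j \<tau> = U y h j \<tau> + load s b j \<tau>" if "\<tau> \<in> {1..T}" "j \<in> reps" for j \<tau>
    unfolding U_def load_split[OF that(1)] using that by (simp add: y' h' sum.distrib)
  have "int (\<Sum>t=1..T. \<Sum>j\<in>reps. (Q' t j)\<^sup>2) \<le> (\<Sum>t=1..T. \<Sum>j\<in>reps. int ((Q t j)\<^sup>2) +
      2 * int B * (int (Q t j * load s b j t) - int (Q t j * kk j)) + int (B\<^sup>2 * (T + k)\<^sup>2))"
    unfolding of_nat_sum
    by (intro sum_mono) (use Q' load_le kk_le in \<open>auto intro!: queue_sq intro: trans_le_add1 trans_le_add2 simp del: of_nat_add of_nat_mult of_nat_power\<close>)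
  also have "\<dots> = int (\<Sum>t=1..T. \<Sum>j\<in>reps. (Q t j)\<^sup>2) +
      2 * int B * (int (\<Sum>t=1..T. \<Sum>j\<in>reps. Q t j * load s b j t) - int (\<Sum>t=1..T. \<Sum>j\<in>reps. Q t j * kk j)) +
      int (\<Sum>t=1..T. \<Sum>j\<in>reps. B\<^sup>2 * (T + k)\<^sup>2)"
    unfolding of_nat_sum by (simp add: sum.distrib sum_subtractf sum_distrib_left right_diff_distrib)
  also have "\<dots> \<le> int (\<Sum>t=1..T. \<Sum>j\<in>reps. (Q t j)\<^sup>2) +
      2 * int B * (4 * int DD * int opt - 4 * int DD * int (fcost s b)) + int (B\<^sup>2 * DD)"
  proof (intro add_mono mult_left_mono order_refl)
    have "int (4 * DD * fcost s b + (\<Sum>t=1..T. \<Sum>j\<in>reps. Q t j * load s b j t))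
      \<le> int (4 * DD * opt + (\<Sum>t=1..T. \<Sum>j\<in>reps. Q t j * kk j))" using hyp by (rule of_nat_mono)
    then show "int (\<Sum>t=1..T. \<Sum>j\<in>reps. Q t j * load s b j t) - int (\<Sum>t=1..T. \<Sum>j\<in>reps. Q t j * kk j)
      \<le> 4 * int DD * int opt - 4 * int DD * int (fcost s b)" by simp
    \<comment> \<open>There are at most \<open>T * k\<close> queues, each with a quadratic term of
      at most \<open>B\<^sup>2 * (T + k)\<^sup>2\<close>. This is the origin of
      \<open>DD\<close>.\<close>
    have "card reps \<le> card {..<k}" by (intro card_mono) (auto simp: reps_def)
    then show "int (\<Sum>t=1..T. \<Sum>j\<in>reps. B\<^sup>2 * (T + k)\<^sup>2) \<le> int (B\<^sup>2 * DD)"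
      unfolding DD_def by (intro of_nat_mono) (simp add: mult_mono)
  qed simp
  finally have "int ((\<Sum>t=1..T. \<Sum>j\<in>reps. (Q' t j)\<^sup>2) + 8 * DD * B * TC y' h') \<le>
      int ((\<Sum>t=1..T. \<Sum>j\<in>reps. (Q t j)\<^sup>2) + 8 * DD * B * TC y h + (8 * DD * B * opt + B\<^sup>2 * DD))"
    unfolding TC by (simp add: algebra_simps)
  then have "(\<Sum>t=1..T. \<Sum>j\<in>reps. (Q' t j)\<^sup>2) + 8 * DD * B * TC y' h' \<le>
      (\<Sum>t=1..T. \<Sum>j\<in>reps. (Q t j)\<^sup>2) + 8 * DD * B * TC y h + (8 * DD * B * opt + B\<^sup>2 * DD)"
    by (simp only: of_nat_le_iff)
  moreover have "(\<Sum>t=1..T. \<Sum>j\<in>reps. (Q t j)\<^sup>2) + 8 * DD * B * TC y h \<le> r * (8 * DD * B * opt + B\<^sup>2 * DD)"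
    using inv by (simp add: rinv_def)
  ultimately have 1: "(\<Sum>t=1..T. \<Sum>j\<in>reps. (Q' t j)\<^sup>2) + 8 * DD * B * TC y' h' \<le>
      Suc r * (8 * DD * B * opt + B\<^sup>2 * DD)" unfolding mult_Suc by linarith
  have 2: "B * U y' h' j \<tau> \<le> Suc r * B * kk j + Q' \<tau> j" if "\<tau> \<in> {1..T}" "j \<in> reps" for j \<tau>
  proof -
    have "B * U y h j \<tau> \<le> r * B * kk j + Q \<tau> j" using inv that by (auto simp: rinv_def)
    then show ?thesis unfolding U[OF that] Q'[OF that] by (simp add: add_mult_distrib2 add_mult_distrib)
  qed
  have 3: "(\<Sum>j\<in>reps. y' t j) = Suc r" if t: "t \<in> {1..T}" for t
  proof -
    have "(\<Sum>j\<in>reps. y' t j) = (\<Sum>j\<in>reps. y t j) + (\<Sum>j\<in>reps. if s t = j then 1 else 0)"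
      unfolding sum.distrib[symmetric] by (intro sum.cong) (auto simp: y'[OF t])
    also have "\<dots> = Suc r" using inv t s[OF t] by (simp add: rinv_def)
    finally show ?thesis .
  qed
  have 4: "h' t j \<le> y' t j" "0 < pv t \<Longrightarrow> h' t j \<le> y' (pv t) j" "pv t = 0 \<Longrightarrow> 0 < h' t j \<Longrightarrow> ini t j"
    if t: "t \<in> {1..T}" and j: "j \<in> reps" for t j
  proof -
    show "h' t j \<le> y' t j" using hy(1)[OF t j] by (simp add: y'[OF t j] h'[OF t j])
    show "h' t j \<le> y' (pv t) j" if "0 < pv t"
    proof -
      have "pv t \<in> {1..T}" using that pv_less[OF t] t by auto
      moreover have "s t = j \<and> b t \<Longrightarrow> s (pv t) = j" using p t that by (auto simp: plan_def)
      ultimately show ?thesis using hy(2)[OF t j that] j by (auto simp: y' h'[OF t j])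
    qed
    show "ini t j" if "pv t = 0" "0 < h' t j"
      using hy(3)[OF t j] that p t by (cases "s t = j \<and> b t") (auto simp: h'[OF t j] plan_def)
  qed
  show ?thesis unfolding rinv_def using 1 2 3 4 by blast
qed

text \<open>A hit pays the queues of its class at all moments of its window, a fetch only at its own
  moment. Collecting these payments by moment and class gives queues times loads.\<close>

lemma pcost_prices:
  assumes "\<And>t. t \<in> {1..T} \<Longrightarrow> s t \<in> reps"
    and F: "\<And>t j. t \<in> {1..T} \<Longrightarrow> j \<in> reps \<Longrightarrow> F t j = A * wt j + Q t j"
    and H: "\<And>t j. t \<in> {1..T} \<Longrightarrow> j \<in> reps \<Longrightarrow> H t j = (\<Sum>\<tau>\<in>{pv t<..t}. Q \<tau> j)"
  shows "pcost F H s b = A * fcost s b + (\<Sum>\<tau>=1..T. \<Sum>j\<in>reps. Q \<tau> j * load s b j \<tau>)"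
proof -
  have "(if b t then H t (s t) else F t (s t)) =
      A * (if b t then 0 else wt (s t)) + (\<Sum>\<tau>=1..T. Q \<tau> (s t) * of_bool (win b t \<tau>))" if t: "t \<in> {1..T}" for t
  proof (cases "b t")
    case True
    have "(\<Sum>\<tau>=1..T. Q \<tau> (s t) * of_bool (win b t \<tau>)) = (\<Sum>\<tau>\<in>{pv t<..t}. Q \<tau> (s t))"
      using t True pv_less[OF t] by (intro sum.mono_neutral_cong_right) (auto simp: win_def)
    then show ?thesis using True H[OF t assms(1)[OF t]] by simp
  next
    case False
    have "(\<Sum>\<tau>=1..T. Q \<tau> (s t) * of_bool (win b t \<tau>)) = (\<Sum>\<tau>\<in>{t}. Q \<tau> (s t))"
      using t False by (intro sum.mono_neutral_cong_right) (auto simp: win_def)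
    then show ?thesis using False F[OF t assms(1)[OF t]] by simp
  qed
  then have "pcost F H s b = A * fcost s b + (\<Sum>t=1..T. \<Sum>\<tau>=1..T. Q \<tau> (s t) * of_bool (win b t \<tau>))"
    unfolding pcost_def fcost_def by (simp add: sum.distrib sum_distrib_left)
  also have "(\<Sum>t=1..T. \<Sum>\<tau>=1..T. Q \<tau> (s t) * of_bool (win b t \<tau>)) =
      (\<Sum>\<tau>=1..T. \<Sum>t=1..T. Q \<tau> (s t) * of_bool (win b t \<tau>))" by (rule sum.swap)
  also have "\<dots> = (\<Sum>\<tau>=1..T. \<Sum>j\<in>reps. Q \<tau> j * load s b j \<tau>)"
  proof (rule sum.cong[OF refl])
    fix \<tau>
    have "(\<Sum>j\<in>reps. Q \<tau> j * load s b j \<tau>) = (\<Sum>j\<in>reps. \<Sum>t=1..T. Q \<tau> j * of_bool (s t = j \<and> win b t \<tau>))"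
      unfolding load_def sum_distrib_left[symmetric]
      by (subst sum_of_bool_eq) (auto intro!: sum.cong arg_cong[where f = card])
    also have "\<dots> = (\<Sum>t=1..T. \<Sum>j\<in>reps. Q \<tau> j * of_bool (s t = j \<and> win b t \<tau>))" by (rule sum.swap)
    also have "\<dots> = (\<Sum>t=1..T. Q \<tau> (s t) * of_bool (win b t \<tau>))"
    proof (intro sum.cong refl)
      fix t assume t: "t \<in> {1..T}"
      have "(\<Sum>j\<in>reps. Q \<tau> j * of_bool (s t = j \<and> win b t \<tau>)) =
          (\<Sum>j\<in>reps. if s t = j then Q \<tau> (s t) * of_bool (win b t \<tau>) else 0)"
        by (intro sum.cong) auto
      then show "(\<Sum>j\<in>reps. Q \<tau> j * of_bool (s t = j \<and> win b t \<tau>)) = Q \<tau> (s t) * of_bool (win b t \<tau>)"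
        using assms(1)[OF t] by simp
    qed
    finally show "(\<Sum>t=1..T. Q \<tau> (s t) * of_bool (win b t \<tau>)) = (\<Sum>j\<in>reps. Q \<tau> j * load s b j \<tau>)" by (rule sym)
  qed
  finally show ?thesis .
qed

text \<open>For \<open>opt \<le> B\<close> the squared queues sum to at most
  \<open>9 * R * DD * B\<^sup>2\<close> after \<open>R\<close> rounds. This is at most
  \<open>(R * B / 10)\<^sup>2\<close> as soon as \<open>R\<close> is at least
  \<open>900 * DD\<close>.\<close>

lemma check_passes:
  assumes inv: "rinv B opt (900 * DD) Q y h" and "opt \<le> B" "t \<in> {1..T}" "j \<in> reps"
  shows "10 * Q t j \<le> 900 * DD * B"
proof -
  have "(Q t j)\<^sup>2 \<le> (\<Sum>j\<in>reps. (Q t j)\<^sup>2)" using assms by (intro member_le_sum) auto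
  also have "\<dots> \<le> (\<Sum>t=1..T. \<Sum>j\<in>reps. (Q t j)\<^sup>2)"
    using assms(3) by (intro member_le_sum[of t "{1..T}" "\<lambda>t. \<Sum>j\<in>reps. (Q t j)\<^sup>2"]) auto
  also have "\<dots> \<le> 900 * DD * (8 * DD * B * opt + B\<^sup>2 * DD)" using inv by (simp add: rinv_def)
  also have "\<dots> \<le> 900 * DD * (8 * DD * B * B + B\<^sup>2 * DD)" using assms(2) by (intro mult_le_mono add_mono) auto
  finally have "(10 * Q t j)\<^sup>2 \<le> (900 * DD * B)\<^sup>2" by (simp add: power2_eq_square algebra_simps)
  then show ?thesis by (rule power2_le_imp_le) simp
qed

text \<open>Let \<open>w\<close> be the largest fetched weight. Passing to the next multiple of
  \<open>w\<close> at most doubles the cost, since \<open>w\<close> is itself part of it, and the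
  multiplier is at most \<open>T\<close> because there are at most \<open>T\<close> fetches. The
  second inequality is what turns the bound of \<open>final_cost\<close> into the factor 4.\<close>

lemma guess:
  assumes "plan s b"
  shows "\<exists>j<k. \<exists>c\<le>T. fcost s b \<le> 1 + wt j * c \<and>
    160 * fcost s b + 20 * (1 + wt j * c) < 72 * (4 * fcost s b + 1)"
proof (cases "fcost s b = 0")
  case True
  then show ?thesis using k_pos by (intro exI[of _ 0] conjI) auto
next
  case False
  let ?f = "\<lambda>t. if b t then 0 else wt (s t)"
  have ne: "{1..T} \<noteq> {}" using False unfolding fcost_def by (metis sum.empty)
  define w where "w = Max (?f ` {1..T})"
  have "w \<in> ?f ` {1..T}" unfolding w_def
    by (rule Max_in, simp, use ne in blast)
  then obtain t where t: "t \<in> {1..T}" "w = ?f t" by blast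
  have le: "fcost s b \<le> T * w"
  proof -
    have "fcost s b \<le> (\<Sum>t=1..T. w)" unfolding fcost_def w_def by (intro sum_mono Max_ge) auto
    then show ?thesis by simp
  qed
  have "w \<le> fcost s b" unfolding fcost_def t(2) using t(1) by (intro member_le_sum[of t "{1..T}" ?f]) auto
  moreover have w0: "w > 0" using le False by (cases w) auto
  then have "w = wt (s t)" "s t < k" using t assms by (auto simp: plan_def reps_def split: if_splits)
  moreover have "w * (fcost s b div w) \<le> fcost s b" "fcost s b \<le> w * (fcost s b div w) + w"
    using mult_div_mod_eq[of w "fcost s b"] mod_less_divisor[OF w0, of "fcost s b"] by linarith+
  moreover have "fcost s b div w \<le> T" using le w0
    by (metis div_le_mono nonzero_mult_div_cancel_right neq0_conv)
  ultimately show ?thesis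
  proof (cases "fcost s b div w = T")
    \<comment> \<open>Here the cost is exactly \<open>T * w\<close>, and the next multiple would lie
      outside the range of \<open>c\<close>.\<close>
    case True
    then show ?thesis using le \<open>w = wt (s t)\<close> \<open>s t < k\<close> \<open>w * (fcost s b div w) \<le> fcost s b\<close> False
      by (intro exI[of _ "s t"] conjI exI[of _ T]) (auto simp: mult.commute)
  next
    case F: False
    then have "Suc (fcost s b div w) \<le> T" using \<open>fcost s b div w \<le> T\<close> by simp
    moreover have "160 * fcost s b + 20 * (1 + w * Suc (fcost s b div w)) < 72 * (4 * fcost s b + 1)"
    proof -
      have "160 * n + 20 * (1 + (w + x)) < 72 * (4 * n + 1)" if "x \<le> n" "w \<le> n" for n x :: nat
      proof -
        have "20 * (1 + (w + x)) \<le> 20 * (1 + (n + n))" using that by (intro mult_le_mono2 add_mono) auto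
        moreover have "160 * n + 20 * (1 + (n + n)) < 72 * (4 * n + 1)" by simp
        ultimately show ?thesis by linarith
      qed
      then show ?thesis using \<open>w * (fcost s b div w) \<le> fcost s b\<close> \<open>w \<le> fcost s b\<close>
        unfolding mult_Suc_right by blast
    qed
    moreover have "fcost s b \<le> 1 + w * Suc (fcost s b div w)"
      using \<open>fcost s b \<le> w * (fcost s b div w) + w\<close> by simp
    ultimately show ?thesis using \<open>w = wt (s t)\<close> \<open>s t < k\<close> by metis
  qed
qed

end

section \<open>Rounding the average of the rounds by thresholds\<close>

locale final_prog = dyn_prog +
  fixes B opt R :: nat and Q y h :: "nat \<Rightarrow> nat \<Rightarrow> nat"
  assumes inv: "rinv B opt R Q y h" and R_pos: "0 < R" and B_pos: "0 < B" and T_pos: "0 < T"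
    and okf_final: "t \<in> {1..T} \<Longrightarrow> okf t j \<longleftrightarrow> j \<in> reps \<and> 11 * R \<le> 20 * (ell * y t j)"
    and okh_final: "t \<in> {1..T} \<Longrightarrow> j < k \<Longrightarrow> okh t j \<longleftrightarrow> j \<in> reps \<and> 11 * R \<le> 20 * (ell * h t j)"
    and F_final: "t \<in> {1..T} \<Longrightarrow> j \<in> reps \<Longrightarrow> F t j = wt j"
    and H_final: "t \<in> {1..T} \<Longrightarrow> j \<in> reps \<Longrightarrow> H t j = 0"
begin

lemma h_le_y: "t \<in> {1..T} \<Longrightarrow> j \<in> reps \<Longrightarrow> h t j \<le> y t j"
    "t \<in> {1..T} \<Longrightarrow> j \<in> reps \<Longrightarrow> 0 < pv t \<Longrightarrow> h t j \<le> y (pv t) j"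
    "t \<in> {1..T} \<Longrightarrow> j \<in> reps \<Longrightarrow> pv t = 0 \<Longrightarrow> 0 < h t j \<Longrightarrow> ini t j"
  using inv unfolding rinv_def by blast+

text \<open>A hit above the threshold was a hit in at least one round; if it is the first request to
  its page, the class has a server starting there.\<close>

lemma final_plan: "plan s b"
  unfolding plan_def
proof (intro ballI conjI impI)
  fix t assume t: "t \<in> {1..T}"
  show r: "s t \<in> reps" using okf_s[OF t] okf_final[OF t] by blast
  assume b: "b t"
  then have "11 * R \<le> 20 * (ell * h t (s t))"
    using okh_s[OF t b] okh_final[OF t s_less[OF t]] by blast
  then have "0 < h t (s t)" using R_pos by (cases "h t (s t)") auto
  then show "if pv t = 0 then ini t (s t) else s (pv t) = s t"
    using h_le_y(3)[OF t r] s_pv[OF t _ b] by auto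
qed

text \<open>Every request that contributes to the load was counted in at least
  \<open>11 * R / (20 * ell)\<close> rounds, request \<open>\<tau>\<close> through \<open>y\<close>
  and the later ones through \<open>h\<close>. By \<open>check\<close> and
  \<open>kk j \<ge> 1\<close> these counts sum to at most \<open>11/10 * R * kk j\<close>, and the
  quotient is \<open>2 * ell * kk j\<close>.\<close>

lemma final_load:
  assumes \<tau>: "\<tau> \<in> {1..T}" and j: "j \<in> reps" and check: "10 * Q \<tau> j \<le> R * B"
  shows "load s b j \<tau> \<le> 2 * ell * kk j"
proof -
  let ?P = "{t \<in> {1..T}. pv t < \<tau> \<and> \<tau> < t}"
  have y: "11 * R * of_bool (s t = j) \<le> 20 * (ell * y t j)" if "t \<in> {1..T}" for t
    using okf_s[OF that] okf_final[OF that] by auto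
  have h: "11 * R * of_bool (s t = j \<and> b t) \<le> 20 * (ell * h t j)" if "t \<in> {1..T}" for t
    using okh_s[OF that] okh_final[OF that s_less[OF that]] by auto
  have "11 * R * load s b j \<tau> = 11 * R * of_bool (s \<tau> = j) + (\<Sum>t\<in>?P. 11 * R * of_bool (s t = j \<and> b t))"
    unfolding load_split[OF \<tau>] by (simp only: add_mult_distrib2 sum_distrib_left)
  also have "\<dots> \<le> 20 * (ell * y \<tau> j) + (\<Sum>t\<in>?P. 20 * (ell * h t j))"
    using \<tau> by (intro add_mono sum_mono y h) auto
  also have "\<dots> = 2 * ell * (10 * U y h j \<tau>)"
    unfolding U_def by (simp add: sum_distrib_left algebra_simps)
  also have "10 * U y h j \<tau> \<le> 11 * R * kk j"
  proof -
    have "B * U y h j \<tau> \<le> R * B * kk j + Q \<tau> j" using inv \<tau> j unfolding rinv_def by blast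
    then have "B * (10 * U y h j \<tau>) \<le> 10 * (R * B * kk j + Q \<tau> j)" by simp
    also have "\<dots> \<le> 10 * (R * B * kk j) + R * B" using check by simp
    also have "\<dots> \<le> 10 * (R * B * kk j) + R * B * kk j" using kk_pos[OF j] by simp
    also have "\<dots> = B * (11 * R * kk j)" by simp
    finally show ?thesis using B_pos by simp
  qed
  finally have "11 * R * load s b j \<tau> \<le> 11 * R * (2 * ell * kk j)" by (simp add: algebra_simps)
  then show ?thesis using R_pos by (simp only: mult_le_cancel1)
qed

text \<open>A class keeps the part of its fractional service above the threshold. Each unit of this part pays
  for the increments of the optimal cost \<open>E\<close> while it lasts, and these sum up to at most the weight
  paid for fetching it; \<open>tr t j * (D t j - E t)\<close> is the unspent part.\<close>

lemma final_cost: "72 * pcost F H s b \<le> 160 * opt + 20 * B"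
proof -
  \<comment> \<open>The excess of \<open>y t j\<close> over the threshold, scaled by
    \<open>20 * ell\<close>. Truncation makes it 0 for classes that are not allowed at
    \<open>t\<close>.\<close>
  define tr where "tr t j = 20 * (ell * y t j) - 11 * R" for t j
  define G where "G j t = (if t = 0 then 0 else int (tr t j) * (int (D t j) - int (E t)))" for j t
  have G0: "0 \<le> G j t" if "t = 0 \<or> t \<in> {1..T}" "j \<in> reps" for j t
  proof (cases "t = 0 \<or> tr t j = 0")
    case False
    then have "okf t j" using okf_final[of t j] that by (auto simp: tr_def)
    then show ?thesis using E_le[of t j] that by (auto simp: G_def)
  qed (auto simp: G_def)
  have pv0: "pv t = 0 \<or> pv t \<in> {1..T}" if "t \<in> {1..T}" for t using pv_less[OF that] that by auto
  have step: "(int (E t) - int (E (pv t))) * int (tr t j) + (G j t - G j (pv t)) \<le>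
      20 * int ell * int (wt j * (y t j - h t j))" if t: "t \<in> {1..T}" and j: "j \<in> reps" for t j
  proof -
    have jk: "j < k" using j by (simp add: reps_def)
    have "int (tr t j) * (int (D t j) - int (E (pv t))) - G j (pv t) \<le>
      20 * int ell * int (wt j * (y t j - h t j))"
    proof (cases "tr t j = 0")
      case True
      then have "int (tr t j) * (int (D t j) - int (E (pv t))) - G j (pv t) \<le> 0"
        using G0[OF pv0[OF t] j] by simp
      also have "0 \<le> 20 * int ell * int (wt j * (y t j - h t j))" by simp
      finally show ?thesis .
    next
      case False
      then have okf: "okf t j" using okf_final[OF t] j by (auto simp: tr_def)
      define trh where "trh = 20 * (ell * h t j) - 11 * R"
      have "20 * (ell * y t j) = 20 * (ell * h t j) + 20 * (ell * (y t j - h t j))"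
        using h_le_y(1)[OF t j] by (metis add_mult_distrib2 le_add_diff_inverse)
      \<comment> \<open>The excess at \<open>t\<close> splits into units continuing by hits,
        \<open>trh\<close>, and fetched units. For the former \<open>D t j \<le> D (pv t) j\<close>,
        because hits are free here, so they spend what is left from \<open>pv t\<close>. For the
        latter \<open>D t j - E (pv t) \<le> wt j\<close>, which their fetch pays.\<close>
      then have tr: "tr t j \<le> trh + 20 * (ell * (y t j - h t j))" unfolding tr_def trh_def by linarith
      let ?x = "int (D t j) - int (E (pv t))"
      have x: "0 \<le> ?x" "?x \<le> int (wt j)"
        using E_pv[OF t okf] D_le_fetch[OF t jk] F_final[OF t j] by auto
      have "int (tr t j) * ?x \<le> int (trh + 20 * (ell * (y t j - h t j))) * ?x"
        using tr x(1) by (intro mult_right_mono of_nat_mono)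
      also have "\<dots> = int trh * ?x + int (20 * (ell * (y t j - h t j))) * ?x"
        by (simp add: distrib_right)
      also have "\<dots> \<le> G j (pv t) + int (20 * (ell * (y t j - h t j))) * int (wt j)"
      proof (intro add_mono mult_left_mono x)
        show "int trh * ?x \<le> G j (pv t)"
        proof (cases "trh = 0")
          case True
          then show ?thesis using G0[OF pv0[OF t] j] by simp
        next
          case False
          then have "okh t j" using okh_final[OF t jk] j by (auto simp: trh_def)
          then have D: "D t j \<le> D (pv t) j" using D_le_hit[OF t jk] H_final[OF t j] by simp
          show ?thesis
          proof (cases "pv t = 0")
            case True
            then show ?thesis using D D0[OF jk] E0 x(1) by (simp add: G_def)
          next
            case p: False
            have "trh \<le> tr (pv t) j" unfolding trh_def tr_def using h_le_y(2)[OF t j] p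
              by (intro diff_le_mono mult_le_mono) auto
            then have "int trh * ?x \<le> int (tr (pv t) j) * (int (D (pv t) j) - int (E (pv t)))"
              using D x by (intro mult_mono) auto
            then show ?thesis using p by (simp add: G_def)
          qed
        qed
      qed simp
      finally show ?thesis by (simp add: mult_ac)
    qed
    then show ?thesis using t by (simp add: G_def algebra_simps)
  qed
  have "(\<Sum>t=1..T. \<Sum>j\<in>reps. (int (E t) - int (E (pv t))) * int (tr t j) + (G j t - G j (pv t))) \<le>
      (\<Sum>t=1..T. \<Sum>j\<in>reps. 20 * int ell * int (wt j * (y t j - h t j)))"
    by (intro sum_mono step)
  also have "\<dots> = 20 * int ell * int (TC y h)" by (simp add: TC_def sum_distrib_left)
  finally have 1: "(\<Sum>t=1..T. (int (E t) - int (E (pv t))) * int (\<Sum>j\<in>reps. tr t j)) +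
      (\<Sum>t=1..T. \<Sum>j\<in>reps. G j t - G j (pv t)) \<le> 20 * int ell * int (TC y h)"
    by (simp add: sum.distrib sum_distrib_left)
  have "(\<Sum>t=1..T. \<Sum>j\<in>reps. G j t - G j (pv t)) = (\<Sum>j\<in>reps. \<Sum>t=1..T. G j t - G j (pv t))"
    by (rule sum.swap)
  also have "\<dots> = (\<Sum>j\<in>reps. sum (G j) ends)"
    by (intro sum.cong telescope refl) (simp add: G_def)
  also have "\<dots> \<ge> 0" using G0 by (intro sum_nonneg) (auto simp: ends_def)
  finally have 2: "(\<Sum>t=1..T. (int (E t) - int (E (pv t))) * int (\<Sum>j\<in>reps. tr t j)) \<le>
      20 * int ell * int (TC y h)" using 1 by linarith
  \<comment> \<open>The counts \<open>y t j\<close> sum to \<open>R\<close>, and each of the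
    \<open>ell\<close> classes loses at most \<open>11 * R\<close> to its threshold:
    \<open>20 * ell * R - 11 * ell * R = 9 * R * ell\<close>.\<close>
  have sum_tr: "9 * R * ell \<le> (\<Sum>j\<in>reps. tr t j)" if t: "t \<in> {1..T}" for t
  proof -
    have "20 * (ell * R) = (\<Sum>j\<in>reps. 20 * (ell * y t j))"
      using inv t by (simp add: rinv_def sum_distrib_left[symmetric])
    also have "\<dots> \<le> (\<Sum>j\<in>reps. tr t j + 11 * R)" unfolding tr_def by (intro sum_mono) simp
    also have "\<dots> = (\<Sum>j\<in>reps. tr t j) + ell * (11 * R)" by (simp add: sum.distrib ell_def)
    finally show ?thesis by (simp add: algebra_simps)
  qed
  have "(\<Sum>t=1..T. (int (E t) - int (E (pv t))) * int (9 * R * ell)) \<le>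
      (\<Sum>t=1..T. (int (E t) - int (E (pv t))) * int (\<Sum>j\<in>reps. tr t j))"
    using E_mono sum_tr by (intro sum_mono mult_left_mono of_nat_mono) auto
  moreover have "(\<Sum>t=1..T. int (E t) - int (E (pv t))) = int (pcost F H s b)"
    unfolding pcost_eq by (rule telescope) (simp add: E0)
  ultimately have "int (pcost F H s b) * int (9 * R * ell) \<le> 20 * int ell * int (TC y h)"
    using 2 by (simp add: sum_distrib_right[symmetric])
  then have "int (ell * (pcost F H s b * (9 * R))) \<le> int (ell * (20 * TC y h))"
    by (simp add: algebra_simps)
  then have 3: "pcost F H s b * (9 * R) \<le> 20 * TC y h" using ell_pos by (simp only: of_nat_le_iff mult_le_cancel1)
  have "8 * DD * B * TC y h \<le> R * (8 * DD * B * opt + B\<^sup>2 * DD)" using inv by (simp add: rinv_def)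
  then have "(DD * B) * (8 * TC y h) \<le> (DD * B) * (R * (8 * opt + B))"
    by (simp add: power2_eq_square algebra_simps)
  then have 4: "8 * TC y h \<le> R * (8 * opt + B)" using DD_pos[OF T_pos] B_pos by simp
  have "R * (72 * pcost F H s b) \<le> R * (160 * opt + 20 * B)"
    using 3 4 by (simp add: algebra_simps)
  then show ?thesis using R_pos by (simp only: mult_le_cancel1)
qed

end

section \<open>Carrying out a plan with individual servers\<close>

locale serving = kserver +
  fixes s :: "nat \<Rightarrow> nat" and b :: "nat \<Rightarrow> bool" and N :: nat and c p hini :: "nat \<Rightarrow> nat"
  assumes plan: "plan s b"
    and capacity: "\<tau> \<in> {1..T} \<Longrightarrow> j \<in> reps \<Longrightarrow> load s b j \<tau> \<le> card {g. g < N \<and> c g = j}"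
    and hini: "t \<in> {1..T} \<Longrightarrow> b t \<Longrightarrow> pv t = 0 \<Longrightarrow> hini t < N \<and> c (hini t) = s t \<and> p (hini t) = sg t"
begin

definition hold :: "(nat \<Rightarrow> nat) \<Rightarrow> nat \<Rightarrow> nat" where
  "hold a t = (if pv t = 0 then hini t else a (pv t))"

text \<open>A fetch must take a server that is not waiting for a hit with an open window. Apart from
  \<open>a t\<close> itself, the condition consults \<open>a\<close> only before \<open>t\<close>,
  so the assignment can be built forwards in time.\<close>

definition good :: "(nat \<Rightarrow> nat) \<Rightarrow> nat \<Rightarrow> bool" where
  "good a t \<longleftrightarrow> a t < N \<and> c (a t) = s t \<and>
    (if b t then a t = hold a t else \<forall>t'\<in>{1..T}. t < t' \<and> b t' \<and> pv t' < t \<longrightarrow> hold a t' \<noteq> a t)"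

lemma hold_class:
  assumes "t \<in> {1..T}" "b t" "0 < pv t \<Longrightarrow> good a (pv t)"
  shows "hold a t < N \<and> c (hold a t) = s t"
proof (cases "pv t = 0")
  case True then show ?thesis using hini[OF assms(1,2)] by (simp add: hold_def)
next
  case False
  then show ?thesis using assms plan by (auto simp: hold_def good_def plan_def)
qed

text \<open>The load at \<open>t\<close> counts request \<open>t\<close> itself, so the open windows
  of the class hold at least one server fewer than the capacity.\<close>

lemma free_server:
  assumes t: "t \<in> {1..T}" and nb: "\<not> b t" and prev: "\<And>t'. t' \<in> {1..<t} \<Longrightarrow> good a t'"
  shows "\<exists>g<N. c g = s t \<and> (\<forall>t'\<in>{1..T}. t < t' \<and> b t' \<and> pv t' < t \<longrightarrow> hold a t' \<noteq> g)"
proof -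
  let ?P = "{t' \<in> {1..T}. s t' = s t \<and> win b t' t}"
  have hc: "hold a t' < N \<and> c (hold a t') = s t'" if "t' \<in> {1..T}" "b t'" "pv t' < t" for t'
    using that by (intro hold_class prev) auto
  have "t \<in> ?P" using t by (auto simp: win_def)
  then have "card (?P - {t}) < card ?P" by (intro psubset_card_mono) auto
  moreover have "card ?P \<le> card {g. g < N \<and> c g = s t}"
    using capacity[OF t, of "s t"] plan t by (auto simp: load_def plan_def)
  moreover have "card (hold a ` (?P - {t})) \<le> card (?P - {t})" by (intro card_image_le) auto
  ultimately have "\<not> {g. g < N \<and> c g = s t} \<subseteq> hold a ` (?P - {t})"
    using card_mono[of "hold a ` (?P - {t})" "{g. g < N \<and> c g = s t}"] by auto
  then obtain g where g: "g < N" "c g = s t" "g \<notin> hold a ` (?P - {t})" by blast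
  have "hold a t' \<noteq> g" if "t' \<in> {1..T}" "t < t'" "b t'" "pv t' < t" for t'
  proof
    assume "hold a t' = g"
    moreover from this have "s t' = s t" using hc[of t'] that g by auto
    ultimately show False using g(3) that by (auto simp: win_def)
  qed
  then show ?thesis using g by blast
qed

fun pos :: "(nat \<Rightarrow> nat) \<Rightarrow> nat \<Rightarrow> nat \<Rightarrow> nat" where
  "pos a g 0 = p g"
| "pos a g (Suc t) = (if a (Suc t) = g then sg (Suc t) else pos a g t)"

context
  fixes a assumes good: "\<And>t. t \<in> {1..T} \<Longrightarrow> good a t"
begin

text \<open>The two windows are followed back to the moment \<open>x\<close> at which the later one
  opens, where its server serves request \<open>x\<close>. If that server was fetched, it was chosen
  apart from the held ones; if it was a hit, it was held before, and induction applies. Windows open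
  since time 0 belong to different pages, so their servers have different initial positions.\<close>

lemma hold_disjoint:
  assumes "t \<in> {1..T}" "t' \<in> {1..T}" "t \<noteq> t'" "b t" "b t'" "pv t < x" "x \<le> t" "pv t' < x" "x \<le> t'"
  shows "hold a t \<noteq> hold a t'"
  using assms
proof (induction x arbitrary: t t')
  case (Suc x)
  have key: "hold a t \<noteq> hold a t'" if a: "t \<in> {1..T}" "t' \<in> {1..T}" "t \<noteq> t'" "b t" "b t'"
      "pv t = x" "x < t" "pv t' \<le> x" "x < t'" and x: "0 < x" for t t'
  proof -
    have xT: "x \<in> {1..T}" using a x by auto
    have p: "pv t' < x" using pv_inj[of t t'] a x by (cases "pv t' = x") auto
    have h: "hold a t = a x" using a x by (simp add: hold_def)
    show ?thesis
    proof (cases "b x")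
      case True
      then have "a x = hold a x" using good[OF xT] by (simp add: good_def)
      moreover have "hold a x \<noteq> hold a t'"
        using Suc.IH[of x t'] xT True a p pv_less[OF xT] by auto
      ultimately show ?thesis using h by simp
    next
      case False
      then show ?thesis using good[OF xT] a p h by (auto simp: good_def)
    qed
  qed
  consider "x = 0" | "0 < x" "pv t = x" | "0 < x" "pv t' = x" | "pv t < x" "pv t' < x"
    using Suc.prems by linarith
  then show ?case
  proof cases
    case 1
    then have "sg t \<noteq> sg t'" using same_window[of t t' 1] Suc.prems by auto
    then show ?thesis using hini[of t] hini[of t'] Suc.prems 1 by (auto simp: hold_def)
  next
    case 2 then show ?thesis using key[of t t'] Suc.prems by auto
  next
    case 3 then show ?thesis using key[of t' t] Suc.prems by auto
  next
    case 4 then show ?thesis using Suc.IH[of t t'] Suc.prems by auto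
  qed
qed auto

lemma pos_hold:
  assumes t: "t \<in> {1..T}" "b t" and "pv t \<le> x" "x < t"
  shows "pos a (hold a t) x = sg t"
  using assms(3,4)
proof (induction x rule: dec_induct)
  case base
  show ?case
  proof (cases "pv t")
    case 0 then show ?thesis using hini[OF t] by (simp add: hold_def)
  next
    case (Suc u) then show ?thesis using sg_pv[OF t(1)] by (simp add: hold_def)
  qed
next
  case (step x)
  have sx: "Suc x \<in> {1..T}" using step t by auto
  have "a (Suc x) \<noteq> hold a t"
  proof (cases "b (Suc x)")
    case True
    then have "a (Suc x) = hold a (Suc x)" using good[OF sx] by (simp add: good_def)
    moreover have "hold a (Suc x) \<noteq> hold a t"
      using hold_disjoint[OF sx t(1) _ True t(2), of "Suc x"] step pv_less[OF sx] by auto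
    ultimately show ?thesis by simp
  next
    case False
    then show ?thesis using good[OF sx] t step by (auto simp: good_def)
  qed
  then show ?case using step by auto
qed

lemma pos_serves: "t \<in> {1..T} \<Longrightarrow> pos a (a t) t = sg t"
  by (cases t) auto

text \<open>A server can move only when it is assigned to a request, and at a hit it is at the page
  already (\<open>pos_hold\<close>).\<close>

lemma pos_cost:
  assumes v: "\<And>t. t \<in> {1..T} \<Longrightarrow> v (a t) = wt (s t)"
  shows "(\<Sum>g<N. v g * card {t \<in> {1..T}. pos a g t \<noteq> pos a g (t - 1)}) \<le> fcost s b"
proof -
  let ?M = "SIGMA g:{..<N}. {t \<in> {1..T}. pos a g t \<noteq> pos a g (t - 1)}"
  let ?A = "{t \<in> {1..T}. \<not> b t}"
  have "(\<Sum>g<N. v g * card {t \<in> {1..T}. pos a g t \<noteq> pos a g (t - 1)}) = (\<Sum>(g, t)\<in>?M. v g)"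
    by (subst sum.Sigma[symmetric]) (auto simp: mult.commute)
  also have "\<dots> \<le> (\<Sum>(g, t)\<in>(\<lambda>t. (a t, t)) ` ?A. v g)"
  proof (rule sum_mono2)
    show "?M \<subseteq> (\<lambda>t. (a t, t)) ` ?A"
    proof clarify
      fix g t assume t: "t \<in> {1..T}" and m: "pos a g t \<noteq> pos a g (t - 1)"
      have g: "a t = g" using m t by (cases t) (auto split: if_splits)
      have "\<not> b t"
      proof
        assume bt: "b t"
        then have "g = hold a t" using good[OF t] g by (simp add: good_def)
        then have "pos a g (t - 1) = sg t" using pos_hold[OF t bt, of "t - 1"] pv_less[OF t] t by auto
        then show False using m pos_serves[OF t] g by simp
      qed
      then show "(g, t) \<in> (\<lambda>t. (a t, t)) ` ?A" using t g by auto
    qed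
  qed auto
  also have "\<dots> = (\<Sum>t\<in>?A. v (a t))" by (subst sum.reindex) (auto simp: inj_on_def)
  also have "\<dots> = (\<Sum>t\<in>?A. wt (s t))" using v by (intro sum.cong) auto
  also have "\<dots> = fcost s b" unfolding fcost_def by (intro sum.mono_neutral_cong_left) auto
  finally show ?thesis .
qed

end

end

section \<open>The program\<close>

text \<open>A folded form of the store update, which lets simplification resolve a lookup by the
  name of the array first.\<close>

definition upd :: "string \<Rightarrow> nat \<Rightarrow> nat \<Rightarrow> store \<Rightarrow> store" where
  "upd x i v s = s(x := (s x)(i := v))"

lemma upd_apply [simp]: "upd x i v s y = (if y = x then (s x)(i := v) else s y)"
  by (simp add: upd_def)

lemma run_upd [simp]:
  "run (Asg x a b) s = upd x (eval_expr a s) (eval_expr b s) s"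
  "run (For x l e c) s = upd x 0 (l + eval_expr e s) (iter (eval_expr e s) (\<lambda>i s. run c (upd x 0 (l + i) s)) s)"
  by (simp_all only: upd_def run.simps)

declare run.simps(2,5) [simp del]

text \<open>The frame condition compares each pass with the store on entry, so that the invariant
  \<open>P\<close> has to mention only what the loop changes.\<close>

lemma For_rule:
  assumes "eval_expr e s = N" and "P l s"
    and "\<And>i s'. l \<le> i \<Longrightarrow> i < l + N \<Longrightarrow> P i s' \<Longrightarrow> (\<And>y. y \<noteq> x \<Longrightarrow> y \<notin> writes c \<Longrightarrow> s' y = s y) \<Longrightarrow>
      P (Suc i) (run c (upd x 0 i s'))"
    and "\<And>s'. P (l + N) s' \<Longrightarrow> (\<And>y. y \<noteq> x \<Longrightarrow> y \<notin> writes c \<Longrightarrow> s' y = s y) \<Longrightarrow> R (upd x 0 (l + N) s')"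
  shows "R (run (For x l e c) s)"
proof -
  let ?F = "\<lambda>i s. run c (upd x 0 (l + i) s)"
  have "P (l + n) (iter n ?F s) \<and> (\<forall>y. y \<noteq> x \<longrightarrow> y \<notin> writes c \<longrightarrow> iter n ?F s y = s y)" if "n \<le> N" for n
    using that
  proof (induction n)
    case (Suc n)
    let ?s = "iter n ?F s"
    have IH: "P (l + n) ?s" "\<And>y. y \<noteq> x \<Longrightarrow> y \<notin> writes c \<Longrightarrow> ?s y = s y"
      using Suc.IH[OF Suc_leD[OF Suc.prems]] by blast+
    have "P (Suc (l + n)) (run c (upd x 0 (l + n) ?s))" using assms(3)[OF _ _ IH] Suc.prems by auto
    moreover have "run c (upd x 0 (l + n) ?s) y = s y" if "y \<noteq> x" "y \<notin> writes c" for y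
      using that IH(2) by (simp add: run_frame)
    ultimately show ?case unfolding iter.simps add_Suc_right by blast
  qed (use assms(2) in auto)
  from this[of N] show ?thesis unfolding run_upd(2) assms(1) using assms(4)[of "iter N ?F s"] by blast
qed

declare run_upd(2) [simp del]

text \<open>For loops whose passes fill separate cells: a pass establishes its own cell and
  preserves the others, which replaces an invariant.\<close>

lemma For_cells:
  assumes "eval_expr e s = N"
    and "\<And>i s'. l \<le> i \<Longrightarrow> i < l + N \<Longrightarrow> s' x 0 = i \<Longrightarrow>
      (\<And>y. y \<noteq> x \<Longrightarrow> y \<notin> writes c \<Longrightarrow> s' y = s y) \<Longrightarrow>
      R i (run c s') \<and> (\<forall>i'. l \<le> i' \<and> i' < l + N \<and> i' \<noteq> i \<and> R i' s' \<longrightarrow> R i' (run c s'))"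
    and "\<And>i v s'. R i s' \<Longrightarrow> R i (upd x 0 v s')"
  shows "l \<le> i \<Longrightarrow> i < l + N \<Longrightarrow> R i (run (For x l e c) s)"
proof -
  have "\<forall>i. l \<le> i \<and> i < l + N \<longrightarrow> R i (run (For x l e c) s)"
  proof (rule For_rule[where P = "\<lambda>n s'. \<forall>i. l \<le> i \<and> i < n \<longrightarrow> R i s'", OF assms(1)])
    fix n s' assume n: "l \<le> n" "n < l + N" "\<forall>i. l \<le> i \<and> i < n \<longrightarrow> R i s'"
      and fr: "\<And>y. y \<noteq> x \<Longrightarrow> y \<notin> writes c \<Longrightarrow> s' y = s y"
    have "R n (run c (upd x 0 n s')) \<and>
      (\<forall>i'. l \<le> i' \<and> i' < l + N \<and> i' \<noteq> n \<and> R i' (upd x 0 n s') \<longrightarrow> R i' (run c (upd x 0 n s')))"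
      using n fr by (intro assms(2)) auto
    then show "\<forall>i. l \<le> i \<and> i < Suc n \<longrightarrow> R i (run c (upd x 0 n s'))"
      using n assms(3)[of _ s' n] by (auto simp: less_Suc_eq )
  next
    fix s' assume "\<forall>i. l \<le> i \<and> i < l + N \<longrightarrow> R i s'"
    then show "\<forall>i. l \<le> i \<and> i < l + N \<longrightarrow> R i (upd x 0 (l + N) s')" using assms(3) by blast
  qed auto
  then show "l \<le> i \<Longrightarrow> i < l + N \<Longrightarrow> R i (run (For x l e c) s)" by blast
qed

definition V :: "string \<Rightarrow> expr" where "V x = Cell x (Num 0)"
definition K :: expr where "K = Cell ''in'' (Num 1)"
definition Tm :: expr where "Tm = Cell ''in'' (Num 2)"
definition I2 :: "expr \<Rightarrow> expr \<Rightarrow> expr" where "I2 t j = Add (Mul t K) j"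
text \<open>With truncated subtraction \<open>1 - e\<close> tests whether \<open>e\<close> is 0. The
  connectives and comparisons below are built from this test and take the values 0 and 1.\<close>

definition NotE :: "expr \<Rightarrow> expr" where "NotE e = Sub (Num 1) e"
definition AndE :: "expr \<Rightarrow> expr \<Rightarrow> expr" where "AndE d e = NotE (Add (NotE d) (NotE e))"
definition OrE :: "expr \<Rightarrow> expr \<Rightarrow> expr" where "OrE d e = NotE (NotE (Add d e))"
definition LtE :: "expr \<Rightarrow> expr \<Rightarrow> expr" where "LtE d e = NotE (NotE (Sub e d))"
definition LeE :: "expr \<Rightarrow> expr \<Rightarrow> expr" where "LeE d e = NotE (LtE e d)"
definition EqE :: "expr \<Rightarrow> expr \<Rightarrow> expr" where "EqE d e = NotE (Add (Sub d e) (Sub e d))"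
definition ModK :: "expr \<Rightarrow> expr" where "ModK e = Sub e (Mul (Div e K) K)"
definition DDe :: expr where "DDe = Mul (Mul Tm K) (Mul (Add Tm K) (Add Tm K))"
definition RRe :: expr where "RRe = Mul (Num 900) DDe"

lemma eval_derived [simp]:
  "eval_expr (V x) s = s x 0"
  "eval_expr K s = s ''in'' (Suc 0)"
  "eval_expr Tm s = s ''in'' 2"
  "eval_expr (I2 d e) s = eval_expr d s * s ''in'' (Suc 0) + eval_expr e s"
  "eval_expr (NotE e) s = of_bool (eval_expr e s = 0)"
  "eval_expr (AndE d e) s = of_bool (eval_expr d s \<noteq> 0 \<and> eval_expr e s \<noteq> 0)"
  "eval_expr (OrE d e) s = of_bool (eval_expr d s \<noteq> 0 \<or> eval_expr e s \<noteq> 0)"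
  "eval_expr (LtE d e) s = of_bool (eval_expr d s < eval_expr e s)"
  "eval_expr (LeE d e) s = of_bool (eval_expr d s \<le> eval_expr e s)"
  "eval_expr (EqE d e) s = of_bool (eval_expr d s = eval_expr e s)"
  "eval_expr (ModK e) s = eval_expr e s mod s ''in'' (Suc 0)"
  "eval_expr DDe s = s ''in'' 2 * s ''in'' (Suc 0) * (s ''in'' 2 + s ''in'' (Suc 0)) ^ 2"
  "eval_expr RRe s = 900 * (s ''in'' 2 * s ''in'' (Suc 0) * (s ''in'' 2 + s ''in'' (Suc 0)) ^ 2)"
  by (auto simp: V_def K_def Tm_def I2_def NotE_def AndE_def OrE_def LtE_def LeE_def EqE_def ModK_def
      DDe_def RRe_def minus_div_mult_eq_mod power2_eq_square)

lemma tame_derived [simp]: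
  "tame (V x)" "tame K" "tame Tm"
  "tame (I2 d e) \<longleftrightarrow> tame d \<and> tame e"
  "tame (NotE e) \<longleftrightarrow> tame e"
  "tame (AndE d e) \<longleftrightarrow> tame d \<and> tame e"
  "tame (OrE d e) \<longleftrightarrow> tame d \<and> tame e"
  "tame (LtE d e) \<longleftrightarrow> tame d \<and> tame e"
  "tame (LeE d e) \<longleftrightarrow> tame d \<and> tame e"
  "tame (EqE d e) \<longleftrightarrow> tame d \<and> tame e"
  "tame (ModK e) \<longleftrightarrow> tame e"
  "tame DDe" "tame RRe"
  by (auto simp: V_def K_def Tm_def I2_def NotE_def AndE_def OrE_def LtE_def LeE_def EqE_def ModK_def
      DDe_def RRe_def)

lemma small_derived [simp]: "small K" "small Tm" "small DDe" "small RRe"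
  by (auto simp: K_def Tm_def DDe_def RRe_def)

lemma bound_derived [simp]: "bound K" "bound Tm" "bound DDe" "bound RRe"
  by (auto simp: K_def Tm_def DDe_def RRe_def)

definition When :: "expr \<Rightarrow> cmd \<Rightarrow> cmd" where "When e c = Ite e c Nop"

lemma When [simp]:
  "run (When e c) s = (if eval_expr e s \<noteq> 0 then run c s else s)"
  "writes (When e c) = writes c" "wf_cmd (When e c) \<longleftrightarrow> tame e \<and> wf_cmd c"
  by (auto simp: When_def)

abbreviation Let0 :: "string \<Rightarrow> expr \<Rightarrow> cmd" where "Let0 x e \<equiv> Asg x (Num 0) e"
notation Sq (infixr ";;" 60)

text \<open>
  Cell \<open>(t, j)\<close> of a two-dimensional array has index \<open>t * k + j\<close>. The arrays \<open>sg\<close>, \<open>wt\<close>, \<open>cl\<close>, \<open>pv\<close> are the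
  parameters of \<open>kserver\<close>; \<open>ini\<close> holds 1 plus a server of class \<open>j\<close> that starts at the page of
  request \<open>t\<close>, or 0. Fetches and hits allowed by \<open>okf\<close> and \<open>okh\<close> cost \<open>F\<close> and \<open>H\<close>; \<open>D\<close> and \<open>E\<close> are the
  resulting distances, \<open>hit\<close> and \<open>ar\<close> record how they arise, and \<open>nd\<close> is 1 plus the class forced
  by a hit at the next request. The plan is \<open>(s, b)\<close>. To avoid products of computed numbers, \<open>y\<close> and
  \<open>h\<close> are multiples of the number \<open>ell\<close> of classes, and \<open>Q\<close> is a multiple of \<open>B\<close>; \<open>yb\<close> and \<open>hb\<close> belong to
  the smallest \<open>B\<close> that passed the check so far. Server \<open>g < gn\<close> of the augmented instance has class
  \<open>gc\<close> and position \<open>pos\<close>, and \<open>asg\<close> is the server of a request.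
\<close>

definition c_wt :: cmd where
  "c_wt = Let0 ''P'' (Num 1) ;;
    For ''i'' 0 K (Let0 ''P'' (Mul (V ''P'') (Cell ''in'' (Add (Mul (V ''i'') (Num 3)) (Num 4))))) ;;
    For ''i'' 0 K (Asg ''wt'' (V ''i'')
      (Mul (Div (V ''P'') (Cell ''in'' (Add (Mul (V ''i'') (Num 3)) (Num 4))))
        (Cell ''in'' (Add (Mul (V ''i'') (Num 3)) (Num 3)))))"

definition c_cl :: cmd where
  "c_cl = For ''i'' 0 K (
      Let0 ''c'' (V ''i'') ;;
      For ''a'' 0 K (When (AndE (EqE (Cell ''wt'' (V ''a'')) (Cell ''wt'' (V ''i''))) (LtE (V ''a'') (V ''c'')))
        (Let0 ''c'' (V ''a''))) ;;
      Asg ''cl'' (V ''i'') (V ''c'')) ;;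
    Let0 ''ell'' (Num 0) ;;
    For ''i'' 0 K (When (EqE (Cell ''cl'' (V ''i'')) (V ''i'')) (Let0 ''ell'' (Add (V ''ell'') (Num 1))))"

definition c_pv :: cmd where
  "c_pv = For ''t'' 1 Tm (Asg ''sg'' (V ''t'') (Cell ''in'' (Add (Add (Mul K (Num 3)) (Num 2)) (V ''t'')))) ;;
    For ''t'' 1 Tm (
      Let0 ''m'' (Num 0) ;;
      For ''a'' 1 Tm (When (AndE (LtE (V ''a'') (V ''t'')) (EqE (Cell ''sg'' (V ''a'')) (Cell ''sg'' (V ''t''))))
        (Let0 ''m'' (V ''a''))) ;;
      Asg ''pv'' (V ''t'') (V ''m''))"

definition c_ini :: cmd where
  "c_ini = For ''t'' 1 Tm (
      For ''j'' 0 K (Asg ''ini'' (I2 (V ''t'') (V ''j'')) (Num 0)) ;;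
      For ''i'' 0 K (When (EqE (Cell ''in'' (Add (Mul (V ''i'') (Num 3)) (Num 5))) (Cell ''sg'' (V ''t'')))
        (Asg ''ini'' (I2 (V ''t'') (Cell ''cl'' (V ''i''))) (Add (V ''i'') (Num 1)))))"

abbreviation C1 :: "string \<Rightarrow> string \<Rightarrow> expr" where "C1 x t \<equiv> Cell x (V t)"
abbreviation C2 :: "string \<Rightarrow> string \<Rightarrow> string \<Rightarrow> expr" where "C2 x t j \<equiv> Cell x (I2 (V t) (V j))"
abbreviation Asg2 :: "string \<Rightarrow> string \<Rightarrow> string \<Rightarrow> expr \<Rightarrow> cmd" where
  "Asg2 x t j e \<equiv> Asg x (I2 (V t) (V j)) e"

definition c_set :: cmd where
  "c_set = For ''t'' 1 Tm (For ''j'' 0 K (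
      Asg2 ''okf'' ''t'' ''j'' (EqE (C1 ''cl'' ''j'') (V ''j'')) ;;
      Asg2 ''okh'' ''t'' ''j'' (AndE (EqE (C1 ''cl'' ''j'') (V ''j'')) (OrE (C1 ''pv'' ''t'') (C2 ''ini'' ''t'' ''j''))) ;;
      Asg2 ''F'' ''t'' ''j'' (Add (Mul (C1 ''wt'' ''j'') (Mul (Num 4) DDe)) (C2 ''Q'' ''t'' ''j'')) ;;
      Let0 ''m'' (Num 0) ;;
      For ''a'' 1 Tm (When (AndE (LtE (C1 ''pv'' ''t'') (V ''a'')) (LeE (V ''a'') (V ''t'')))
        (Let0 ''m'' (Add (V ''m'') (C2 ''Q'' ''a'' ''j'')))) ;;
      Asg2 ''H'' ''t'' ''j'' (V ''m'')))"

definition c_cell :: cmd where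
  "c_cell = Asg2 ''D'' ''t'' ''j'' (Add (Cell ''E'' (C1 ''pv'' ''t'')) (C2 ''F'' ''t'' ''j'')) ;;
    Asg2 ''hit'' ''t'' ''j'' (Num 0) ;;
    When (AndE (C2 ''okh'' ''t'' ''j'')
        (LtE (Add (Cell ''D'' (I2 (C1 ''pv'' ''t'') (V ''j''))) (C2 ''H'' ''t'' ''j'')) (C2 ''D'' ''t'' ''j'')))
      (Asg2 ''D'' ''t'' ''j'' (Add (Cell ''D'' (I2 (C1 ''pv'' ''t'') (V ''j''))) (C2 ''H'' ''t'' ''j'')) ;;
       Asg2 ''hit'' ''t'' ''j'' (Num 1)) ;;
    When (AndE (C2 ''okf'' ''t'' ''j'') (OrE (NotE (V ''fd'')) (LtE (C2 ''D'' ''t'' ''j'') (C1 ''E'' ''t''))))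
      (Asg ''E'' (V ''t'') (C2 ''D'' ''t'' ''j'') ;; Asg ''ar'' (V ''t'') (V ''j'') ;; Let0 ''fd'' (Num 1))"

definition c_dp :: cmd where
  "c_dp = Let0 ''E'' (Num 0) ;; For ''j'' 0 K (Asg ''D'' (V ''j'') (Num 0)) ;;
    For ''t'' 1 Tm (Let0 ''fd'' (Num 0) ;; For ''j'' 0 K c_cell)"

text \<open>Loops count upwards, so the requests are visited in reverse as \<open>T - x\<close>. A
  hit leaves its class in \<open>nd\<close> at the preceding request, which is visited
  later.\<close>

definition c_back :: cmd where
  "c_back = For ''x'' 0 (Add Tm (Num 1)) (Asg ''nd'' (V ''x'') (Num 0)) ;;
    For ''x'' 0 Tm (
      Let0 ''t'' (Sub Tm (V ''x'')) ;;
      Ite (C1 ''nd'' ''t'') (Asg ''s'' (V ''t'') (Sub (C1 ''nd'' ''t'') (Num 1))) (Asg ''s'' (V ''t'') (C1 ''ar'' ''t'')) ;;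
      Asg ''b'' (V ''t'') (Cell ''hit'' (I2 (V ''t'') (C1 ''s'' ''t''))) ;;
      When (C1 ''b'' ''t'') (Asg ''nd'' (C1 ''pv'' ''t'') (Add (C1 ''s'' ''t'') (Num 1))))"

definition c_count :: cmd where
  "c_count = For ''t'' 1 Tm (
      Asg ''y'' (I2 (V ''t'') (C1 ''s'' ''t'')) (Add (Cell ''y'' (I2 (V ''t'') (C1 ''s'' ''t''))) (V ''ell'')) ;;
      When (C1 ''b'' ''t'')
        (Asg ''h'' (I2 (V ''t'') (C1 ''s'' ''t'')) (Add (Cell ''h'' (I2 (V ''t'') (C1 ''s'' ''t''))) (V ''ell''))))"

definition c_load :: cmd where
  "c_load = For ''t'' 1 Tm (For ''a'' 1 Tm (
      When (AndE (LeE (V ''a'') (V ''t'')) (OrE (EqE (V ''a'') (V ''t'')) (AndE (C1 ''b'' ''t'') (LtE (C1 ''pv'' ''t'') (V ''a'')))))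
        (Asg ''Q'' (I2 (V ''a'') (C1 ''s'' ''t'')) (Add (Cell ''Q'' (I2 (V ''a'') (C1 ''s'' ''t''))) (V ''B'')))))"

text \<open>Removing \<open>B\<close> once for each server of the class removes
  \<open>B * kk j\<close> with truncation at 0, and needs no product of computed numbers.\<close>

definition c_drain :: cmd where
  "c_drain = For ''t'' 1 Tm (For ''j'' 0 K (For ''i'' 0 K (
      When (EqE (C1 ''cl'' ''i'') (V ''j'')) (Asg2 ''Q'' ''t'' ''j'' (Sub (C2 ''Q'' ''t'' ''j'') (V ''B''))))))"

definition c_clear :: cmd where
  "c_clear = For ''t'' 1 Tm (For ''j'' 0 K (
      Asg2 ''Q'' ''t'' ''j'' (Num 0) ;; Asg2 ''y'' ''t'' ''j'' (Num 0) ;; Asg2 ''h'' ''t'' ''j'' (Num 0)))"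

definition c_round :: cmd where
  "c_round = c_set ;; c_dp ;; c_back ;; c_count ;; c_load ;; c_drain"

definition c_rounds :: cmd where
  "c_rounds = c_clear ;; For ''r'' 0 RRe c_round"

definition c_check :: cmd where
  "c_check = Let0 ''ok'' (Num 1) ;;
    For ''t'' 1 Tm (For ''j'' 0 K (
      When (AndE (EqE (C1 ''cl'' ''j'') (V ''j'')) (LtE (Mul (V ''B'') RRe) (Mul (C2 ''Q'' ''t'' ''j'') (Num 10))))
        (Let0 ''ok'' (Num 0))))"

definition c_save :: cmd where
  "c_save = For ''t'' 1 Tm (For ''j'' 0 K (
      Asg2 ''yb'' ''t'' ''j'' (C2 ''y'' ''t'' ''j'') ;; Asg2 ''hb'' ''t'' ''j'' (C2 ''h'' ''t'' ''j'')))"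

text \<open>The guesses \<open>1 + wt g * u\<close> for \<open>u \<le> T\<close> are those of the
  lemma \<open>guess\<close>, reached by repeated addition.\<close>

definition c_guess :: cmd where
  "c_guess = Let0 ''best'' (Num 0) ;;
    For ''g'' 0 K (Let0 ''B'' (Num 1) ;;
      For ''u'' 0 (Add Tm (Num 1)) (
        c_rounds ;; c_check ;;
        When (AndE (V ''ok'') (OrE (NotE (V ''best'')) (LtE (V ''B'') (V ''best'')))) (Let0 ''best'' (V ''B'') ;; c_save) ;;
        Let0 ''B'' (Add (V ''B'') (C1 ''wt'' ''g''))))"

definition c_flags :: cmd where
  "c_flags = For ''t'' 1 Tm (For ''j'' 0 K (
      Asg2 ''okf'' ''t'' ''j'' (AndE (EqE (C1 ''cl'' ''j'') (V ''j'')) (LeE (Mul (Num 11) RRe) (Mul (C2 ''yb'' ''t'' ''j'') (Num 20)))) ;;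
      Asg2 ''okh'' ''t'' ''j'' (AndE (EqE (C1 ''cl'' ''j'') (V ''j'')) (LeE (Mul (Num 11) RRe) (Mul (C2 ''hb'' ''t'' ''j'') (Num 20)))) ;;
      Asg2 ''F'' ''t'' ''j'' (C1 ''wt'' ''j'') ;;
      Asg2 ''H'' ''t'' ''j'' (Num 0)))"

text \<open>Loop bounds must be expressions in the input, so \<open>2 * ell * k\<close> is replaced
  by the upper bound \<open>2 * k\<^sup>2\<close> and the bodies test against
  \<open>gn\<close>.\<close>

definition Ge :: expr where "Ge = Mul (Num 2) (Mul K K)"

definition c_prep :: cmd where
  "c_prep = Let0 ''gn'' (Mul (V ''ell'') (Mul (Num 2) K)) ;;
    Asg ''out'' (Num 0) (Sub (V ''gn'') K) ;;
    For ''x'' 0 Ge (When (LtE (V ''x'') (Sub (V ''gn'') K)) (Asg ''out'' (Add (V ''x'') (Num 1)) (ModK (V ''x'')))) ;;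
    For ''g'' 0 Ge (Asg ''pos'' (V ''g'') (Cell ''in'' (Add (Mul (ModK (V ''g'')) (Num 3)) (Num 5))) ;;
      Asg ''gc'' (V ''g'') (Cell ''cl'' (ModK (V ''g''))))"

text \<open>The offset skips the number of copies and the \<open>gn - k\<close> copied indices; each
  server then owns a row of \<open>T + 1\<close> positions.\<close>

definition c_emit :: cmd where
  "c_emit = For ''g'' 0 Ge (When (LtE (V ''g'') (V ''gn''))
      (Asg ''out'' (Add (Add (Sub (V ''gn'') K) (Num 1)) (Add (Mul (V ''g'') (Add Tm (Num 1))) (V ''t''))) (C1 ''pos'' ''g'')))"

definition c_hold :: "string \<Rightarrow> string \<Rightarrow> cmd" where
  "c_hold z t = Ite (C1 ''pv'' t) (Let0 z (Cell ''asg'' (C1 ''pv'' t)))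
      (Let0 z (Sub (Cell ''ini'' (I2 (V t) (C1 ''s'' t))) (Num 1)))"

text \<open>Without an exit from the loop the last suitable server wins. Earlier choices for
  \<open>t\<close> do not disturb the test, whose outcome depends only on assignments of requests
  before \<open>t\<close>.\<close>

definition c_pick :: cmd where
  "c_pick = For ''g'' 0 Ge (
      Let0 ''ok'' (Num 1) ;;
      For ''a'' 1 Tm (c_hold ''z'' ''a'' ;;
        When (AndE (AndE (LtE (V ''t'') (V ''a'')) (C1 ''b'' ''a'')) (AndE (LtE (C1 ''pv'' ''a'') (V ''t'')) (EqE (V ''z'') (V ''g''))))
          (Let0 ''ok'' (Num 0))) ;;
      When (AndE (AndE (V ''ok'') (LtE (V ''g'') (V ''gn''))) (EqE (C1 ''gc'' ''g'') (C1 ''s'' ''t'')))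
        (Asg ''asg'' (V ''t'') (V ''g'')))"

definition c_serve :: cmd where
  "c_serve = For ''t'' 1 Tm (
      Ite (C1 ''b'' ''t'') (c_hold ''z'' ''t'' ;; Asg ''asg'' (V ''t'') (V ''z'')) c_pick ;;
      Asg ''pos'' (C1 ''asg'' ''t'') (C1 ''sg'' ''t'') ;;
      c_emit)"

definition c_main :: cmd where
  "c_main = c_wt ;; c_cl ;; c_pv ;; c_ini ;; c_guess ;;
     c_flags ;; c_dp ;; c_back ;;
     c_prep ;; Let0 ''t'' (Num 0) ;; c_emit ;; c_serve"

lemma bound_Ge [simp]: "bound Ge" "tame Ge" "eval_expr Ge s = 2 * (s ''in'' (Suc 0))\<^sup>2"
  by (simp_all add: Ge_def power2_eq_square)

lemma writes_cmds [simp]: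
  "writes c_wt = {''P'', ''i'', ''wt''}"
  "writes c_cl = {''i'', ''c'', ''a'', ''cl'', ''ell''}"
  "writes c_pv = {''t'', ''sg'', ''m'', ''a'', ''pv''}"
  "writes c_ini = {''t'', ''j'', ''i'', ''ini''}"
  "writes c_set = {''t'', ''j'', ''okf'', ''okh'', ''F'', ''m'', ''a'', ''H''}"
  "writes c_cell = {''D'', ''hit'', ''E'', ''ar'', ''fd''}"
  "writes c_dp = {''D'', ''hit'', ''E'', ''ar'', ''fd'', ''j'', ''t''}"
  "writes c_back = {''nd'', ''t'', ''s'', ''b'', ''x''}"
  "writes c_count = {''t'', ''y'', ''h''}"
  "writes c_load = {''t'', ''a'', ''Q''}"
  "writes c_drain = {''t'', ''j'', ''i'', ''Q''}"
  "writes c_clear = {''t'', ''j'', ''Q'', ''y'', ''h''}"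
  "writes c_check = {''t'', ''j'', ''ok''}"
  "writes c_save = {''t'', ''j'', ''yb'', ''hb''}"
  "writes c_flags = {''t'', ''j'', ''okf'', ''okh'', ''F'', ''H''}"
  "writes c_prep = {''gn'', ''out'', ''x'', ''g'', ''pos'', ''gc''}"
  "writes c_emit = {''g'', ''out''}"
  "writes (c_hold z t) = {z}"
  "writes c_pick = {''g'', ''ok'', ''a'', ''z'', ''asg''}"
  by (auto simp: c_wt_def c_cl_def c_pv_def c_ini_def c_set_def c_cell_def c_dp_def c_back_def c_count_def
    c_load_def c_drain_def c_clear_def c_check_def c_save_def c_flags_def c_prep_def c_emit_def c_hold_def c_pick_def)

lemma writes_rounds [simp]:
  "writes c_round = {''t'', ''j'', ''okf'', ''okh'', ''F'', ''m'', ''a'', ''H'', ''D'', ''hit'', ''E'', ''ar'', ''fd'',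
     ''nd'', ''s'', ''b'', ''x'', ''y'', ''h'', ''Q'', ''i''}"
  "writes c_rounds = {''t'', ''j'', ''okf'', ''okh'', ''F'', ''m'', ''a'', ''H'', ''D'', ''hit'', ''E'', ''ar'', ''fd'',
     ''nd'', ''s'', ''b'', ''x'', ''y'', ''h'', ''Q'', ''i'', ''r''}"
  by (auto simp: c_round_def c_rounds_def)

lemma wf_cmds:
  "wf_cmd c_wt" "wf_cmd c_cl" "wf_cmd c_pv" "wf_cmd c_ini" "wf_cmd c_set" "wf_cmd c_dp" "wf_cmd c_back"
  "wf_cmd c_count" "wf_cmd c_load" "wf_cmd c_drain" "wf_cmd c_clear" "wf_cmd c_check" "wf_cmd c_flags" "wf_cmd c_save"
  "wf_cmd c_prep" "wf_cmd c_emit" "wf_cmd c_pick"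
  by (simp_all add: c_wt_def c_cl_def c_pv_def c_ini_def c_set_def c_cell_def c_dp_def c_back_def c_count_def
    c_load_def c_drain_def c_clear_def c_check_def c_save_def c_flags_def c_prep_def c_emit_def c_hold_def c_pick_def)

lemma wf_main: "wf_cmd c_main"
  by (simp add: c_main_def wf_cmds c_guess_def c_rounds_def c_round_def c_serve_def c_hold_def)

section \<open>Correctness of the loops\<close>

lemma Sq_rule:
  assumes "P (run c s)"
    and "\<And>s'. P s' \<Longrightarrow> (\<And>y. y \<notin> writes c \<Longrightarrow> s' y = s y) \<Longrightarrow> R (run d s')"
  shows "R (run (c ;; d) s)"
  using assms by (simp add: run_frame)

lemma ix_eq [simp]:
  fixes k :: nat
  assumes "j < k" "j' < k"
  shows "t * k + j = t' * k + j' \<longleftrightarrow> t = t' \<and> j = j'"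
proof
  assume "t * k + j = t' * k + j'"
  then have "(t * k + j) div k = (t' * k + j') div k" "(t * k + j) mod k = (t' * k + j') mod k" by simp_all
  then show "t = t' \<and> j = j'" using assms by simp
qed simp

lemma run_wt:
  assumes k: "s ''in'' (Suc 0) = k"
    and den: "\<And>i. i < k \<Longrightarrow> s ''in'' (i * 3 + 4) = den i"
    and num: "\<And>i. i < k \<Longrightarrow> s ''in'' (i * 3 + 3) = num i"
    and i: "i < k"
  shows "run c_wt s ''wt'' i = (\<Prod>a<k. den a) div den i * num i"
  unfolding c_wt_def
proof (rule Sq_rule[where P = "\<lambda>s'. s' ''P'' 0 = 1" and R = "\<lambda>s'. s' ''wt'' i = (\<Prod>a<k. den a) div den i * num i"],
    goal_cases)
  case (2 s1)
  show ?case
  proof (rule Sq_rule[where P = "\<lambda>s'. s' ''P'' 0 = (\<Prod>a<k. den a)" and R = "\<lambda>s'. s' ''wt'' i = (\<Prod>a<k. den a) div den i * num i"],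
      goal_cases)
    case 1
    show ?case
      by (rule For_rule[where P = "\<lambda>n s'. s' ''P'' 0 = (\<Prod>a<n. den a)" and N = k])
        (use 2 k den in auto)
  next
    case (2 s2)
    show ?case
      by (rule For_cells[where R = "\<lambda>i s'. s' ''wt'' i = (\<Prod>a<k. den a) div den i * num i" and N = k])
        (use 2 \<open>\<And>y. y \<notin> writes (Let0 ''P'' (Num 1)) \<Longrightarrow> s1 y = s y\<close> k den num i in auto)
  qed
qed auto

definition clf :: "(nat \<Rightarrow> nat) \<Rightarrow> nat \<Rightarrow> nat" where
  "clf wt i = (LEAST a. wt a = wt i)"

lemma card_less_Suc_if: "card {i. i < Suc n \<and> P i} = card {i. i < n \<and> P i} + of_bool (P n)"
proof -
  have "{i. i < Suc n \<and> P i} = (if P n then insert n {i. i < n \<and> P i} else {i. i < n \<and> P i})"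
    by (auto simp: less_Suc_eq)
  then show ?thesis by simp
qed

lemma run_cl:
  assumes k: "s ''in'' (Suc 0) = k" and wt: "\<And>i. i < k \<Longrightarrow> s ''wt'' i = wt i"
  shows "(\<forall>i<k. run c_cl s ''cl'' i = clf wt i) \<and> run c_cl s ''ell'' 0 = card {i. i < k \<and> clf wt i = i}"
  unfolding c_cl_def
proof (rule Sq_rule[where P = "\<lambda>s'. \<forall>i<k. s' ''cl'' i = clf wt i"
      and R = "\<lambda>s'. (\<forall>i<k. s' ''cl'' i = clf wt i) \<and> s' ''ell'' 0 = card {i. i < k \<and> clf wt i = i}"], goal_cases)
  case 1
  show ?case
  proof (intro allI impI, rule For_cells[where R = "\<lambda>i s'. s' ''cl'' i = clf wt i" and N = k], goal_cases)
    case (2 i0 i s')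
    note fr = 2(5)
    have "run (For ''a'' 0 K (When (AndE (EqE (Cell ''wt'' (V ''a'')) (Cell ''wt'' (V ''i''))) (LtE (V ''a'') (V ''c'')))
        (Let0 ''c'' (V ''a'')))) (run (Let0 ''c'' (V ''i'')) s') ''c'' 0 = clf wt i"
    proof (rule For_rule[where N = k and P = "\<lambda>n r. wt (r ''c'' 0) = wt i \<and> r ''c'' 0 \<le> i \<and> (\<forall>a<n. wt a = wt i \<longrightarrow> r ''c'' 0 \<le> a)"],
        goal_cases)
      case 1
      show ?case using fr k by simp
    next
      case (3 a r)
      have e: "r ''wt'' a = wt a" "r ''wt'' i = wt i" "r ''i'' 0 = i"
        using 3(1,2,4) 2(1-4) fr wt by auto
      show ?case using 3(3) e by (auto simp: less_Suc_eq)
    next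
      case (4 r)
      \<comment> \<open>The minimum in \<open>clf\<close> ranges over all numbers, but an index
        \<open>a \<ge> k\<close> exceeds the candidate, which is at most
        \<open>i < k\<close>.\<close>
      have "r ''c'' 0 \<le> a" if "wt a = wt i" for a
        using 4(1) that 2(3) by (cases "a < k") auto
      then have "clf wt i = r ''c'' 0" unfolding clf_def
        using 4(1) by (intro Least_equality) auto
      then show ?case by simp
    qed (use 2(4) in auto)
    then show ?case using 2 fr by (auto simp: run_frame)
  qed (use k in auto)
next
  case (2 s1)
  note fr = 2(2)
  have cl: "\<And>i. i < k \<Longrightarrow> s1 ''cl'' i = clf wt i" using 2 by auto
  show ?case
  proof (rule Sq_rule[where P = "\<lambda>s'. s' ''ell'' 0 = 0"
      and R = "\<lambda>s'. (\<forall>i<k. s' ''cl'' i = clf wt i) \<and> s' ''ell'' 0 = card {i. i < k \<and> clf wt i = i}"], goal_cases)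
    case (2 s2)
    show ?case
      by (rule For_rule[where N = k and P = "\<lambda>n r. r ''ell'' 0 = card {i. i < n \<and> clf wt i = i}"])
        (use 2 k cl fr in \<open>auto simp: card_less_Suc_if\<close>)
  qed auto
qed

fun prevf :: "(nat \<Rightarrow> nat) \<Rightarrow> nat \<Rightarrow> nat \<Rightarrow> nat" where
  "prevf sg v 0 = 0"
| "prevf sg v (Suc n) = (if 0 < n \<and> sg n = v then n else prevf sg v n)"

lemma prevf: "0 < n \<Longrightarrow> prevf sg v n < n" "0 < prevf sg v n \<Longrightarrow> sg (prevf sg v n) = v"
  "prevf sg v n < \<tau> \<Longrightarrow> \<tau> < n \<Longrightarrow> sg \<tau> \<noteq> v"
proof -
  show "0 < n \<Longrightarrow> prevf sg v n < n" by (induction n) (auto simp: less_Suc_eq)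
  show "0 < prevf sg v n \<Longrightarrow> sg (prevf sg v n) = v" by (induction n) (auto split: if_splits)
  show "prevf sg v n < \<tau> \<Longrightarrow> \<tau> < n \<Longrightarrow> sg \<tau> \<noteq> v"
    by (induction n) (auto simp: less_Suc_eq split: if_splits)
qed

lemma run_pv:
  assumes k: "s ''in'' (Suc 0) = k" and T: "s ''in'' 2 = T"
    and sg: "\<And>t. t \<in> {1..T} \<Longrightarrow> s ''in'' (k * 3 + 2 + t) = sg t"
  shows "\<forall>t\<in>{1..T}. run c_pv s ''sg'' t = sg t \<and> run c_pv s ''pv'' t = prevf sg (sg t) t"
  unfolding c_pv_def
proof (rule Sq_rule[where P = "\<lambda>s'. \<forall>t\<in>{1..T}. s' ''sg'' t = sg t"
      and R = "\<lambda>s'. \<forall>t\<in>{1..T}. s' ''sg'' t = sg t \<and> s' ''pv'' t = prevf sg (sg t) t"], goal_cases)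
  case 1
  show ?case
    by (intro ballI, rule For_cells[where R = "\<lambda>t s'. s' ''sg'' t = sg t" and N = T])
      (use k T sg in auto)
next
  case (2 s1)
  note fr = 2(2)
  have sg1: "\<And>t. t \<in> {1..T} \<Longrightarrow> s1 ''sg'' t = sg t" using 2 by auto
  show ?case
  proof (intro ballI conjI, goal_cases)
    case (1 t)
    then show ?case using sg1 by (simp add: run_frame)
  next
    case (2 t)
    show ?case
    proof (rule For_cells[where R = "\<lambda>t s'. s' ''pv'' t = prevf sg (sg t) t" and N = T], goal_cases)
      case (2 t s')
      note fr' = 2(4)
      have "run (For ''a'' 1 Tm (When (AndE (LtE (V ''a'') (V ''t'')) (EqE (Cell ''sg'' (V ''a'')) (Cell ''sg'' (V ''t''))))
        (Let0 ''m'' (V ''a'')))) (run (Let0 ''m'' (Num 0)) s') ''m'' 0 = prevf sg (sg t) t"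
      proof (rule For_rule[where N = T and P = "\<lambda>n r. r ''m'' 0 = prevf sg (sg t) (min n t)"], goal_cases)
        case (3 a r)
        have e: "r ''sg'' a = sg a" "r ''sg'' t = sg t" "r ''t'' 0 = t"
          using 3(1,2,4) 2(1-3) fr' sg1 by auto
        show ?case
        proof (cases "a < t")
          case True
          then have "min (Suc a) t = Suc a" "min a t = a" by auto
          then show ?thesis using 3(1,3) e True by auto
        next
          case False
          then have "min (Suc a) t = t" "min a t = t" by auto
          then show ?thesis using 3(3) e False by auto
        qed
      next
        case (4 r)
        then show ?case using 2 by (simp add: min_def)
      qed (use 2 fr' fr T in \<open>auto simp: min_def\<close>)
      then show ?case using 2 by (auto simp: run_frame)
    qed (use 2 fr T in auto)
  qed
qed

lemma run_ini:
  assumes k: "s ''in'' (Suc 0) = k" and T: "s ''in'' 2 = T"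
    and sg: "\<And>t. t \<in> {1..T} \<Longrightarrow> s ''sg'' t = sg t"
    and cl: "\<And>i. i < k \<Longrightarrow> s ''cl'' i = cl i" "\<And>i. i < k \<Longrightarrow> cl i < k"
    and p0: "\<And>i. i < k \<Longrightarrow> s ''in'' (i * 3 + 5) = p0 i"
    and t: "t \<in> {1..T}" and j: "j < k"
  shows "(\<exists>i<k. cl i = j \<and> p0 i = sg t \<and> run c_ini s ''ini'' (t * k + j) = Suc i) \<or>
    run c_ini s ''ini'' (t * k + j) = 0 \<and> (\<forall>i<k. cl i = j \<longrightarrow> p0 i \<noteq> sg t)"
proof -
  define R where "R n t r \<longleftrightarrow> (\<forall>j<k. (\<exists>i<n. cl i = j \<and> p0 i = sg t \<and> r ''ini'' (t * k + j) = Suc i) \<or>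
    r ''ini'' (t * k + j) = 0 \<and> (\<forall>i<n. cl i = j \<longrightarrow> p0 i \<noteq> sg t))" for n t and r :: store
  have "R k t (run c_ini s)"
    unfolding c_ini_def
  proof (rule For_cells[where R = "R k" and N = T], goal_cases)
    case (2 t s')
    note fr = 2(4)
    show ?case (is "?A \<and> ?B")
    proof
      show ?A
      proof (rule Sq_rule[where P = "\<lambda>r. \<forall>j<k. r ''ini'' (t * k + j) = 0" and R = "R k t"], goal_cases)
        case 1
        show ?case
          by (intro allI impI, rule For_cells[where R = "\<lambda>j r. r ''ini'' (t * k + j) = 0" and N = k])
            (use 2 fr k in auto)
      next
        case (2 r)
        note fr' = 2(2)
        show ?case
        proof (rule For_rule[where N = k and P = "\<lambda>n. R n t"], goal_cases)
          case (3 i r')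
          have e: "r' ''in'' (i * 3 + 5) = p0 i" "r' ''in'' (Suc 0) = k" "r' ''t'' 0 = t" "r' ''sg'' t = sg t" "r' ''cl'' i = cl i"
            using 3 fr' fr \<open>s' ''t'' 0 = t\<close> k p0 sg cl \<open>1 \<le> t\<close> \<open>t < 1 + T\<close> by auto
          show ?case using 3(1-3) e cl unfolding R_def by (auto simp: less_Suc_eq)
        qed (use 2 fr k in \<open>auto simp: R_def\<close>)
      qed
      show ?B
      proof (intro allI impI)
        fix t' assume t': "1 \<le> t' \<and> t' < 1 + T \<and> t' \<noteq> t \<and> R k t' s'"
        show "R k t' (run (For ''j'' 0 K (Asg ''ini'' (I2 (V ''t'') (V ''j'')) (Num 0)) ;;
          For ''i'' 0 K (When (EqE (Cell ''in'' (Add (Mul (V ''i'') (Num 3)) (Num 5))) (Cell ''sg'' (V ''t'')))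
            (Asg ''ini'' (I2 (V ''t'') (Cell ''cl'' (V ''i''))) (Add (V ''i'') (Num 1))))) s')"
        proof (rule Sq_rule[where P = "R k t'" and R = "R k t'"], goal_cases)
          case 1
          show ?case
            by (rule For_rule[where N = k and P = "\<lambda>n. R k t'"])
              (use 2 fr k t' in \<open>auto simp: R_def\<close>)
        next
          case (2 r)
          note fr' = 2(2)
          show ?case
          proof (rule For_rule[where N = k and P = "\<lambda>n. R k t'"], goal_cases)
            case (3 i r')
            have e: "r' ''in'' (Suc 0) = k" "r' ''t'' 0 = t" "r' ''cl'' i = cl i"
              using 3 fr' fr \<open>s' ''t'' 0 = t\<close> k cl by auto
            show ?case using 3(1-3) e cl t' unfolding R_def by auto
          qed (use 2 fr k in \<open>auto simp: R_def\<close>)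
        qed
      qed
    qed
  qed (use t T in \<open>auto simp: R_def\<close>)
  then show ?thesis using j by (simp add: R_def)
qed

text \<open>The analogue of \<open>For_cells\<close> for two nested loops, viewed as one loop over
  pairs so that only the innermost body needs an argument.\<close>

lemma For2_cells:
  assumes e1: "eval_expr e1 s = N"
    and e2: "\<And>s'. (\<And>y. y \<noteq> x1 \<Longrightarrow> y \<noteq> x2 \<Longrightarrow> y \<notin> writes c \<Longrightarrow> s' y = s y) \<Longrightarrow> eval_expr e2 s' = k"
    and x: "x1 \<noteq> x2" "x1 \<notin> writes c"
    and body: "\<And>t j s'. t \<in> {1..N} \<Longrightarrow> j < k \<Longrightarrow> s' x1 0 = t \<Longrightarrow> s' x2 0 = j \<Longrightarrow>
      (\<And>y. y \<noteq> x1 \<Longrightarrow> y \<noteq> x2 \<Longrightarrow> y \<notin> writes c \<Longrightarrow> s' y = s y) \<Longrightarrow>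
      R t j (run c s') \<and> (\<forall>t'\<in>{1..N}. \<forall>j'<k. (t' \<noteq> t \<or> j' \<noteq> j) \<longrightarrow> R t' j' s' \<longrightarrow> R t' j' (run c s'))"
    and ins: "\<And>t j v s'. R t j s' \<Longrightarrow> R t j (upd x1 0 v s') \<and> R t j (upd x2 0 v s')"
  shows "\<forall>t\<in>{1..N}. \<forall>j<k. R t j (run (For x1 1 e1 (For x2 0 e2 c)) s)"
proof (intro ballI)
  fix t0 assume t0: "t0 \<in> {1..N}"
  show "\<forall>j<k. R t0 j (run (For x1 1 e1 (For x2 0 e2 c)) s)"
  proof (rule For_cells[where R = "\<lambda>t r. \<forall>j<k. R t j r" and N = N], goal_cases)
    case (2 t s')
    note t = 2(1-3) and fr = 2(4)
    have fr2: "\<And>y. y \<noteq> x1 \<Longrightarrow> y \<noteq> x2 \<Longrightarrow> y \<notin> writes c \<Longrightarrow> s' y = s y" using fr by simp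
    have e: "eval_expr e2 s' = k" using fr2 by (rule e2)
    show ?case
    proof (intro conjI allI impI)
      fix j assume j: "j < k"
      show "R t j (run (For x2 0 e2 c) s')"
      proof (rule For_cells[where R = "R t" and N = k], goal_cases)
        case (2 j r)
        have "r x1 0 = t" "\<And>y. y \<noteq> x1 \<Longrightarrow> y \<noteq> x2 \<Longrightarrow> y \<notin> writes c \<Longrightarrow> r y = s y"
          using 2(4) x t(3) fr2 by auto
        then show ?case using body[of t j r] 2(2,3) t by auto
      qed (use e j ins in auto)
    next
      fix t' j' assume *: "1 \<le> t' \<and> t' < 1 + N \<and> t' \<noteq> t \<and> (\<forall>j<k. R t' j s')" "j' < k"
      show "R t' j' (run (For x2 0 e2 c) s')"
      proof (rule For_rule[where P = "\<lambda>n r. R t' j' r" and N = k], goal_cases)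
        case (3 j r)
        have "r x1 0 = t" "\<And>y. y \<noteq> x1 \<Longrightarrow> y \<noteq> x2 \<Longrightarrow> y \<notin> writes c \<Longrightarrow> r y = s y"
          using 3(4) x t(3) fr2 by auto
        then show ?case using body[of t j "upd x2 0 j r"] 3(2,3) t * ins x(1) by auto
      next
        case (4 r)
        then show ?case using ins by blast
      qed (use e * in auto)
    qed
  qed (use e1 t0 ins in auto)
qed

lemma run_set:
  assumes k: "s ''in'' (Suc 0) = k" and T: "s ''in'' 2 = T"
  defines "r \<equiv> run c_set s"
  shows "\<forall>t\<in>{1..T}. \<forall>j<k. r ''okf'' (t * k + j) = of_bool (s ''cl'' j = j) \<and>
    r ''okh'' (t * k + j) = of_bool (s ''cl'' j = j \<and> (s ''pv'' t \<noteq> 0 \<or> s ''ini'' (t * k + j) \<noteq> 0)) \<and>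
    r ''F'' (t * k + j) = s ''wt'' j * (4 * (T * k * (T + k)\<^sup>2)) + s ''Q'' (t * k + j) \<and>
    r ''H'' (t * k + j) = (\<Sum>a\<in>{s ''pv'' t<..t}. s ''Q'' (a * k + j))"
  unfolding r_def c_set_def
proof (rule For2_cells, goal_cases)
  case (5 t j s')
  note fr = 5(5)
  have e: "s' ''in'' = s ''in''" "s' ''cl'' = s ''cl''" "s' ''pv'' = s ''pv''" "s' ''ini'' = s ''ini''"
    "s' ''wt'' = s ''wt''" "s' ''Q'' = s ''Q''" using fr by auto
  have "run (For ''a'' 1 Tm (When (AndE (LtE (C1 ''pv'' ''t'') (V ''a'')) (LeE (V ''a'') (V ''t'')))
        (Let0 ''m'' (Add (V ''m'') (C2 ''Q'' ''a'' ''j''))))) z ''m'' 0 = (\<Sum>a\<in>{s ''pv'' t<..t}. s ''Q'' (a * k + j))"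
    if z: "z ''m'' 0 = 0" "z ''in'' = s ''in''" "z ''pv'' = s ''pv''" "z ''Q'' = s ''Q''" "z ''t'' 0 = t" "z ''j'' 0 = j" for z
  proof (rule For_rule[where N = T and P = "\<lambda>n q. q ''m'' 0 = (\<Sum>a\<in>{a. s ''pv'' t < a \<and> a \<le> t \<and> a < n}. s ''Q'' (a * k + j))"],
      goal_cases)
    case (3 a q)
    have q: "q ''in'' = s ''in''" "q ''pv'' = s ''pv''" "q ''Q'' = s ''Q''" "q ''t'' 0 = t" "q ''j'' 0 = j"
      using 3(4) z by auto
    have "{a'. s ''pv'' t < a' \<and> a' \<le> t \<and> a' < Suc a} = (if s ''pv'' t < a \<and> a \<le> t
        then insert a {a'. s ''pv'' t < a' \<and> a' \<le> t \<and> a' < a} else {a'. s ''pv'' t < a' \<and> a' \<le> t \<and> a' < a})"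
      by (auto simp: less_Suc_eq)
    then show ?case using 3(3) q k by auto
  next
    case (4 q)
    have "{a. s ''pv'' t < a \<and> a \<le> t \<and> a < 1 + T} = {s ''pv'' t<..t}" using 5(1) by auto
    then show ?case using 4(1) by simp
  next
    case 2
    have "{a. s ''pv'' t < a \<and> a \<le> t \<and> a < 1} = {}" by auto
    then show ?case using z(1) by simp
  qed (use z T in auto)
  then show ?case using 5(1-4) e k T by (auto simp: run_frame)
qed (use k T in auto)

lemma run_cell:
  assumes "q ''in'' (Suc 0) = k" "q ''t'' 0 = t" "q ''j'' 0 = j" "q ''pv'' t < t" "j < k"
  defines "p \<equiv> q ''pv'' t" and "i \<equiv> t * k + j"
  defines "h \<equiv> q ''okh'' i \<noteq> 0 \<and> q ''D'' (p * k + j) + q ''H'' i < q ''E'' p + q ''F'' i"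
  defines "v \<equiv> if h then q ''D'' (p * k + j) + q ''H'' i else q ''E'' p + q ''F'' i"
  defines "b \<equiv> q ''okf'' i \<noteq> 0 \<and> (q ''fd'' 0 = 0 \<or> v < q ''E'' t)"
  shows "run c_cell q ''D'' = (q ''D'')(i := v) \<and> run c_cell q ''hit'' = (q ''hit'')(i := of_bool h) \<and>
    run c_cell q ''E'' = (if b then (q ''E'')(t := v) else q ''E'') \<and>
    run c_cell q ''ar'' = (if b then (q ''ar'')(t := j) else q ''ar'') \<and>
    run c_cell q ''fd'' = (if b then (q ''fd'')(0 := 1) else q ''fd'')"
proof -
  \<comment> \<open>The cell read in the row of the preceding request is not the one being
    overwritten.\<close>
  have ne: "p * k + j \<noteq> i" unfolding i_def p_def using assms(4,5) by simp
  show ?thesis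
  proof (cases h)
    case True
    then have v: "v = q ''D'' (p * k + j) + q ''H'' i" by (simp add: v_def)
    show ?thesis using True ne unfolding c_cell_def b_def v h_def
      by (auto simp: assms(1-3) i_def[symmetric] p_def[symmetric])
  next
    case False
    then have v: "v = q ''E'' p + q ''F'' i" by (simp add: v_def)
    show ?thesis using False ne unfolding c_cell_def b_def v h_def
      by (auto simp: assms(1-3) i_def[symmetric] p_def[symmetric])
  qed
qed

text \<open>The recurrence is stated within the single store \<open>r\<close>. This is sound because
  the cells it reads belong to the earlier request \<open>pv t\<close> and are final when row
  \<open>t\<close> is computed.\<close>

definition dp_cell :: "nat \<Rightarrow> store \<Rightarrow> nat \<Rightarrow> nat \<Rightarrow> store \<Rightarrow> bool" where
  "dp_cell k s t j r \<longleftrightarrow> (let i = t * k + j; p = s ''pv'' t;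
      h = (s ''okh'' i \<noteq> 0 \<and> r ''D'' (p * k + j) + s ''H'' i < r ''E'' p + s ''F'' i) in
    r ''hit'' i = of_bool h \<and> r ''D'' i = (if h then r ''D'' (p * k + j) + s ''H'' i else r ''E'' p + s ''F'' i))"

definition dp_best :: "nat \<Rightarrow> store \<Rightarrow> nat \<Rightarrow> nat \<Rightarrow> store \<Rightarrow> bool" where
  "dp_best k s n t r \<longleftrightarrow> r ''ar'' t < n \<and> s ''okf'' (t * k + r ''ar'' t) \<noteq> 0 \<and> r ''E'' t = r ''D'' (t * k + r ''ar'' t) \<and>
    (\<forall>j<n. s ''okf'' (t * k + j) \<noteq> 0 \<longrightarrow> r ''E'' t \<le> r ''D'' (t * k + j))"

definition dp_inv :: "nat \<Rightarrow> store \<Rightarrow> nat \<Rightarrow> store \<Rightarrow> bool" where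
  "dp_inv k s n r \<longleftrightarrow> r ''E'' 0 = 0 \<and> (\<forall>j<k. r ''D'' j = 0) \<and>
    (\<forall>t. 1 \<le> t \<and> t < n \<longrightarrow> (\<forall>j<k. dp_cell k s t j r) \<and> dp_best k s k t r)"

lemma dp_upd:
  assumes "x \<notin> {''D'', ''hit'', ''E'', ''ar''}"
  shows "dp_inv k s n (upd x i v r) \<longleftrightarrow> dp_inv k s n r"
    "dp_cell k s t j (upd x i v r) \<longleftrightarrow> dp_cell k s t j r"
    "dp_best k s n t (upd x i v r) \<longleftrightarrow> dp_best k s n t r"
proof -
  have "upd x i v r ''D'' = r ''D''" "upd x i v r ''hit'' = r ''hit''"
    "upd x i v r ''E'' = r ''E''" "upd x i v r ''ar'' = r ''ar''" using assms by auto
  then show "dp_inv k s n (upd x i v r) \<longleftrightarrow> dp_inv k s n r"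
    "dp_cell k s t j (upd x i v r) \<longleftrightarrow> dp_cell k s t j r"
    "dp_best k s n t (upd x i v r) \<longleftrightarrow> dp_best k s n t r"
    unfolding dp_inv_def dp_cell_def dp_best_def by (simp_all only:)
qed

lemma dp_cong:
  assumes "\<And>t' j. t' \<le> t \<Longrightarrow> j < k \<Longrightarrow> r' ''D'' (t' * k + j) = r ''D'' (t' * k + j) \<and> r' ''hit'' (t' * k + j) = r ''hit'' (t' * k + j)"
    and "\<And>t'. t' \<le> t \<Longrightarrow> r' ''E'' t' = r ''E'' t' \<and> r' ''ar'' t' = r ''ar'' t'" and "s ''pv'' t < t" and "n \<le> k"
  shows "j < k \<Longrightarrow> dp_cell k s t j r \<Longrightarrow> dp_cell k s t j r'" "dp_best k s n t r \<Longrightarrow> dp_best k s n t r'"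
proof -
  show "dp_cell k s t j r'" if "j < k" "dp_cell k s t j r"
    using that assms by (simp add: dp_cell_def Let_def)
  show "dp_best k s n t r'" if "dp_best k s n t r"
  proof -
    have eq: "r' ''ar'' t = r ''ar'' t" "r' ''E'' t = r ''E'' t" using assms(2) by auto
    have "r' ''D'' (t * k + j) = r ''D'' (t * k + j)" if "j < n" for j using assms(1,4) that by auto
    then show ?thesis using that unfolding dp_best_def eq by auto
  qed
qed

lemma run_dp:
  assumes k: "s ''in'' (Suc 0) = k" and T: "s ''in'' 2 = T"
    and pv: "\<And>t. t \<in> {1..T} \<Longrightarrow> s ''pv'' t < t"
    and ex: "\<And>t. t \<in> {1..T} \<Longrightarrow> \<exists>j<k. s ''okf'' (t * k + j) \<noteq> 0"
  shows "dp_inv k s (1 + T) (run c_dp s)"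
  unfolding c_dp_def
proof (rule Sq_rule[where P = "\<lambda>r. r ''E'' 0 = 0" and R = "dp_inv k s (1 + T)"], goal_cases)
  case (2 s1)
  note E1 = 2(1) and fr1 = 2(2)
  show ?case
  proof (rule Sq_rule[where P = "\<lambda>r. \<forall>j<k. r ''D'' j = 0" and R = "dp_inv k s (1 + T)"], goal_cases)
    case 1
    show ?case
      by (intro allI impI, rule For_cells[where R = "\<lambda>j r. r ''D'' j = 0" and N = k])
        (use fr1 k in auto)
  next
    case (2 s2)
    have fr2: "s2 y = s y" if "y \<notin> {''E'', ''D'', ''j''}" for y using 2(2) fr1 that by simp
    have E2: "s2 ''E'' 0 = 0" using 2(2) E1 by simp
    show ?case
    proof (rule For_rule[where P = "dp_inv k s" and R = "dp_inv k s (1 + T)" and N = T], goal_cases)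
      case (3 t r0)
      have t: "t \<in> {1..T}" using 3 by auto
      have fr0: "r0 y = s y" if "y \<notin> {''D'', ''hit'', ''E'', ''ar'', ''fd'', ''j'', ''t''}" for y
        using 3(4) fr2 that by simp
      have inv0: "dp_inv k s t r0" by (rule 3(3))
      \<comment> \<open>The arrays are not cleared between runs, so \<open>E t\<close> and
        \<open>ar t\<close> may be left over from an earlier run until \<open>fd\<close> signals
        that an allowed class has been met.\<close>
      define J where "J n r \<longleftrightarrow> dp_inv k s t r \<and> (\<forall>j<n. dp_cell k s t j r) \<and>
        r ''fd'' 0 = of_bool (\<exists>j<n. s ''okf'' (t * k + j) \<noteq> 0) \<and> (r ''fd'' 0 \<noteq> 0 \<longrightarrow> dp_best k s n t r)" for n r
      show ?case
      proof (rule Sq_rule[where P = "\<lambda>r. dp_inv k s t r \<and> r ''fd'' 0 = 0" and R = "dp_inv k s (Suc t)"], goal_cases)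
        case 1
        then show ?case using inv0 by (simp add: dp_upd)
      next
        case (2 r1)
        have t1: "r1 ''t'' 0 = t" using 2(2) by simp
        have fr1: "r1 y = s y" if "y \<notin> {''D'', ''hit'', ''E'', ''ar'', ''fd'', ''j'', ''t''}" for y
          using 2(2) fr0 that by simp
        show ?case
        proof (rule For_rule[where P = J and R = "dp_inv k s (Suc t)" and N = k], goal_cases)
          case 2
          then show ?case using \<open>dp_inv k s t r1 \<and> r1 ''fd'' 0 = 0\<close> by (simp add: J_def)
        next
          case (3 j q0)
          define q where "q = upd ''j'' 0 j q0"
          have frq: "q y = s y" if "y \<notin> {''D'', ''hit'', ''E'', ''ar'', ''fd'', ''j'', ''t''}" for y
            using 3(4) fr1 that by (simp add: q_def)
          have tq: "q ''t'' 0 = t" "q ''j'' 0 = j" using 3(4) t1 by (simp_all add: q_def)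
          have jk: "j < k" using 3(2) by simp
          have kq: "q ''in'' (Suc 0) = k" "q ''pv'' t < t" using frq k pv[OF t] by auto
          have J: "J j q" using 3(3) unfolding q_def J_def by (simp add: dp_upd)
          define p where "p = s ''pv'' t"
          define i where "i = t * k + j"
          define h where "h \<longleftrightarrow> s ''okh'' i \<noteq> 0 \<and> q ''D'' (p * k + j) + s ''H'' i < q ''E'' p + s ''F'' i"
          define v where "v = (if h then q ''D'' (p * k + j) + s ''H'' i else q ''E'' p + s ''F'' i)"
          define b where "b \<longleftrightarrow> s ''okf'' i \<noteq> 0 \<and> (q ''fd'' 0 = 0 \<or> v < q ''E'' t)"
          define q' where "q' = run c_cell q"
          have q': "q' ''D'' = (q ''D'')(i := v)" "q' ''hit'' = (q ''hit'')(i := of_bool h)"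
            "q' ''E'' = (if b then (q ''E'')(t := v) else q ''E'')"
            "q' ''ar'' = (if b then (q ''ar'')(t := j) else q ''ar'')"
            "q' ''fd'' = (if b then (q ''fd'')(0 := 1) else q ''fd'')"
            using run_cell[OF kq(1) tq kq(2) jk] frq
            by (simp_all add: q'_def i_def h_def v_def b_def p_def)
          have pt: "p < t" using pv[OF t] by (simp add: p_def)
          have inv': "dp_inv k s t q'"
          proof -
            have inv: "dp_inv k s t q" using J by (simp add: J_def)
            have "dp_cell k s t' j' q'" if "1 \<le> t'" "t' < t" "j' < k" for t' j'
            proof (rule dp_cong(1)[of t' k q' q s k])
              show "dp_cell k s t' j' q" using inv that by (simp add: dp_inv_def)
              show "s ''pv'' t' < t'" using pv t that by auto
            qed (use that jk in \<open>auto simp: q' i_def\<close>)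
            moreover have "dp_best k s k t' q'" if "1 \<le> t'" "t' < t" for t'
            proof (rule dp_cong(2)[of t' k q' q s k])
              show "dp_best k s k t' q" using inv that by (simp add: dp_inv_def)
              show "s ''pv'' t' < t'" using pv t that by auto
            qed (use that jk in \<open>auto simp: q' i_def\<close>)
            moreover have "j' \<noteq> i" if "j' < k" for j' using that jk t ix_eq[of j' k j 0 t] by (auto simp: i_def)
            ultimately show ?thesis using inv t by (auto simp: dp_inv_def q')
          qed
          have cell_old: "dp_cell k s t j' q'" if "j' < j" for j'
          proof -
            have "dp_cell k s t j' q" using J that by (simp add: J_def)
            then show ?thesis using that jk pt unfolding dp_cell_def Let_def by (auto simp: q' i_def p_def)
          qed
          have cell_new: "dp_cell k s t j q'"
          proof -
            have ne: "p * k + j \<noteq> i" using jk pt by (simp add: i_def)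
            have pe: "q' ''E'' p = q ''E'' p" using pt by (simp add: q')
            show ?thesis using ne unfolding dp_cell_def Let_def i_def[symmetric] p_def[symmetric] pe
              by (simp add: q' v_def) (auto simp: h_def)
          qed
          have best: "dp_best k s (Suc j) t q'" if fd: "q' ''fd'' 0 \<noteq> 0"
          proof (cases "q ''fd'' 0 = 0")
            case True
            then have "b" using fd by (auto simp: q' split: if_splits)
            moreover have "s ''okf'' (t * k + j') = 0" if "j' < j" for j' using True J that by (auto simp: J_def)
            ultimately show ?thesis unfolding dp_best_def b_def by (auto simp: q' i_def less_Suc_eq b_def)
          next
            case False
            then have old: "dp_best k s j t q" using J by (simp add: J_def)
            show ?thesis
            proof (cases b)
              case True
              then have "v < q ''E'' t" using False by (auto simp: b_def)
              then show ?thesis using old True jk unfolding dp_best_def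
                by (auto simp: q' i_def less_Suc_eq b_def)
            next
              case nb: False
              then have "s ''okf'' i = 0 \<or> q ''E'' t \<le> v" using False by (auto simp: b_def)
              then show ?thesis using old nb jk unfolding dp_best_def
                by (auto simp: q' i_def less_Suc_eq)
            qed
          qed
          have fd: "q' ''fd'' 0 = of_bool (\<exists>j'<Suc j. s ''okf'' (t * k + j') \<noteq> 0)"
          proof -
            have "q ''fd'' 0 = of_bool (\<exists>j'<j. s ''okf'' (t * k + j') \<noteq> 0)" using J by (simp add: J_def)
            then show ?thesis by (auto simp: q' b_def i_def less_Suc_eq split: if_splits)
          qed
          show ?case using inv' cell_old cell_new best fd
            unfolding J_def q'_def[symmetric] q_def[symmetric] by (auto simp: less_Suc_eq)
        next
          case (4 q)
          have J: "J k q" using 4(1) by simp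
          have "q ''fd'' 0 \<noteq> 0" using J ex[OF t] by (simp add: J_def)
          then have "dp_inv k s (Suc t) q" using J by (auto simp: J_def dp_inv_def less_Suc_eq)
          then show ?case by (simp add: dp_upd)
        qed (use fr1 k in auto)
      qed
    next
      case 2
      then show ?case using E2 \<open>\<forall>j<k. s2 ''D'' j = 0\<close> by (auto simp: dp_inv_def)
    next
      case (4 r)
      then show ?case by (simp add: dp_upd)
    qed (use fr2 T in simp)
  qed
qed auto

lemma run_back:
  assumes k: "s ''in'' (Suc 0) = k" and T: "s ''in'' 2 = T"
    and pv: "\<And>t. t \<in> {1..T} \<Longrightarrow> s ''pv'' t < t"
    and inj: "\<And>t t'. t \<in> {1..T} \<Longrightarrow> t' \<in> {1..T} \<Longrightarrow> s ''pv'' t = s ''pv'' t' \<Longrightarrow> 0 < s ''pv'' t \<Longrightarrow> t = t'"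
  defines "r \<equiv> run c_back s"
  shows "\<forall>t\<in>{1..T}. r ''b'' t = s ''hit'' (t * k + r ''s'' t) \<and>
    (r ''b'' t \<noteq> 0 \<and> 0 < s ''pv'' t \<longrightarrow> r ''s'' (s ''pv'' t) = r ''s'' t) \<and>
    ((\<forall>t'\<in>{1..T}. s ''pv'' t' = t \<longrightarrow> r ''b'' t' = 0) \<longrightarrow> r ''s'' t = s ''ar'' t)"
proof -
  \<comment> \<open>Requests after \<open>n\<close> are decided. The demand of a hit on its
    predecessor is met in \<open>s\<close> if the predecessor is decided, and otherwise is still
    waiting in \<open>nd\<close>; where nothing is demanded, \<open>nd\<close> is 0.\<close>
  define J where "J n q \<longleftrightarrow>
    (\<forall>t. n < t \<and> t \<le> T \<longrightarrow> q ''b'' t = s ''hit'' (t * k + q ''s'' t) \<and>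
      (q ''b'' t \<noteq> 0 \<and> 0 < s ''pv'' t \<longrightarrow>
        (if n < s ''pv'' t then q ''s'' (s ''pv'' t) = q ''s'' t else q ''nd'' (s ''pv'' t) = Suc (q ''s'' t))) \<and>
      ((\<forall>t'\<in>{1..T}. s ''pv'' t' = t \<longrightarrow> q ''b'' t' = 0) \<longrightarrow> q ''s'' t = s ''ar'' t)) \<and>
    (\<forall>t. 0 < t \<and> t \<le> n \<longrightarrow> (\<forall>t'. n < t' \<and> t' \<le> T \<and> s ''pv'' t' = t \<longrightarrow> q ''b'' t' = 0) \<longrightarrow> q ''nd'' t = 0)"
    for n and q :: store
  have "J 0 r"
    unfolding r_def c_back_def
  proof (rule Sq_rule[where P = "\<lambda>q. \<forall>x<Suc T. q ''nd'' x = 0" and R = "J 0"], goal_cases)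
    case 1
    show ?case
      by (intro allI impI, rule For_cells[where R = "\<lambda>x q. q ''nd'' x = 0" and N = "Suc T"])
        (use T in auto)
  next
    case (2 s1)
    have fr1: "s1 y = s y" if "y \<notin> {''x'', ''nd''}" for y using 2(2) that by simp
    show ?case
    proof (rule For_rule[where P = "\<lambda>x. J (T - x)" and R = "J 0" and N = T], goal_cases)
      case 2
      then show ?case using \<open>\<forall>x<Suc T. s1 ''nd'' x = 0\<close> by (auto simp: J_def)
    next
      case (3 x q0)
      define t where "t = T - x"
      have t: "t \<in> {1..T}" and tx: "T - Suc x = t - 1" using 3(2) by (auto simp: t_def)
      have J: "J t q0" using 3(3) by (simp add: t_def)
      have fr: "q0 y = s y" if "y \<notin> {''x'', ''nd'', ''t'', ''s'', ''b''}" for y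
        using 3(4) fr1 that by simp
      define v where "v = (if q0 ''nd'' t \<noteq> 0 then q0 ''nd'' t - 1 else s ''ar'' t)"
      define bb where "bb = s ''hit'' (t * k + v)"
      define p where "p = s ''pv'' t"
      define q where "q = run (Let0 ''t'' (Sub Tm (V ''x'')) ;;
        Ite (C1 ''nd'' ''t'') (Asg ''s'' (V ''t'') (Sub (C1 ''nd'' ''t'') (Num 1))) (Asg ''s'' (V ''t'') (C1 ''ar'' ''t'')) ;;
        Asg ''b'' (V ''t'') (Cell ''hit'' (I2 (V ''t'') (C1 ''s'' ''t''))) ;;
        When (C1 ''b'' ''t'') (Asg ''nd'' (C1 ''pv'' ''t'') (Add (C1 ''s'' ''t'') (Num 1)))) (upd ''x'' 0 x q0)"
      have q: "q ''s'' = (q0 ''s'')(t := v)" "q ''b'' = (q0 ''b'')(t := bb)"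
        "q ''nd'' = (if bb \<noteq> 0 then (q0 ''nd'')(p := Suc v) else q0 ''nd'')"
        by (simp_all add: q_def fr T k t_def[symmetric] v_def bb_def p_def)
      have pt: "p < t" using pv[OF t] by (simp add: p_def)
      have later: "t < t'" if "t' \<in> {1..T}" "s ''pv'' t' = t" for t' using pv[OF that(1)] that(2) by simp
      have "J (t - 1) q"
        unfolding J_def
      proof (intro conjI allI impI, goal_cases)
        case (1 t')
        then show ?case using J t by (cases "t' = t") (auto simp: J_def q bb_def)
      next
        case (2 t')
        show ?case
        proof (cases "t' = t")
          case True
          then have "\<not> t - 1 < s ''pv'' t'" using pt by (simp add: p_def)
          moreover have "q ''nd'' p = Suc v" using 2(2) True by (simp add: q)
          ultimately show ?thesis using True by (simp add: q p_def)
        next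
          case False
          then have t': "t < t'" "t' \<le> T" using 2(1) by auto
          have b': "q0 ''b'' t' \<noteq> 0" using 2(2) False by (simp add: q)
          have old: "if t < s ''pv'' t' then q0 ''s'' (s ''pv'' t') = q0 ''s'' t' else q0 ''nd'' (s ''pv'' t') = Suc (q0 ''s'' t')"
            using J t' b' 2(2) unfolding J_def by blast
          \<comment> \<open>By injectivity of \<open>pv\<close>, two hits never write the same
            positive entry of \<open>nd\<close>, so no waiting demand is lost.\<close>
          have np: "s ''pv'' t' \<noteq> p" using inj[of t' t] t' t 2(2) False by (auto simp: p_def)
          consider "t < s ''pv'' t'" | "s ''pv'' t' = t" | "s ''pv'' t' < t" by linarith
          then show ?thesis
          proof cases
            case 2
            then show ?thesis using old t False by (simp add: q v_def)
          qed (use old t False np in \<open>auto simp: q\<close>)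
        qed
      next
        case (3 t')
        show ?case
        proof (cases "t' = t")
          case True
          have "q0 ''b'' u = 0" if "t < u \<and> u \<le> T \<and> s ''pv'' u = t" for u
            using 3(2) that True t by (auto simp: q)
          then have "q0 ''nd'' t = 0" using J t unfolding J_def by auto
          then show ?thesis using True by (simp add: q v_def)
        next
          case False
          have "q0 ''b'' u = 0" if "u \<in> {1..T}" "s ''pv'' u = t'" for u
            using 3(2) that pv[OF that(1)] 3(1) False t by (auto simp: q split: if_splits)
          then show ?thesis using J 3(1) False t by (auto simp: J_def q)
        qed
      next
        case (4 t')
        have "q0 ''b'' u = 0" if "t < u \<and> u \<le> T \<and> s ''pv'' u = t'" for u
          using 4(2) that by (auto simp: q split: if_splits)
        then have "q0 ''nd'' t' = 0" using J 4(1) unfolding J_def by auto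
        moreover have "bb = 0" if "t' = p"
          using 4 that t by (auto simp: q p_def split: if_splits)
        ultimately show ?case by (auto simp: q)
      qed
      then show ?case unfolding tx q_def by simp
    next
      case (4 q)
      then show ?case by (simp add: J_def)
    qed (use fr1 T in auto)
  qed
  then show ?thesis by (auto simp: J_def)
qed

lemma run_count:
  assumes k: "s ''in'' (Suc 0) = k" and T: "s ''in'' 2 = T"
    and sk: "\<And>t. t \<in> {1..T} \<Longrightarrow> s ''s'' t < k"
  shows "\<forall>t\<in>{1..T}. \<forall>j<k. run c_count s ''y'' (t * k + j) = s ''y'' (t * k + j) + s ''ell'' 0 * of_bool (s ''s'' t = j) \<and>
    run c_count s ''h'' (t * k + j) = s ''h'' (t * k + j) + s ''ell'' 0 * of_bool (s ''s'' t = j \<and> s ''b'' t \<noteq> 0)"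
proof -
  define R where "R n q \<longleftrightarrow> (\<forall>t\<in>{1..T}. \<forall>j<k.
    q ''y'' (t * k + j) = s ''y'' (t * k + j) + s ''ell'' 0 * of_bool (s ''s'' t = j \<and> t < n) \<and>
    q ''h'' (t * k + j) = s ''h'' (t * k + j) + s ''ell'' 0 * of_bool (s ''s'' t = j \<and> s ''b'' t \<noteq> 0 \<and> t < n))"
    for n and q :: store
  have "R (1 + T) (run c_count s)"
    unfolding c_count_def
  proof (rule For_rule[where P = R and R = "R (1 + T)" and N = T], goal_cases)
    case (3 t q)
    have t: "t \<in> {1..T}" using 3 by simp
    have fr: "q ''in'' = s ''in''" "q ''s'' = s ''s''" "q ''b'' = s ''b''" "q ''ell'' = s ''ell''"
      using 3(4) by simp_all
    show ?case using 3(3) sk[OF t] unfolding R_def by (auto simp: fr k less_Suc_eq)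
  qed (use T in \<open>auto simp: R_def\<close>)
  then show ?thesis by (auto simp: R_def)
qed

lemma card_Suc_interval: "1 \<le> n \<Longrightarrow> card {t. 1 \<le> t \<and> t < Suc n \<and> P t} = card {t. 1 \<le> t \<and> t < n \<and> P t} + of_bool (P n)"
  using card_less_Suc_if[of n "\<lambda>t. 1 \<le> t \<and> P t"] by (auto simp: conj_ac)

lemma run_load:
  assumes k: "s ''in'' (Suc 0) = k" and T: "s ''in'' 2 = T"
    and sk: "\<And>t. t \<in> {1..T} \<Longrightarrow> s ''s'' t < k"
  shows "\<forall>\<tau>\<in>{1..T}. \<forall>j<k. run c_load s ''Q'' (\<tau> * k + j) = s ''Q'' (\<tau> * k + j) +
    s ''B'' 0 * card {t \<in> {1..T}. s ''s'' t = j \<and> \<tau> \<le> t \<and> (\<tau> = t \<or> s ''b'' t \<noteq> 0 \<and> s ''pv'' t < \<tau>)}"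
proof -
  define w where "w t \<tau> \<longleftrightarrow> \<tau> \<le> t \<and> (\<tau> = t \<or> s ''b'' t \<noteq> 0 \<and> s ''pv'' t < \<tau>)" for t \<tau>
  define R where "R n q \<longleftrightarrow> (\<forall>\<tau>\<in>{1..T}. \<forall>j<k. q ''Q'' (\<tau> * k + j) = s ''Q'' (\<tau> * k + j) +
    s ''B'' 0 * card {t. 1 \<le> t \<and> t < n \<and> s ''s'' t = j \<and> w t \<tau>})"
    for n and q :: store
  have "R (1 + T) (run c_load s)"
    unfolding c_load_def
  proof (rule For_rule[where P = R and R = "R (1 + T)" and N = T], goal_cases)
    case (3 t q)
    have t: "t \<in> {1..T}" using 3 by simp
    have fr: "q ''in'' = s ''in''" "q ''s'' = s ''s''" "q ''b'' = s ''b''" "q ''B'' = s ''B''" "q ''pv'' = s ''pv''"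
      using 3(4) by simp_all
    define J where "J a q' \<longleftrightarrow> (\<forall>\<tau>\<in>{1..T}. \<forall>j<k. q' ''Q'' (\<tau> * k + j) = q ''Q'' (\<tau> * k + j) +
      s ''B'' 0 * of_bool (s ''s'' t = j \<and> w t \<tau> \<and> \<tau> < a))" for a and q' :: store
    show ?case
    proof (rule For_rule[where P = J and R = "R (Suc t)" and N = T], goal_cases)
      case (3 a q')
      have fr': "q' ''in'' = s ''in''" "q' ''s'' = s ''s''" "q' ''b'' = s ''b''" "q' ''B'' = s ''B''" "q' ''pv'' = s ''pv''"
        "q' ''t'' 0 = t"
        using 3(4) fr by simp_all
      have wa: "w t a \<longleftrightarrow> a \<le> t \<and> (a = t \<or> s ''b'' t \<noteq> 0 \<and> s ''pv'' t < a)" by (simp add: w_def)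
      show ?case using 3(3) sk[OF t] unfolding J_def by (auto simp: fr' k less_Suc_eq wa)
    next
      case (4 q')
      have "q' ''Q'' (\<tau> * k + j) = s ''Q'' (\<tau> * k + j) +
          s ''B'' 0 * card {u. 1 \<le> u \<and> u < Suc t \<and> s ''s'' u = j \<and> w u \<tau>}" if "\<tau> \<in> {1..T}" "j < k" for \<tau> j
      proof -
        have "q' ''Q'' (\<tau> * k + j) = q ''Q'' (\<tau> * k + j) + s ''B'' 0 * of_bool (s ''s'' t = j \<and> w t \<tau>)"
          using 4(1) that by (auto simp: J_def)
        also have "q ''Q'' (\<tau> * k + j) = s ''Q'' (\<tau> * k + j) +
          s ''B'' 0 * card {u. 1 \<le> u \<and> u < t \<and> s ''s'' u = j \<and> w u \<tau>}"
          using \<open>R t q\<close> that by (simp add: R_def)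
        finally show ?thesis using t card_Suc_interval[of t "\<lambda>u. s ''s'' u = j \<and> w u \<tau>"]
          by (simp add: algebra_simps)
      qed
      then show ?case by (simp add: R_def)
    qed (use fr T in \<open>auto simp: J_def\<close>)
  qed (use T in \<open>auto simp: R_def\<close>)
  moreover have "{t. 1 \<le> t \<and> t < 1 + T \<and> s ''s'' t = j \<and> w t \<tau>} = {t \<in> {1..T}. s ''s'' t = j \<and> w t \<tau>}" for j \<tau>
    by auto
  ultimately show ?thesis unfolding R_def w_def by simp
qed

lemma run_drain:
  assumes k: "s ''in'' (Suc 0) = k" and T: "s ''in'' 2 = T"
  shows "\<forall>t\<in>{1..T}. \<forall>j<k. run c_drain s ''Q'' (t * k + j) = s ''Q'' (t * k + j) -
    s ''B'' 0 * card {i. i < k \<and> s ''cl'' i = j}"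
proof -
  \<comment> \<open>Progress in lexicographic order: rows before \<open>n\<close> are finished, and
    in row \<open>n\<close> the cells before \<open>m\<close>.\<close>
  define R where "R n m q \<longleftrightarrow> (\<forall>t\<in>{1..T}. \<forall>j<k. q ''Q'' (t * k + j) = (if t < n \<or> t = n \<and> j < m then
    s ''Q'' (t * k + j) - s ''B'' 0 * card {i. i < k \<and> s ''cl'' i = j} else s ''Q'' (t * k + j)))"
    for n m and q :: store
  have "R (1 + T) 0 (run c_drain s)"
    unfolding c_drain_def
  proof (rule For_rule[where P = "\<lambda>n. R n 0" and R = "R (1 + T) 0" and N = T], goal_cases)
    case (3 t q)
    have t: "t \<in> {1..T}" using 3 by simp
    have fr: "q ''in'' = s ''in''" "q ''cl'' = s ''cl''" "q ''B'' = s ''B''" using 3(4) by simp_all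
    show ?case
    proof (rule For_rule[where P = "R t" and R = "R (Suc t) 0" and N = k], goal_cases)
      case (3 j q')
      have fr': "q' ''in'' = s ''in''" "q' ''cl'' = s ''cl''" "q' ''B'' = s ''B''" "q' ''t'' 0 = t"
        using 3(4) fr by simp_all
      define J where "J n z \<longleftrightarrow> (\<forall>t'\<in>{1..T}. \<forall>j'<k. z ''Q'' (t' * k + j') = (if t' = t \<and> j' = j then
        s ''Q'' (t * k + j) - s ''B'' 0 * card {i. i < n \<and> s ''cl'' i = j} else q' ''Q'' (t' * k + j')))"
        for n and z :: store
      show ?case
      proof (rule For_rule[where P = J and R = "R t (Suc j)" and N = k], goal_cases)
        case 2
        then show ?case using \<open>R t j q'\<close> by (auto simp: J_def R_def)
      next
        case (3 i z)
        have e: "z ''in'' = s ''in''" "z ''cl'' = s ''cl''" "z ''B'' = s ''B''" "z ''t'' 0 = t" "z ''j'' 0 = j"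
          using 3(4) fr' by simp_all
        have zQ: "z ''Q'' (t * k + j) = s ''Q'' (t * k + j) - s ''B'' 0 * card {i'. i' < i \<and> s ''cl'' i' = j}"
          using 3(3) t \<open>j < 0 + k\<close> by (simp add: J_def)
        show ?case using 3(3) \<open>j < 0 + k\<close> unfolding J_def
          by (auto simp: e k zQ card_less_Suc_if add_mult_distrib2)
      next
        case (4 z)
        then show ?case using \<open>R t j q'\<close> by (auto simp: J_def R_def less_Suc_eq)
      qed (use fr' k in auto)
    next
      case (4 q')
      then show ?case by (auto simp: R_def less_Suc_eq)
    qed (use fr k \<open>R t 0 q\<close> in \<open>auto simp: R_def\<close>)
  next
    case 2
    then show ?case by (auto simp: R_def)
  next
    case (4 q)
    then show ?case by (auto simp: R_def)
  qed (use T in auto)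
  then show ?thesis by (auto simp: R_def)
qed

lemma run_clear:
  assumes k: "s ''in'' (Suc 0) = k" and T: "s ''in'' 2 = T"
  shows "\<forall>t\<in>{1..T}. \<forall>j<k. run c_clear s ''Q'' (t * k + j) = 0 \<and> run c_clear s ''y'' (t * k + j) = 0 \<and>
    run c_clear s ''h'' (t * k + j) = 0"
  unfolding c_clear_def
proof (rule For2_cells, goal_cases)
  case (5 t j s')
  have "s' ''in'' = s ''in''" using 5(5) by simp
  then show ?case using 5(1-4) k by auto
qed (use k T in auto)

lemma run_save:
  assumes k: "s ''in'' (Suc 0) = k" and T: "s ''in'' 2 = T"
  shows "\<forall>t\<in>{1..T}. \<forall>j<k. run c_save s ''yb'' (t * k + j) = s ''y'' (t * k + j) \<and>
    run c_save s ''hb'' (t * k + j) = s ''h'' (t * k + j)"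
  unfolding c_save_def
proof (rule For2_cells, goal_cases)
  case (5 t j s')
  have "s' ''in'' = s ''in''" "s' ''y'' = s ''y''" "s' ''h'' = s ''h''" using 5(5) by simp_all
  then show ?case using 5(1-4) k by auto
qed (use k T in auto)

lemma run_flags:
  assumes k: "s ''in'' (Suc 0) = k" and T: "s ''in'' 2 = T"
  defines "r \<equiv> run c_flags s" and "RR \<equiv> 900 * (T * k * (T + k)\<^sup>2)"
  shows "\<forall>t\<in>{1..T}. \<forall>j<k. r ''okf'' (t * k + j) = of_bool (s ''cl'' j = j \<and> 11 * RR \<le> s ''yb'' (t * k + j) * 20) \<and>
    r ''okh'' (t * k + j) = of_bool (s ''cl'' j = j \<and> 11 * RR \<le> s ''hb'' (t * k + j) * 20) \<and>
    r ''F'' (t * k + j) = s ''wt'' j \<and> r ''H'' (t * k + j) = 0"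
  unfolding r_def c_flags_def
proof (rule For2_cells, goal_cases)
  case (5 t j s')
  have "s' ''in'' = s ''in''" "s' ''cl'' = s ''cl''" "s' ''yb'' = s ''yb''" "s' ''hb'' = s ''hb''" "s' ''wt'' = s ''wt''"
    using 5(5) by simp_all
  then show ?case using 5(1-4) k T by (auto simp: RR_def)
qed (use k T in auto)

lemma run_check:
  assumes k: "s ''in'' (Suc 0) = k" and T: "s ''in'' 2 = T"
  shows "run c_check s ''ok'' 0 \<noteq> 0 \<longleftrightarrow> (\<forall>t\<in>{1..T}. \<forall>j<k. s ''cl'' j = j \<longrightarrow>
    10 * s ''Q'' (t * k + j) \<le> 900 * (T * k * (T + k)\<^sup>2) * s ''B'' 0)"
proof -
  define c where "c t j \<longleftrightarrow> s ''cl'' j = j \<longrightarrow> 10 * s ''Q'' (t * k + j) \<le> 900 * (T * k * (T + k)\<^sup>2) * s ''B'' 0" for t j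
  define R where "R n m q \<longleftrightarrow> (q ''ok'' 0 \<noteq> 0 \<longleftrightarrow> (\<forall>t\<in>{1..T}. \<forall>j<k. t < n \<or> t = n \<and> j < m \<longrightarrow> c t j))"
    for n m and q :: store
  have "R (1 + T) 0 (run c_check s)"
    unfolding c_check_def
  proof (rule Sq_rule[where P = "\<lambda>q. q ''ok'' 0 = 1" and R = "R (1 + T) 0"], goal_cases)
    case (2 s1)
    have fr1: "s1 y = s y" if "y \<noteq> ''ok''" for y using 2(2) that by simp
    show ?case
    proof (rule For_rule[where P = "\<lambda>n. R n 0" and R = "R (1 + T) 0" and N = T], goal_cases)
      case (3 t q)
      have fr: "q ''in'' = s ''in''" "q ''cl'' = s ''cl''" "q ''B'' = s ''B''" "q ''Q'' = s ''Q''"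
        using 3(4) fr1 by simp_all
      show ?case
      proof (rule For_rule[where P = "R t" and R = "R (Suc t) 0" and N = k], goal_cases)
        case (3 j q')
        have fr': "q' ''in'' = s ''in''" "q' ''cl'' = s ''cl''" "q' ''B'' = s ''B''" "q' ''Q'' = s ''Q''" "q' ''t'' 0 = t"
          using 3(4) fr by simp_all
        have "\<not> c t j \<longleftrightarrow> s ''cl'' j = j \<and> s ''B'' 0 * (900 * (T * k * (T + k)\<^sup>2)) < s ''Q'' (t * k + j) * 10"
          by (auto simp: c_def mult.commute)
        then show ?case using 3(1-3) \<open>1 \<le> t\<close> \<open>t < 1 + T\<close> unfolding R_def
          by (auto simp: fr' k T less_Suc_eq)
      next
        case (4 q')
        then show ?case by (auto simp: R_def less_Suc_eq)
      qed (use fr k \<open>R t 0 q\<close> in \<open>auto simp: R_def\<close>)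
    next
      case 2
      then show ?case using \<open>s1 ''ok'' 0 = 1\<close> by (auto simp: R_def)
    next
      case (4 q)
      then show ?case by (auto simp: R_def)
    qed (use T fr1 in auto)
  qed auto
  then show ?thesis by (auto simp: R_def c_def)
qed

section \<open>Correctness of the algorithm\<close>

context kserver
begin

text \<open>After the preprocessing none of these cells is written again, so \<open>env\<close>
  passes to every later store by \<open>env_frame\<close>.\<close>

definition env :: "store \<Rightarrow> bool" where
  "env s \<longleftrightarrow> s ''in'' (Suc 0) = k \<and> s ''in'' 2 = T \<and> (\<forall>t\<in>{1..T}. s ''sg'' t = sg t \<and> s ''pv'' t = pv t) \<and>
    (\<forall>i<k. s ''wt'' i = wt i \<and> s ''cl'' i = cl i) \<and> s ''ell'' 0 = ell \<and>
    (\<forall>t\<in>{1..T}. \<forall>j<k. (\<exists>i<k. cl i = j \<and> p0 i = sg t \<and> s ''ini'' (t * k + j) = Suc i) \<or>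
      s ''ini'' (t * k + j) = 0 \<and> \<not> ini t j)"

lemma envD:
  assumes "env s"
  shows "s ''in'' (Suc 0) = k" "s ''in'' 2 = T" "t \<in> {1..T} \<Longrightarrow> s ''sg'' t = sg t" "t \<in> {1..T} \<Longrightarrow> s ''pv'' t = pv t"
    "i < k \<Longrightarrow> s ''wt'' i = wt i" "i < k \<Longrightarrow> s ''cl'' i = cl i" "s ''ell'' 0 = ell"
    "t \<in> {1..T} \<Longrightarrow> j < k \<Longrightarrow> s ''ini'' (t * k + j) \<noteq> 0 \<longleftrightarrow> ini t j"
proof -
  note e = assms[unfolded env_def]
  note e6 = e[THEN conjunct2, THEN conjunct2, THEN conjunct2, THEN conjunct2, THEN conjunct2]
  show "s ''in'' (Suc 0) = k" "s ''in'' 2 = T" "s ''ell'' 0 = ell" using e by blast+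
  show "t \<in> {1..T} \<Longrightarrow> s ''sg'' t = sg t" "t \<in> {1..T} \<Longrightarrow> s ''pv'' t = pv t"
    "i < k \<Longrightarrow> s ''wt'' i = wt i" "i < k \<Longrightarrow> s ''cl'' i = cl i" using e by blast+
  show "s ''ini'' (t * k + j) \<noteq> 0 \<longleftrightarrow> ini t j" if "t \<in> {1..T}" "j < k"
  proof -
    have "(\<exists>i<k. cl i = j \<and> p0 i = sg t \<and> s ''ini'' (t * k + j) = Suc i) \<or>
      s ''ini'' (t * k + j) = 0 \<and> \<not> ini t j" using e6[rule_format, OF that] .
    then show ?thesis
    proof
      assume "\<exists>i<k. cl i = j \<and> p0 i = sg t \<and> s ''ini'' (t * k + j) = Suc i"
      then obtain i where i: "i < k" "cl i = j" "p0 i = sg t" "s ''ini'' (t * k + j) = Suc i" by blast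
      have "ini t j" unfolding ini_def using i by blast
      then show ?thesis using i(4) by simp
    qed simp
  qed
qed

lemma env_ini:
  assumes "env s" "t \<in> {1..T}" "j < k" "ini t j"
  shows "\<exists>i<k. cl i = j \<and> p0 i = sg t \<and> s ''ini'' (t * k + j) = Suc i"
proof -
  note e = assms(1)[unfolded env_def]
  note e6 = e[THEN conjunct2, THEN conjunct2, THEN conjunct2, THEN conjunct2, THEN conjunct2]
  show ?thesis using e6[rule_format, OF assms(2,3)] assms(4) by (elim disjE conjE) simp_all
qed

lemma env_frame:
  assumes "env s" "s' ''in'' = s ''in''" "s' ''sg'' = s ''sg''" "s' ''pv'' = s ''pv''" "s' ''wt'' = s ''wt''"
    "s' ''cl'' = s ''cl''" "s' ''ell'' = s ''ell''" "s' ''ini'' = s ''ini''"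
  shows "env s'"
  using assms(1) unfolding env_def assms(2-8) .

lemma reps_less: "j \<in> reps \<Longrightarrow> j < k"
  by (simp add: reps_def)

text \<open>Applied twice: to the prices of a round, and to the thresholds that define the final
  plan.\<close>

lemma run_dp_back:
  assumes env: "env s"
    and ex: "\<And>t. t \<in> {1..T} \<Longrightarrow> \<exists>j<k. s ''okf'' (t * k + j) \<noteq> 0"
    and ok: "\<And>t j. t \<in> {1..T} \<Longrightarrow> j < k \<Longrightarrow> s ''okh'' (t * k + j) \<noteq> 0 \<Longrightarrow>
      s ''okf'' (t * k + j) \<noteq> 0 \<and> (0 < pv t \<longrightarrow> s ''okf'' (pv t * k + j) \<noteq> 0)"
  defines "r \<equiv> run c_back (run c_dp s)"
  shows "dyn_prog k T sg wt cl pv (\<lambda>t j. j < k \<and> s ''okf'' (t * k + j) \<noteq> 0) (\<lambda>t j. s ''okh'' (t * k + j) \<noteq> 0)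
    (\<lambda>t j. r ''hit'' (t * k + j) \<noteq> 0) (\<lambda>t j. s ''F'' (t * k + j)) (\<lambda>t j. s ''H'' (t * k + j))
    (\<lambda>t j. r ''D'' (t * k + j)) (r ''E'') (r ''ar'') (r ''s'') (\<lambda>t. r ''b'' t \<noteq> 0)"
proof -
  define r1 where "r1 = run c_dp s"
  have pv: "s ''pv'' t < t" "s ''pv'' t = pv t" if "t \<in> {1..T}" for t
    using envD(4)[OF env that] pv_less[OF that] by auto
  have dp: "dp_inv k s (1 + T) r1"
    unfolding r1_def using run_dp[where s = s, OF envD(1)[OF env] envD(2)[OF env] pv(1) ex] by blast
  have eq: "r ''D'' = r1 ''D''" "r ''E'' = r1 ''E''" "r ''ar'' = r1 ''ar''" "r ''hit'' = r1 ''hit''"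
    by (simp_all add: r_def r1_def run_frame)
  have fr: "r1 ''pv'' = s ''pv''" "r1 ''in'' = s ''in''" by (simp_all add: r1_def run_frame)
  have bk: "\<forall>t\<in>{1..T}. r ''b'' t = r1 ''hit'' (t * k + r ''s'' t) \<and>
    (r ''b'' t \<noteq> 0 \<and> 0 < r1 ''pv'' t \<longrightarrow> r ''s'' (r1 ''pv'' t) = r ''s'' t) \<and>
    ((\<forall>t'\<in>{1..T}. r1 ''pv'' t' = t \<longrightarrow> r ''b'' t' = 0) \<longrightarrow> r ''s'' t = r1 ''ar'' t)"
    unfolding r_def r1_def[symmetric]
  proof (rule run_back)
    show "r1 ''in'' (Suc 0) = k" "r1 ''in'' 2 = T" using fr envD(1,2)[OF env] by simp_all
    show "r1 ''pv'' t < t" if "t \<in> {1..T}" for t using pv(1)[OF that] by (simp add: fr)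
    show "t = t'" if "t \<in> {1..T}" "t' \<in> {1..T}" "r1 ''pv'' t = r1 ''pv'' t'" "0 < r1 ''pv'' t" for t t'
      using pv_inj[OF that(1,2)] that pv(2)[OF that(1)] pv(2)[OF that(2)] by (simp add: fr)
  qed
  have cell: "dp_cell k s t j r1" if "t \<in> {1..T}" "j < k" for t j
    using dp that by (auto simp: dp_inv_def)
  have best: "dp_best k s k t r1" if "t \<in> {1..T}" for t
    using dp that by (auto simp: dp_inv_def)
  show ?thesis
  proof (unfold_locales, goal_cases)
    case (6 t j)
    then show ?case using cell[of t j] pv[of t] unfolding eq dp_cell_def Let_def by simp
  next
    case (7 t j)
    then show ?case using cell[of t j] pv[of t] unfolding eq dp_cell_def Let_def by simp
  next
    case (8 t)
    then show ?case using best[of t] unfolding eq dp_best_def by simp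
  next
    case (9 t j)
    then show ?case using best[of t] unfolding eq dp_best_def by blast
  next
    case (10 t)
    then show ?case using bk unfolding eq by simp
  next
    case (11 t)
    then have t: "t \<in> {1..T}" and *: "0 < pv t" "r ''b'' t \<noteq> 0" by auto
    show ?case using bk[unfolded fr, THEN bspec, OF t] * unfolding pv(2)[OF t] by blast
  next
    case (12 t)
    then show ?case using bk pv unfolding eq fr by auto
  qed (use ok dp in \<open>auto simp: eq dp_inv_def\<close>)
qed

definition counts :: "store \<Rightarrow> string \<Rightarrow> (nat \<Rightarrow> nat \<Rightarrow> nat) \<Rightarrow> bool" where
  "counts s x y \<longleftrightarrow> (\<forall>t\<in>{1..T}. \<forall>j<k. s x (t * k + j) = ell * y t j)"

definition rstate :: "nat \<Rightarrow> nat \<Rightarrow> nat \<Rightarrow> store \<Rightarrow> bool" where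
  "rstate B opt r s \<longleftrightarrow> (\<exists>y h. counts s ''y'' y \<and> counts s ''h'' h \<and> rinv B opt r (\<lambda>t j. s ''Q'' (t * k + j)) y h)"

text \<open>The plan \<open>so\<close> is a competitor that appears in the analysis only: it is
  admissible for the shortest paths and stays within the capacities, which yields the hypothesis on
  prices in \<open>rinv_step\<close>.\<close>

lemma run_round:
  assumes env: "env s" and B: "s ''B'' 0 = B" and st: "rstate B opt r s"
    and po: "plan so bo" and lo: "\<And>j \<tau>. \<tau> \<in> {1..T} \<Longrightarrow> load so bo j \<tau> \<le> kk j" and fo: "fcost so bo = opt"
  shows "rstate B opt (Suc r) (run c_round s)"
proof -
  define s1 where "s1 = run c_set s"
  define s3 where "s3 = run c_back (run c_dp s1)"
  define s4 where "s4 = run c_count s3"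
  define s5 where "s5 = run c_load s4"
  define s6 where "s6 = run c_drain s5"
  have run: "run c_round s = s6" by (simp add: c_round_def s1_def s3_def s4_def s5_def s6_def)
  have env1: "env s1" using env by (rule env_frame) (simp_all add: s1_def run_frame)
  have env3: "env s3" using env1 by (rule env_frame) (simp_all add: s3_def run_frame)
  have env4: "env s4" using env3 by (rule env_frame) (simp_all add: s4_def run_frame)
  have env5: "env s5" using env4 by (rule env_frame) (simp_all add: s5_def run_frame)
  let ?Q = "\<lambda>t j. s ''Q'' (t * k + j)"
  have set: "s1 ''okf'' (t * k + j) = of_bool (cl j = j)"
    "s1 ''okh'' (t * k + j) = of_bool (cl j = j \<and> (pv t \<noteq> 0 \<or> ini t j))"
    "s1 ''F'' (t * k + j) = (4 * DD) * wt j + ?Q t j"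
    "s1 ''H'' (t * k + j) = (\<Sum>a\<in>{pv t<..t}. ?Q a j)" if "t \<in> {1..T}" "j < k" for t j
    using run_set[where s = s, OF envD(1)[OF env] envD(2)[OF env], rule_format, OF that]
    unfolding s1_def[symmetric] envD(4)[OF env that(1)] envD(5,6)[OF env that(2)] envD(8)[OF env that] DD_def
    by (simp_all add: mult.commute[of "wt j"])
  define ss where "ss = s3 ''s''"
  define b where "b t \<longleftrightarrow> s3 ''b'' t \<noteq> 0" for t
  interpret dyn_prog k T sg wt p0 cl pv "\<lambda>t j. j < k \<and> s1 ''okf'' (t * k + j) \<noteq> 0" "\<lambda>t j. s1 ''okh'' (t * k + j) \<noteq> 0"
    "\<lambda>t j. s3 ''hit'' (t * k + j) \<noteq> 0" "\<lambda>t j. s1 ''F'' (t * k + j)" "\<lambda>t j. s1 ''H'' (t * k + j)"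
    "\<lambda>t j. s3 ''D'' (t * k + j)" "s3 ''E''" "s3 ''ar''" ss b
    unfolding s3_def ss_def b_def
  proof (rule run_dp_back[OF env1])
    show "\<exists>j<k. s1 ''okf'' (t * k + j) \<noteq> 0" if "t \<in> {1..T}" for t
      using cl_reps[OF k_pos] set(1)[OF that, of "cl 0"] by (auto simp: reps_def)
  next
    fix t j assume t: "t \<in> {1..T}" and j: "j < k" and ok: "s1 ''okh'' (t * k + j) \<noteq> 0"
    have "cl j = j" using ok set(2)[OF t j] by auto
    moreover have "pv t \<in> {1..T}" if "0 < pv t" using that pv_less[OF t] t by auto
    ultimately show "s1 ''okf'' (t * k + j) \<noteq> 0 \<and> (0 < pv t \<longrightarrow> s1 ''okf'' (pv t * k + j) \<noteq> 0)"
      using set(1)[of _ j] t j by auto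
  qed
  have sreps: "ss t \<in> reps" if "t \<in> {1..T}" for t
    using okf_s[OF that] set(1)[OF that, of "ss t"] by (auto simp: reps_def)
  have plan: "plan ss b"
    unfolding plan_def
  proof (intro ballI conjI impI)
    fix t assume t: "t \<in> {1..T}"
    show "ss t \<in> reps" using sreps[OF t] .
    assume bt: "b t"
    have "s1 ''okh'' (t * k + ss t) \<noteq> 0" using okh_s[OF t bt] .
    then have "pv t \<noteq> 0 \<or> ini t (ss t)" using set(2)[OF t s_less[OF t]] by auto
    then show "if pv t = 0 then ini t (ss t) else ss (pv t) = ss t" using s_pv[OF t _ bt] by auto
  qed
  have poD: "so t \<in> reps" "bo t \<Longrightarrow> pv t = 0 \<Longrightarrow> ini t (so t)" "bo t \<Longrightarrow> 0 < pv t \<Longrightarrow> so (pv t) = so t"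
    if "t \<in> {1..T}" for t using po that by (auto simp: plan_def)
  have "pcost (\<lambda>t j. s1 ''F'' (t * k + j)) (\<lambda>t j. s1 ''H'' (t * k + j)) ss b \<le>
      pcost (\<lambda>t j. s1 ''F'' (t * k + j)) (\<lambda>t j. s1 ''H'' (t * k + j)) so bo"
  proof (rule pcost_le)
    show "so t < k \<and> s1 ''okf'' (t * k + so t) \<noteq> 0" if "t \<in> {1..T}" for t
      using poD(1)[OF that] set(1)[OF that, of "so t"] by (auto simp: reps_def)
    show "s1 ''okh'' (t * k + so t) \<noteq> 0" if "t \<in> {1..T}" "bo t" for t
      using poD[OF that(1)] that(2) set(2)[OF that(1), of "so t"] by (auto simp: reps_def)
  qed (use poD in auto)
  moreover have "pcost (\<lambda>t j. s1 ''F'' (t * k + j)) (\<lambda>t j. s1 ''H'' (t * k + j)) z c =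
      4 * DD * fcost z c + (\<Sum>\<tau>=1..T. \<Sum>j\<in>reps. ?Q \<tau> j * load z c j \<tau>)"
    if "\<And>t. t \<in> {1..T} \<Longrightarrow> z t \<in> reps" for z c
    using that set reps_less by (intro pcost_prices) auto
  ultimately have "4 * DD * fcost ss b + (\<Sum>\<tau>=1..T. \<Sum>j\<in>reps. ?Q \<tau> j * load ss b j \<tau>) \<le>
      4 * DD * fcost so bo + (\<Sum>\<tau>=1..T. \<Sum>j\<in>reps. ?Q \<tau> j * load so bo j \<tau>)"
    using sreps poD(1) by simp
  also have "\<dots> \<le> 4 * DD * opt + (\<Sum>\<tau>=1..T. \<Sum>j\<in>reps. ?Q \<tau> j * kk j)"
    unfolding fo using lo by (intro add_left_mono sum_mono mult_le_mono2) auto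
  finally have hyp: "4 * DD * fcost ss b + (\<Sum>\<tau>=1..T. \<Sum>j\<in>reps. ?Q \<tau> j * load ss b j \<tau>) \<le>
    4 * DD * opt + (\<Sum>\<tau>=1..T. \<Sum>j\<in>reps. ?Q \<tau> j * kk j)" .
  obtain y h where y: "counts s ''y'' y" and h: "counts s ''h'' h" and inv: "rinv B opt r ?Q y h"
    using st by (auto simp: rstate_def)
  define y' where "y' t j = y t j + of_bool (ss t = j)" for t j
  define h' where "h' t j = h t j + of_bool (ss t = j \<and> b t)" for t j
  have e3: "s3 ''y'' = s ''y''" "s3 ''h'' = s ''h''" by (simp_all add: s3_def s1_def run_frame)
  have "\<forall>t\<in>{1..T}. \<forall>j<k. s4 ''y'' (t * k + j) = s3 ''y'' (t * k + j) + s3 ''ell'' 0 * of_bool (s3 ''s'' t = j) \<and>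
    s4 ''h'' (t * k + j) = s3 ''h'' (t * k + j) + s3 ''ell'' 0 * of_bool (s3 ''s'' t = j \<and> s3 ''b'' t \<noteq> 0)"
    unfolding s4_def by (rule run_count) (use envD(1,2)[OF env3] s_less in \<open>auto simp: ss_def\<close>)
  then have y4: "counts s4 ''y'' y'" and h4: "counts s4 ''h'' h'"
    using y h envD(7)[OF env3] unfolding counts_def y'_def h'_def ss_def b_def e3
    by (simp_all add: add_mult_distrib2)
  have e4: "s4 ''s'' = ss" "s4 ''b'' = s3 ''b''" "s4 ''Q'' = s ''Q''" "s4 ''B'' 0 = B"
    by (simp_all add: s4_def s3_def s1_def run_frame ss_def B)
  have "\<forall>\<tau>\<in>{1..T}. \<forall>j<k. s5 ''Q'' (\<tau> * k + j) = s4 ''Q'' (\<tau> * k + j) +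
    s4 ''B'' 0 * card {t \<in> {1..T}. s4 ''s'' t = j \<and> \<tau> \<le> t \<and> (\<tau> = t \<or> s4 ''b'' t \<noteq> 0 \<and> s4 ''pv'' t < \<tau>)}"
    unfolding s5_def by (rule run_load) (use envD(1,2)[OF env4] s_less e4 in auto)
  moreover have "{t \<in> {1..T}. s4 ''s'' t = j \<and> \<tau> \<le> t \<and> (\<tau> = t \<or> s4 ''b'' t \<noteq> 0 \<and> s4 ''pv'' t < \<tau>)} =
      {t \<in> {1..T}. ss t = j \<and> win b t \<tau>}" for j \<tau>
    using envD(4)[OF env4] by (auto simp: e4 win_def b_def)
  ultimately have Q5: "s5 ''Q'' (\<tau> * k + j) = ?Q \<tau> j + B * load ss b j \<tau>" if "\<tau> \<in> {1..T}" "j < k" for \<tau> j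
    using that unfolding load_def by (simp add: e4)
  have e5: "s5 ''B'' 0 = B" using e4(4) by (simp add: s5_def run_frame)
  have "\<forall>t\<in>{1..T}. \<forall>j<k. s6 ''Q'' (t * k + j) = s5 ''Q'' (t * k + j) -
    s5 ''B'' 0 * card {i. i < k \<and> s5 ''cl'' i = j}"
    unfolding s6_def by (rule run_drain) (use envD(1,2)[OF env5] in auto)
  moreover have "{i. i < k \<and> s5 ''cl'' i = j} = {i. i < k \<and> cl i = j}" for j
    using envD(6)[OF env5] by auto
  ultimately have Q6: "s6 ''Q'' (t * k + j) = ?Q t j + B * load ss b j t - B * kk j" if "t \<in> {1..T}" "j < k" for t j
    using that Q5[OF that] by (simp add: kk_def e5)
  have "rinv B opt (Suc r) (\<lambda>t j. s6 ''Q'' (t * k + j)) y' h'"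
    by (rule rinv_step[OF inv plan hyp]) (use Q6 reps_less in \<open>auto simp: y'_def h'_def\<close>)
  moreover have "s6 ''y'' = s4 ''y''" "s6 ''h'' = s4 ''h''" by (simp_all add: s6_def s5_def run_frame)
  ultimately show ?thesis unfolding run rstate_def using y4 h4 by (auto simp: counts_def)
qed

lemma run_rounds:
  assumes env: "env s" and B: "s ''B'' 0 = B"
    and po: "plan so bo" and lo: "\<And>j \<tau>. \<tau> \<in> {1..T} \<Longrightarrow> load so bo j \<tau> \<le> kk j" and fo: "fcost so bo = opt"
  shows "rstate B opt (900 * DD) (run c_rounds s)"
proof -
  define s0 where "s0 = run c_clear s"
  have env0: "env s0" using env by (rule env_frame) (simp_all add: s0_def run_frame)
  have B0: "s0 ''B'' 0 = B" using B by (simp add: s0_def run_frame)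
  have clear: "\<forall>t\<in>{1..T}. \<forall>j<k. s0 ''Q'' (t * k + j) = 0 \<and> s0 ''y'' (t * k + j) = 0 \<and> s0 ''h'' (t * k + j) = 0"
    unfolding s0_def by (rule run_clear[where s = s, OF envD(1)[OF env] envD(2)[OF env]])
  have "rstate B opt 0 s0"
    unfolding rstate_def
    by (rule exI[of _ "\<lambda>_ _. 0"], rule exI[of _ "\<lambda>_ _. 0"])
      (use clear reps_less in \<open>auto simp: counts_def rinv_def TC_def U_def\<close>)
  moreover have "rstate B opt (900 * DD) (run (For ''r'' 0 RRe c_round) s0)" if "rstate B opt 0 s0"
  proof (rule For_rule[where P = "rstate B opt" and R = "rstate B opt (900 * DD)" and N = "900 * DD"], goal_cases)
    case 1
    show ?case using envD(1,2)[OF env0] by (simp add: DD_def)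
  next
    case (3 i s')
    have "env s'" using env0 by (rule env_frame) (use 3(4) in simp_all)
    then have "env (upd ''r'' 0 i s')" by (rule env_frame) simp_all
    moreover have "upd ''r'' 0 i s' ''B'' 0 = B" using 3(4) B0 by simp
    moreover have "rstate B opt i (upd ''r'' 0 i s')" using 3(3) by (simp add: rstate_def counts_def)
    ultimately show ?case using run_round po lo fo by blast
  next
    case (4 s')
    then show ?case by (simp add: rstate_def counts_def)
  qed (use that in auto)
  ultimately show ?thesis unfolding c_rounds_def run.simps s0_def by blast
qed

text \<open>The queues are quantified because the next guess overwrites them. All guesses are
  positive, so 0 can mean that none has passed yet.\<close>

definition saved :: "nat \<Rightarrow> store \<Rightarrow> bool" where
  "saved opt s \<longleftrightarrow> s ''best'' 0 = 0 \<or> (\<exists>Q y h. counts s ''yb'' y \<and> counts s ''hb'' h \<and>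
    rinv (s ''best'' 0) opt (900 * DD) Q y h \<and> (\<forall>t\<in>{1..T}. \<forall>j\<in>reps. 10 * Q t j \<le> 900 * DD * s ''best'' 0))"

text \<open>A guess below \<open>opt\<close> may also pass the check. This does no harm: the cost
  bound holds for every guess and improves with smaller ones, so it suffices that the saved guess is
  at most each tried guess that is at least \<open>opt\<close>.\<close>

definition covers :: "nat \<Rightarrow> nat \<Rightarrow> nat \<Rightarrow> store \<Rightarrow> bool" where
  "covers opt n m s \<longleftrightarrow> (\<forall>j<k. \<forall>c\<le>T. (j < n \<or> j = n \<and> c < m) \<longrightarrow> opt \<le> 1 + wt j * c \<longrightarrow>
    s ''best'' 0 \<noteq> 0 \<and> s ''best'' 0 \<le> 1 + wt j * c)"

lemma saved_frame:
  assumes "saved opt s" "s' ''best'' = s ''best''" "s' ''yb'' = s ''yb''" "s' ''hb'' = s ''hb''"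
  shows "saved opt s'"
  using assms by (simp add: saved_def counts_def)

lemma covers_frame:
  assumes "covers opt n m s" "s' ''best'' = s ''best''"
  shows "covers opt n m s'"
  using assms by (simp add: covers_def)

definition c_try :: cmd where
  "c_try = c_rounds ;; c_check ;;
    When (AndE (V ''ok'') (OrE (NotE (V ''best'')) (LtE (V ''B'') (V ''best'')))) (Let0 ''best'' (V ''B'') ;; c_save)"

lemma run_try:
  assumes env: "env s" and B: "s ''B'' 0 = B" "0 < B"
    and po: "plan so bo" and lo: "\<And>j \<tau>. \<tau> \<in> {1..T} \<Longrightarrow> load so bo j \<tau> \<le> kk j" and fo: "fcost so bo = opt"
    and saved: "saved opt s"
  defines "r \<equiv> run c_try s"
  shows "saved opt r \<and> (opt \<le> B \<longrightarrow> r ''best'' 0 \<noteq> 0 \<and> r ''best'' 0 \<le> B) \<and>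
    (s ''best'' 0 \<noteq> 0 \<longrightarrow> r ''best'' 0 \<noteq> 0 \<and> r ''best'' 0 \<le> s ''best'' 0)"
proof -
  define s1 where "s1 = run c_rounds s"
  define s2 where "s2 = run c_check s1"
  have env1: "env s1" using env by (rule env_frame) (simp_all add: s1_def run_frame)
  have st: "rstate B opt (900 * DD) s1" unfolding s1_def by (rule run_rounds[OF env B(1) po lo fo])
  then obtain y h where y: "counts s1 ''y'' y" and h: "counts s1 ''h'' h"
    and inv: "rinv B opt (900 * DD) (\<lambda>t j. s1 ''Q'' (t * k + j)) y h" by (auto simp: rstate_def)
  have e1: "s1 ''B'' 0 = B" "s1 ''best'' = s ''best''" "s1 ''yb'' = s ''yb''" "s1 ''hb'' = s ''hb''"
    using B by (simp_all add: s1_def run_frame)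
  have ok: "s2 ''ok'' 0 \<noteq> 0 \<longleftrightarrow> (\<forall>t\<in>{1..T}. \<forall>j\<in>reps. 10 * s1 ''Q'' (t * k + j) \<le> 900 * DD * B)"
    unfolding s2_def run_check[where s = s1, OF envD(1)[OF env1] envD(2)[OF env1]] e1 DD_def[symmetric]
    using envD(6)[OF env1] by (auto simp: reps_def)
  have pass: "s2 ''ok'' 0 \<noteq> 0" if "opt \<le> B" unfolding ok using check_passes[OF inv that] by blast
  have e2: "s2 ''B'' 0 = B" "s2 ''best'' = s ''best''" "s2 ''yb'' = s ''yb''" "s2 ''hb'' = s ''hb''"
    using e1 by (simp_all add: s2_def run_frame)
  let ?c = "s2 ''ok'' 0 \<noteq> 0 \<and> (s ''best'' 0 = 0 \<or> B < s ''best'' 0)"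
  have run: "r = (if ?c then run c_save (upd ''best'' 0 B s2) else s2)"
    unfolding r_def c_try_def by (simp add: s1_def[symmetric] s2_def[symmetric] e2)
  show ?thesis
  proof (cases ?c)
    case True
    define z where "z = upd ''best'' 0 B s2"
    have r: "r = run c_save z" unfolding run z_def using True by (rule if_P)
    have zk: "z ''in'' (Suc 0) = k" "z ''in'' 2 = T" using envD(1,2)[OF env1] by (simp_all add: z_def s2_def run_frame)
    have zy: "z ''y'' = s1 ''y''" "z ''h'' = s1 ''h''" by (simp_all add: z_def s2_def run_frame)
    have "counts r ''yb'' y" "counts r ''hb'' h"
      using y h run_save[where s = z, OF zk] unfolding r counts_def zy by simp_all
    moreover have rb: "r ''best'' 0 = B" by (simp add: r z_def run_frame)
    ultimately have "saved opt r" using True inv unfolding ok saved_def by blast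
    then show ?thesis using rb B True by auto
  next
    case False
    have r: "r = s2" unfolding run using False by (rule if_not_P)
    have "saved opt r" unfolding r using saved e2(2-4) by (rule saved_frame)
    then show ?thesis using r False e2 pass by auto
  qed
qed

lemma run_guess:
  assumes env: "env s"
    and po: "plan so bo" and lo: "\<And>j \<tau>. \<tau> \<in> {1..T} \<Longrightarrow> load so bo j \<tau> \<le> kk j" and fo: "fcost so bo = opt"
  shows "saved opt (run c_guess s) \<and> covers opt k 0 (run c_guess s)"
proof -
  let ?R = "\<lambda>s. saved opt s \<and> covers opt k 0 s"
  have "?R (run c_guess s)"
    unfolding c_guess_def
  proof (rule Sq_rule[where P = "\<lambda>s'. s' ''best'' 0 = 0" and R = ?R], goal_cases)
    case (2 s1)
    have env1: "env s1" using env by (rule env_frame) (use 2(2) in simp_all)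
    show ?case
    proof (rule For_rule[where P = "\<lambda>n s. saved opt s \<and> covers opt n 0 s" and R = ?R and N = k], goal_cases)
      case 1
      show ?case using envD(1)[OF env1] by simp
    next
      case 2
      then show ?case using \<open>s1 ''best'' 0 = 0\<close> by (auto simp: saved_def covers_def)
    next
      case (3 g q)
      have envq: "env q" using env1 by (rule env_frame) (use 3(4) in simp_all)
      have gk: "g < k" using 3(2) by simp
      show ?case
      proof (rule Sq_rule[where P = "\<lambda>s'. saved opt s' \<and> covers opt g 0 s' \<and> s' ''B'' 0 = 1"
            and R = "\<lambda>s. saved opt s \<and> covers opt (Suc g) 0 s"], goal_cases)
        case 1
        show ?case using 3(3) saved_frame[of opt q] covers_frame[of opt g 0 q] by simp
      next
        case (2 q1)
        have env2: "env q1" using envq by (rule env_frame) (use 2(2) in simp_all)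
        have g1: "q1 ''g'' 0 = g" using 2(2) by simp
        show ?case
        proof (rule For_rule[where P = "\<lambda>u s. saved opt s \<and> covers opt g u s \<and> s ''B'' 0 = 1 + wt g * u"
              and R = "\<lambda>s. saved opt s \<and> covers opt (Suc g) 0 s" and N = "Suc T"], goal_cases)
          case 1
          show ?case using envD(2)[OF env2] by simp
        next
          case 2
          then show ?case using \<open>saved opt q1 \<and> covers opt g 0 q1 \<and> q1 ''B'' 0 = 1\<close> by simp
        next
          case (3 u z0)
          define z where "z = upd ''u'' 0 u z0"
          have envz: "env z" using env2 by (rule env_frame) (use 3(4) in \<open>simp_all add: z_def\<close>)
          have zg: "z ''g'' 0 = g" using 3(4) g1 by (simp add: z_def)
          have zero_less_one_plus: "0 < 1 + wt g * u" by simp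
          have zB: "z ''B'' 0 = 1 + wt g * u" and zs: "saved opt z" and zc: "covers opt g u z"
            using 3(3) saved_frame[of opt z0 z] covers_frame[of opt g u z0 z] by (simp_all add: z_def)
          define r where "r = run c_try z"
          have r: "saved opt r" "opt \<le> 1 + wt g * u \<Longrightarrow> r ''best'' 0 \<noteq> 0 \<and> r ''best'' 0 \<le> 1 + wt g * u"
            "z ''best'' 0 \<noteq> 0 \<Longrightarrow> r ''best'' 0 \<noteq> 0 \<and> r ''best'' 0 \<le> z ''best'' 0"
            using run_try[OF envz zB zero_less_one_plus po lo fo zs] unfolding r_def by blast+
          have rc: "covers opt g (Suc u) r"
            unfolding covers_def
          proof (intro allI impI)
            fix j c assume *: "j < k" "c \<le> T" "j < g \<or> j = g \<and> c < Suc u" "opt \<le> 1 + wt j * c"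
            show "r ''best'' 0 \<noteq> 0 \<and> r ''best'' 0 \<le> 1 + wt j * c"
            proof (cases "j = g \<and> c = u")
              case True then show ?thesis using r(2) * by simp
            next
              case False
              then have "z ''best'' 0 \<noteq> 0 \<and> z ''best'' 0 \<le> 1 + wt j * c" using zc * unfolding covers_def by auto
              then show ?thesis using r(3) by linarith
            qed
          qed
          have rB: "r ''B'' 0 = 1 + wt g * u" "r ''g'' 0 = g" "r ''wt'' = z ''wt''"
            using zB zg by (simp_all add: r_def run_frame c_try_def)
          have "run (c_rounds ;; c_check ;;
            When (AndE (V ''ok'') (OrE (NotE (V ''best'')) (LtE (V ''B'') (V ''best'')))) (Let0 ''best'' (V ''B'') ;; c_save) ;;
            Let0 ''B'' (Add (V ''B'') (C1 ''wt'' ''g''))) z = upd ''B'' 0 (1 + wt g * Suc u) r"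
            using rB envD(5)[OF envz gk] by (simp add: r_def c_try_def algebra_simps)
          moreover have "saved opt (upd ''B'' 0 (1 + wt g * Suc u) r)" using r(1) by (rule saved_frame) auto
          moreover have "covers opt g (Suc u) (upd ''B'' 0 (1 + wt g * Suc u) r)" using rc by (rule covers_frame) auto
          ultimately show ?case unfolding z_def[symmetric] by simp
        next
          case (4 z)
          have "covers opt g (Suc T) z" using 4(1) by simp
          then have "covers opt (Suc g) 0 z"
            unfolding covers_def by (metis less_Suc_eq le_imp_less_Suc less_nat_zero_code)
          then have "covers opt (Suc g) 0 (upd ''u'' 0 (0 + Suc T) z)" by (rule covers_frame) auto
          moreover have "saved opt (upd ''u'' 0 (0 + Suc T) z)" using 4(1) saved_frame[of opt z] by simp
          ultimately show ?case by blast
        qed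
      qed
    next
      case (4 q)
      then show ?case using saved_frame[of opt q] covers_frame[of opt k 0 q] by simp
    qed
  qed auto
  then show ?thesis by simp
qed

lemma final_plan_correct:
  assumes env: "env s"
    and po: "plan so bo" and lo: "\<And>j \<tau>. \<tau> \<in> {1..T} \<Longrightarrow> load so bo j \<tau> \<le> kk j"
  defines "r \<equiv> run c_back (run c_dp (run c_flags (run c_guess s)))"
  shows "plan (r ''s'') (\<lambda>t. r ''b'' t \<noteq> 0) \<and>
    (\<forall>\<tau>\<in>{1..T}. \<forall>j\<in>reps. load (r ''s'') (\<lambda>t. r ''b'' t \<noteq> 0) j \<tau> \<le> 2 * ell * kk j) \<and>
    fcost (r ''s'') (\<lambda>t. r ''b'' t \<noteq> 0) \<le> 4 * fcost so bo"
proof (cases "T = 0")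
  \<comment> \<open>Without requests \<open>DD\<close> and the number of rounds are 0, and there is
    no average to round.\<close>
  case True
  then have "{1..T} = {}" by simp
  then show ?thesis unfolding plan_def fcost_def \<open>{1..T} = {}\<close> by simp
next
  case False
  define opt where "opt = fcost so bo"
  define s1 where "s1 = run c_guess s"
  define s2 where "s2 = run c_flags s1"
  have r: "r = run c_back (run c_dp s2)" by (simp add: r_def s1_def s2_def)
  have env1: "env s1" using env by (rule env_frame) (simp_all add: s1_def c_guess_def run_frame)
  have env2: "env s2" using env1 by (rule env_frame) (simp_all add: s2_def run_frame)
  have g: "saved opt s1" "covers opt k 0 s1"
    using run_guess[OF env po lo opt_def[symmetric]] by (auto simp: s1_def)
  define B where "B = s1 ''best'' 0"
  obtain j c where jc: "j < k" "c \<le> T" "opt \<le> 1 + wt j * c" "160 * opt + 20 * (1 + wt j * c) < 72 * (4 * opt + 1)"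
    using guess[OF po] unfolding opt_def[symmetric] by blast
  then have B: "B \<noteq> 0" "B \<le> 1 + wt j * c" using g(2) unfolding covers_def B_def by auto
  obtain Q y h where y: "counts s1 ''yb'' y" and h: "counts s1 ''hb'' h" and inv: "rinv B opt (900 * DD) Q y h"
    and chk: "\<And>t j. t \<in> {1..T} \<Longrightarrow> j \<in> reps \<Longrightarrow> 10 * Q t j \<le> 900 * DD * B"
    using g(1) B(1) unfolding saved_def B_def[symmetric] by blast
  define R where "R = 900 * DD"
  have R0: "0 < R" using DD_pos False by (simp add: R_def)
  have fl: "s2 ''okf'' (t * k + j) = of_bool (j \<in> reps \<and> 11 * R \<le> 20 * (ell * y t j))"
    "s2 ''okh'' (t * k + j) = of_bool (j \<in> reps \<and> 11 * R \<le> 20 * (ell * h t j))"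
    "s2 ''F'' (t * k + j) = wt j" "s2 ''H'' (t * k + j) = 0" if "t \<in> {1..T}" "j < k" for t j
    using run_flags[where s = s1, OF envD(1)[OF env1] envD(2)[OF env1], rule_format, OF that]
      y[unfolded counts_def, rule_format, OF that] h[unfolded counts_def, rule_format, OF that] that(2)
    unfolding s2_def[symmetric] DD_def[symmetric] R_def[symmetric] envD(5,6)[OF env1 that(2)]
    by (simp_all add: reps_def mult.commute[of _ 20])
  have hy: "h t j \<le> y t j" "0 < pv t \<Longrightarrow> h t j \<le> y (pv t) j" if "t \<in> {1..T}" "j \<in> reps" for t j
    using inv that unfolding rinv_def by blast+
  define ss where "ss = r ''s''"
  define b where "b t \<longleftrightarrow> r ''b'' t \<noteq> 0" for t
  have dp: "dyn_prog k T sg wt cl pv (\<lambda>t j. j < k \<and> s2 ''okf'' (t * k + j) \<noteq> 0) (\<lambda>t j. s2 ''okh'' (t * k + j) \<noteq> 0)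
    (\<lambda>t j. r ''hit'' (t * k + j) \<noteq> 0) (\<lambda>t j. s2 ''F'' (t * k + j)) (\<lambda>t j. s2 ''H'' (t * k + j))
    (\<lambda>t j. r ''D'' (t * k + j)) (r ''E'') (r ''ar'') ss b"
    unfolding r ss_def b_def
  proof (rule run_dp_back[OF env2])
    fix t assume t: "t \<in> {1..T}"
    \<comment> \<open>Some class has at least the average share \<open>R / ell\<close>, which is
      above the threshold \<open>11 * R / (20 * ell)\<close>.\<close>
    have "\<exists>j\<in>reps. 11 * R \<le> 20 * (ell * y t j)"
    proof (rule ccontr)
      assume "\<not> ?thesis"
      then have "20 * (ell * y t j) < 11 * R" if "j \<in> reps" for j using that by (meson not_le)
      then have "(\<Sum>j\<in>reps. 20 * (ell * y t j)) \<le> (\<Sum>j\<in>reps. 11 * R)" by (intro sum_mono less_imp_le)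
      then have "20 * ell * (\<Sum>j\<in>reps. y t j) \<le> ell * (11 * R)" by (simp add: sum_distrib_left ell_def mult.assoc)
      moreover have "(\<Sum>j\<in>reps. y t j) = R" using inv t by (simp add: rinv_def R_def)
      ultimately show False using ell_pos R0 by simp
    qed
    then show "\<exists>j<k. s2 ''okf'' (t * k + j) \<noteq> 0" using fl(1)[OF t] by (auto simp: reps_def)
  next
    fix t j assume t: "t \<in> {1..T}" and j: "j < k" and ok: "s2 ''okh'' (t * k + j) \<noteq> 0"
    have jr: "j \<in> reps" and hh: "11 * R \<le> 20 * (ell * h t j)" using ok fl(2)[OF t j] by (auto split: if_splits)
    have "11 * R \<le> 20 * (ell * y t j)" using hh hy(1)[OF t jr] by (meson le_trans mult_le_mono2)
    moreover have "11 * R \<le> 20 * (ell * y (pv t) j)" "pv t \<in> {1..T}" if "0 < pv t"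
    proof -
      show "11 * R \<le> 20 * (ell * y (pv t) j)"
        using hh hy(2)[OF t jr that] by (meson le_trans mult_le_mono2)
      show "pv t \<in> {1..T}" using pv_less[OF t] t that by auto
    qed
    ultimately show "s2 ''okf'' (t * k + j) \<noteq> 0 \<and> (0 < pv t \<longrightarrow> s2 ''okf'' (pv t * k + j) \<noteq> 0)"
      using fl(1)[OF _ j] t jr by auto
  qed
  interpret final_prog k T sg wt p0 cl pv "\<lambda>t j. j < k \<and> s2 ''okf'' (t * k + j) \<noteq> 0" "\<lambda>t j. s2 ''okh'' (t * k + j) \<noteq> 0"
    "\<lambda>t j. r ''hit'' (t * k + j) \<noteq> 0" "\<lambda>t j. s2 ''F'' (t * k + j)" "\<lambda>t j. s2 ''H'' (t * k + j)"
    "\<lambda>t j. r ''D'' (t * k + j)" "r ''E''" "r ''ar''" ss b B opt R Q y h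
    using dp
    by (intro final_prog.intro final_prog_axioms.intro)
      (use inv R0 B(1) False fl reps_less in \<open>auto simp: R_def[symmetric]\<close>)
  have "pcost (\<lambda>t j. s2 ''F'' (t * k + j)) (\<lambda>t j. s2 ''H'' (t * k + j)) ss b = fcost ss b"
    unfolding pcost_def fcost_def using fl(3,4) s_less by (intro sum.cong) auto
  then have "72 * fcost ss b \<le> 160 * opt + 20 * B" using final_cost by simp
  also have "160 * opt + 20 * B \<le> 160 * opt + 20 * (1 + wt j * c)"
    using B(2) by (intro add_left_mono mult_le_mono2)
  also note jc(4)
  finally have "fcost ss b \<le> 4 * opt" by simp
  moreover have "load ss b j \<tau> \<le> 2 * ell * kk j" if "\<tau> \<in> {1..T}" "j \<in> reps" for j \<tau>
    using final_load[OF that] chk[OF that] by (simp add: R_def)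
  ultimately show ?thesis using final_plan unfolding ss_def b_def opt_def by blast
qed

end

section \<open>Layout of the output\<close>

context kserver
begin

lemma ell_le: "ell \<le> k"
proof -
  have "card reps \<le> card {..<k}" by (intro card_mono) (auto simp: reps_def)
  then show ?thesis by (simp add: ell_def)
qed

definition NN :: nat where "NN = 2 * ell * k"

lemma NN: "NN \<le> 2 * k\<^sup>2" "k \<le> NN"
  using ell_le ell_pos by (simp_all add: NN_def power2_eq_square)

lemma run_prep:
  assumes env: "env s" and p0: "\<And>i. i < k \<Longrightarrow> s ''in'' (i * 3 + 5) = p0 i"
  defines "r \<equiv> run c_prep s"
  shows "r ''gn'' 0 = NN \<and> r ''out'' 0 = NN - k \<and> (\<forall>x<NN - k. r ''out'' (Suc x) = x mod k) \<and>
    (\<forall>g<NN. r ''pos'' g = p0 (g mod k) \<and> r ''gc'' g = cl (g mod k))"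
proof -
  define G where "G = 2 * k\<^sup>2"
  have G: "x < G" if "x < NN" for x using that NN(1) by (simp add: G_def)
  let ?R = "\<lambda>q. q ''gn'' 0 = NN \<and> q ''out'' 0 = NN - k \<and> (\<forall>x<NN - k. q ''out'' (Suc x) = x mod k) \<and>
    (\<forall>g<G. q ''pos'' g = p0 (g mod k) \<and> q ''gc'' g = cl (g mod k))"
  have "?R r"
    unfolding r_def c_prep_def
  proof (rule Sq_rule[where P = "\<lambda>q. q ''gn'' 0 = NN" and R = ?R], goal_cases)
    case 1
    show ?case using envD(1,7)[OF env] by (simp add: NN_def)
  next
    case (2 s1)
    have s1: "s1 ''gn'' 0 = NN" and f1: "s1 y = s y" if "y \<noteq> ''gn''" for y using 2 that by simp_all
    show ?case
    proof (rule Sq_rule[where P = "\<lambda>q. q ''out'' 0 = NN - k" and R = ?R], goal_cases)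
      case 1
      show ?case using envD(1)[OF env] 2(1) f1 by simp
    next
      case (2 s2)
      have s2: "s2 ''gn'' 0 = NN" "s2 ''in'' = s ''in''" "s2 ''cl'' = s ''cl''" "s2 ''out'' 0 = NN - k"
        using 2 \<open>s1 ''gn'' 0 = NN\<close> f1 by simp_all
      have kT: "s2 ''in'' (Suc 0) = k" using s2(2) envD(1)[OF env] by simp
      show ?case
      proof (rule Sq_rule[where P = "\<lambda>q. q ''out'' 0 = NN - k \<and> (\<forall>x<NN - k. q ''out'' (Suc x) = x mod k)" and R = ?R], goal_cases)
        case 1
        show ?case
        proof (rule For_rule[where P = "\<lambda>n q. q ''out'' 0 = NN - k \<and> (\<forall>x<NN - k. x < n \<longrightarrow> q ''out'' (Suc x) = x mod k)"
              and R = "\<lambda>q. q ''out'' 0 = NN - k \<and> (\<forall>x<NN - k. q ''out'' (Suc x) = x mod k)" and N = G], goal_cases)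
          case (3 x q)
          have e: "q ''gn'' 0 = NN" "q ''in'' (Suc 0) = k" using 3(4) s2 kT by simp_all
          show ?case using 3(3) by (auto simp: e less_Suc_eq)
        next
          case (4 q)
          then show ?case using G by simp
        qed (use kT s2 in \<open>auto simp: G_def\<close>)
      next
        case (2 s3)
        have s3: "s3 ''gn'' 0 = NN" "s3 ''in'' = s ''in''" "s3 ''cl'' = s ''cl''"
          using 2(2) s2 by simp_all
        have kT: "s3 ''in'' (Suc 0) = k" using s3(2) envD(1)[OF env] by simp
        let ?P = "\<lambda>g q. q ''pos'' g = p0 (g mod k) \<and> q ''gc'' g = cl (g mod k)"
        show ?case
        proof (rule For_rule[where P = "\<lambda>n q. \<forall>g<n. ?P g q" and R = ?R and N = G], goal_cases)
          case (3 g q)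
          have e: "q ''in'' (Suc 0) = k" "q ''in'' (g mod k * 3 + 5) = p0 (g mod k)" "q ''cl'' (g mod k) = cl (g mod k)"
            using 3(4) s3 kT p0[of "g mod k"] envD(6)[OF env, of "g mod k"] k_pos by simp_all
          show ?case using 3(3) by (auto simp: e less_Suc_eq)
        next
          case (4 q)
          have e: "q ''gn'' = s3 ''gn''" "q ''out'' = s3 ''out''" using 4(2) by simp_all
          show ?case using 4(1) \<open>s3 ''out'' 0 = NN - k \<and> (\<forall>x<NN - k. s3 ''out'' (Suc x) = x mod k)\<close> s3
            by (simp add: e)
        qed (use kT in \<open>auto simp: G_def\<close>)
      qed
    qed
  qed
  then show ?thesis using G by simp
qed

definition oix :: "nat \<Rightarrow> nat \<Rightarrow> nat" where "oix g t = NN - k + 1 + (g * (T + 1) + t)"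

lemma oix_eq: "t \<le> T \<Longrightarrow> t' \<le> T \<Longrightarrow> oix g t = oix g' t' \<longleftrightarrow> g = g' \<and> t = t'"
  unfolding oix_def using ix_eq[of t "T + 1" t' g g'] by simp

lemma run_emit:
  assumes s: "s ''in'' (Suc 0) = k" "s ''in'' 2 = T" "s ''gn'' 0 = NN" "s ''t'' 0 = t" and t: "t \<le> T"
  defines "r \<equiv> run c_emit s"
  shows "(\<forall>g<NN. \<forall>t'\<le>T. r ''out'' (oix g t') = (if t' = t then s ''pos'' g else s ''out'' (oix g t'))) \<and>
    (\<forall>x\<le>NN - k. r ''out'' x = s ''out'' x)"
proof -
  define P where "P n q \<longleftrightarrow> (\<forall>g<NN. \<forall>t'\<le>T. q ''out'' (oix g t') =
    (if t' = t \<and> g < n then s ''pos'' g else s ''out'' (oix g t'))) \<and> (\<forall>x\<le>NN - k. q ''out'' x = s ''out'' x)"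
    for n and q :: store
  have "P (2 * k\<^sup>2) r"
    unfolding r_def c_emit_def
  proof (rule For_rule[where P = P and R = "P (2 * k\<^sup>2)" and N = "2 * k\<^sup>2"], goal_cases)
    case (3 g q)
    have e: "q ''in'' (Suc 0) = k" "q ''in'' 2 = T" "q ''gn'' 0 = NN" "q ''t'' 0 = t" "q ''pos'' = s ''pos''"
      using 3(4) s by simp_all
    define q' where "q' = run (When (LtE (V ''g'') (V ''gn''))
      (Asg ''out'' (Add (Add (Sub (V ''gn'') K) (Num 1)) (Add (Mul (V ''g'') (Add Tm (Num 1))) (V ''t''))) (C1 ''pos'' ''g'')))
      (upd ''g'' 0 g q)"
    have q': "q' ''out'' = (if g < NN then (q ''out'')(oix g t := s ''pos'' g) else q ''out'')"
      unfolding q'_def by (simp add: e oix_def)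
    have "x \<noteq> oix g t" if "x \<le> NN - k" for x using that by (simp add: oix_def)
    then have "P (Suc g) q'" using 3(3) t unfolding P_def by (auto simp: q' oix_eq less_Suc_eq)
    then show ?case by (simp only: q'_def)
  next
    case (4 q)
    then show ?case by (simp add: P_def)
  qed (use s in \<open>auto simp: P_def\<close>)
  then show ?thesis using NN(1) unfolding P_def by (meson order_less_le_trans)
qed

end

section \<open>Assigning servers in the program\<close>

context serving
begin

text \<open>The windows that matter at \<open>t\<close> open before \<open>t\<close>, so
  \<open>good a t\<close> does not see the assignments after \<open>t\<close>.\<close>

lemma good_cong:
  assumes "t \<in> {1..T}" "\<And>t'. t' \<in> {1..t} \<Longrightarrow> a' t' = a t'" "good a t"
  shows "good a' t"
proof -
  have "hold a' t' = hold a t'" if "pv t' < t" for t'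
    using assms(2)[of "pv t'"] that by (auto simp: hold_def)
  moreover have "a' t = a t" using assms by auto
  ultimately show ?thesis using assms(3) pv_less[OF assms(1)] unfolding good_def by auto
qed

lemma pos_cong: "(\<And>t'. t' \<in> {1..t} \<Longrightarrow> a' t' = a t') \<Longrightarrow> pos a' g t = pos a g t"
  by (induction t) auto

definition senv :: "store \<Rightarrow> bool" where
  "senv q \<longleftrightarrow> env q \<and> q ''s'' = s \<and> (\<forall>t. q ''b'' t \<noteq> 0 \<longleftrightarrow> b t) \<and> q ''gn'' 0 = N \<and> (\<forall>g<N. q ''gc'' g = c g) \<and>
    (\<forall>t\<in>{1..T}. hini t = q ''ini'' (t * k + s t) - 1)"

lemma senv_frame:
  assumes "senv q" "q' ''in'' = q ''in''" "q' ''sg'' = q ''sg''" "q' ''pv'' = q ''pv''" "q' ''wt'' = q ''wt''"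
    "q' ''cl'' = q ''cl''" "q' ''ell'' = q ''ell''" "q' ''ini'' = q ''ini''"
    "q' ''s'' = q ''s''" "q' ''b'' = q ''b''" "q' ''gn'' = q ''gn''" "q' ''gc'' = q ''gc''"
  shows "senv q'"
  using assms(1) unfolding senv_def env_def assms(2-) .

lemma senvD:
  assumes "senv q"
  shows "q ''in'' (Suc 0) = k" "q ''in'' 2 = T" "t \<in> {1..T} \<Longrightarrow> q ''sg'' t = sg t" "t \<in> {1..T} \<Longrightarrow> q ''pv'' t = pv t"
    "q ''s'' = s" "q ''b'' t \<noteq> 0 \<longleftrightarrow> b t" "q ''gn'' 0 = N" "g < N \<Longrightarrow> q ''gc'' g = c g"
    "t \<in> {1..T} \<Longrightarrow> hini t = q ''ini'' (t * k + s t) - 1"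
proof -
  note e = assms[unfolded senv_def]
  note e' = e[THEN conjunct2] e[THEN conjunct2, THEN conjunct2]
    e[THEN conjunct2, THEN conjunct2, THEN conjunct2] e[THEN conjunct2, THEN conjunct2, THEN conjunct2, THEN conjunct2]
  note env = e[THEN conjunct1]
  note * = e'[THEN conjunct1] e'(4)[THEN conjunct2]
  show "q ''in'' (Suc 0) = k" "q ''in'' 2 = T" "t \<in> {1..T} \<Longrightarrow> q ''sg'' t = sg t" "t \<in> {1..T} \<Longrightarrow> q ''pv'' t = pv t"
    using envD(1-4)[OF env] by blast+
  show "q ''s'' = s" "q ''b'' t \<noteq> 0 \<longleftrightarrow> b t" "q ''gn'' 0 = N" "g < N \<Longrightarrow> q ''gc'' g = c g"
    "t \<in> {1..T} \<Longrightarrow> hini t = q ''ini'' (t * k + s t) - 1" using * by blast+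
qed

lemma run_hold:
  assumes q: "senv q" and t: "q x 0 = t" "t \<in> {1..T}" and x: "x \<noteq> z"
  shows "run (c_hold z x) q z 0 = hold (q ''asg'') t"
  using senvD(1,4,5,9)[OF q] t by (auto simp: c_hold_def hold_def)

lemma run_pick:
  assumes q: "senv q" and t: "q ''t'' 0 = t" "t \<in> {1..T}" and N: "N \<le> 2 * k\<^sup>2"
    and ex: "\<exists>g<N. c g = s t \<and> (\<forall>t'\<in>{1..T}. t < t' \<and> b t' \<and> pv t' < t \<longrightarrow> hold (q ''asg'') t' \<noteq> g)"
  shows "\<exists>g<N. c g = s t \<and> (\<forall>t'\<in>{1..T}. t < t' \<and> b t' \<and> pv t' < t \<longrightarrow> hold (q ''asg'') t' \<noteq> g) \<and>
    run c_pick q ''asg'' = (q ''asg'')(t := g)"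
proof -
  define suit where "suit g \<longleftrightarrow> g < N \<and> c g = s t \<and>
    (\<forall>t'\<in>{1..T}. t < t' \<and> b t' \<and> pv t' < t \<longrightarrow> hold (q ''asg'') t' \<noteq> g)" for g
  define P where "P n r \<longleftrightarrow> r ''asg'' = q ''asg'' \<and> (\<forall>g<n. \<not> suit g) \<or>
    (\<exists>g. suit g \<and> r ''asg'' = (q ''asg'')(t := g))" for n and r :: store
  have "P (2 * k\<^sup>2) (run c_pick q)"
    unfolding c_pick_def
  proof (rule For_rule[where P = P and R = "P (2 * k\<^sup>2)" and N = "2 * k\<^sup>2"], goal_cases)
    case 1
    show ?case using senvD(1)[OF q] by simp
  next
    case (3 g r)
    have er: "senv r" using q by (rule senv_frame) (use 3(4) in simp_all)
    have tr: "r ''t'' 0 = t" using 3(4) t by simp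
    have hr: "hold (r ''asg'') t' = hold (q ''asg'') t'" if "pv t' < t" for t'
      using 3(3) that unfolding P_def hold_def by auto
    let ?ok = "\<lambda>n. \<forall>t'\<in>{1..T}. t' < n \<longrightarrow> t < t' \<and> b t' \<and> pv t' < t \<longrightarrow> hold (q ''asg'') t' \<noteq> g"
    show ?case
    proof (rule Sq_rule[where P = "\<lambda>z. z ''ok'' 0 \<noteq> 0" and R = "P (Suc g)"], goal_cases)
      case (2 r1)
      have e1: "senv r1" using er by (rule senv_frame) (use 2(2) in simp_all)
      have t1: "r1 ''t'' 0 = t" "r1 ''g'' 0 = g" "r1 ''asg'' = r ''asg''" using 2(2) tr by simp_all
      show ?case
      proof (rule Sq_rule[where P = "\<lambda>z. z ''ok'' 0 \<noteq> 0 \<longleftrightarrow> ?ok (1 + T)" and R = "P (Suc g)"], goal_cases)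
        case 1
        show ?case
        proof (rule For_rule[where P = "\<lambda>n z. z ''ok'' 0 \<noteq> 0 \<longleftrightarrow> ?ok n"
              and R = "\<lambda>z. z ''ok'' 0 \<noteq> 0 \<longleftrightarrow> ?ok (1 + T)" and N = T], goal_cases)
          case 1
          show ?case using senvD(2)[OF e1] by simp
        next
          case 2
          show ?case using \<open>r1 ''ok'' 0 \<noteq> 0\<close> by auto
        next
          case (3 a z)
          have a: "a \<in> {1..T}" using 3 by simp
          define z1 where "z1 = upd ''a'' 0 a z"
          define z2 where "z2 = run (c_hold ''z'' ''a'') z1"
          have ez1: "senv z1" using e1 by (rule senv_frame) (use 3(4) in \<open>simp_all add: z1_def\<close>)
          have asg: "z1 ''asg'' = r ''asg''" using 3(4) t1 by (simp add: z1_def)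
          have "z2 ''z'' 0 = hold (z1 ''asg'') a"
            unfolding z2_def by (rule run_hold[OF ez1 _ a]) (simp_all add: z1_def)
          then have zz: "z2 ''z'' 0 = hold (r ''asg'') a" by (simp only: asg)
          have ez2: "senv z2" using ez1 by (rule senv_frame) (simp_all add: z2_def run_frame)
          have e: "z2 ''t'' 0 = t" "z2 ''a'' 0 = a" "z2 ''g'' 0 = g" "z2 ''ok'' 0 = z ''ok'' 0"
            using 3(4) t1 by (simp_all add: z2_def z1_def run_frame)
          have b2: "z2 ''b'' a \<noteq> 0 \<longleftrightarrow> b a" and p2: "z2 ''pv'' a = pv a" using senvD(4,6)[OF ez2] a by blast+
          have "run (c_hold ''z'' ''a'' ;;
            When (AndE (AndE (LtE (V ''t'') (V ''a'')) (C1 ''b'' ''a'')) (AndE (LtE (C1 ''pv'' ''a'') (V ''t'')) (EqE (V ''z'') (V ''g''))))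
              (Let0 ''ok'' (Num 0))) z1 ''ok'' 0 =
            (if t < a \<and> b a \<and> pv a < t \<and> hold (r ''asg'') a = g then 0 else z ''ok'' 0)"
            unfolding run.simps z2_def[symmetric] using b2 by (simp add: e p2 zz)
          then show ?case using 3(3) a hr unfolding z1_def[symmetric] by (auto simp: less_Suc_eq)
        qed auto
      next
        case (2 r2)
        have e2: "senv r2" using e1 by (rule senv_frame) (use 2(2) in simp_all)
        have t2: "r2 ''t'' 0 = t" "r2 ''g'' 0 = g" "r2 ''asg'' = r ''asg''" using 2(2) t1 by simp_all
        have ok: "r2 ''ok'' 0 \<noteq> 0 \<longleftrightarrow> (\<forall>t'\<in>{1..T}. t < t' \<and> b t' \<and> pv t' < t \<longrightarrow> hold (q ''asg'') t' \<noteq> g)"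
          using 2(1) by auto
        have "g < N \<Longrightarrow> r2 ''gc'' g = c g" "r2 ''gn'' 0 = N" "r2 ''s'' t = s t" using senvD(5,7,8)[OF e2] by simp_all
        then have cond: "r2 ''ok'' 0 \<noteq> 0 \<and> g < r2 ''gn'' 0 \<and> r2 ''gc'' g = r2 ''s'' t \<longleftrightarrow> suit g"
          using ok by (auto simp: suit_def)
        have "run (When (AndE (AndE (V ''ok'') (LtE (V ''g'') (V ''gn''))) (EqE (C1 ''gc'' ''g'') (C1 ''s'' ''t'')))
            (Asg ''asg'' (V ''t'') (V ''g''))) r2 ''asg'' = (if suit g then (r ''asg'')(t := g) else r ''asg'')"
          unfolding cond[symmetric] by (simp add: t2)
        then show ?case using 3(3) unfolding P_def by (auto simp: less_Suc_eq)
      qed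
    qed auto
  next
    case (4 r)
    then show ?case by (simp add: P_def)
  qed (auto simp: P_def)
  then show ?thesis
  proof (unfold P_def, elim disjE exE conjE)
    assume "\<forall>g<2 * k\<^sup>2. \<not> suit g"
    moreover obtain g where "suit g" "g < N" using ex unfolding suit_def by blast
    ultimately show ?thesis using N by auto
  next
    fix g assume "suit g" "run c_pick q ''asg'' = (q ''asg'')(t := g)"
    then show ?thesis unfolding suit_def by blast
  qed
qed

lemma run_serve:
  assumes q: "senv q" and N: "N = NN" and pos0: "\<And>g. g < N \<Longrightarrow> q ''pos'' g = p g"
    and out0: "\<And>g. g < N \<Longrightarrow> q ''out'' (oix g 0) = p g"
  defines "r \<equiv> run c_serve q"
  shows "\<exists>a. (\<forall>t\<in>{1..T}. good a t) \<and> (\<forall>g<N. \<forall>t\<le>T. r ''out'' (oix g t) = pos a g t) \<and>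
    (\<forall>x\<le>NN - k. r ''out'' x = q ''out'' x)"
proof -
  \<comment> \<open>Positions are those at time \<open>n - 1\<close>, before request
    \<open>n\<close> is served. Later changes of \<open>asg\<close> cannot spoil the invariant,
    because \<open>good\<close> and \<open>pos\<close> depend on the past only.\<close>
  define P where "P n z \<longleftrightarrow> (\<forall>t\<in>{1..<n}. good (z ''asg'') t) \<and> (\<forall>g<N. z ''pos'' g = pos (z ''asg'') g (n - 1)) \<and>
    (\<forall>g<N. \<forall>t<n. t \<le> T \<longrightarrow> z ''out'' (oix g t) = pos (z ''asg'') g t) \<and> (\<forall>x\<le>NN - k. z ''out'' x = q ''out'' x)"
    for n z
  have "P (1 + T) r"
    unfolding r_def c_serve_def
  proof (rule For_rule[where P = P and R = "P (1 + T)" and N = T], goal_cases)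
    case 1
    show ?case using senvD(2)[OF q] by simp
  next
    case 2
    show ?case using pos0 out0 by (auto simp: P_def)
  next
    case (3 t z0)
    define z where "z = upd ''t'' 0 t z0"
    have t: "t \<in> {1..T}" using 3 by simp
    have ez: "senv z" using q by (rule senv_frame) (use 3(4) in \<open>simp_all add: z_def c_emit_def\<close>)
    have tz: "z ''t'' 0 = t" by (simp add: z_def)
    have Pz: "P t z" using 3(3) by (simp add: P_def z_def)
    define a where "a = z ''asg''"
    have gd: "good a t'" if "t' \<in> {1..<t}" for t' using Pz that by (simp add: P_def a_def)
    define z1 where "z1 = run (Ite (C1 ''b'' ''t'') (c_hold ''z'' ''t'' ;; Asg ''asg'' (V ''t'') (V ''z'')) c_pick) z"
    have ez1: "senv z1" using ez by (rule senv_frame) (simp_all add: z1_def run_frame)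
    have f1: "z1 ''t'' 0 = t" "z1 ''pos'' = z ''pos''" "z1 ''out'' = z ''out''"
      using tz by (simp_all add: z1_def run_frame)
    have "\<exists>g. z1 ''asg'' = a(t := g) \<and> good (a(t := g)) t"
    proof (cases "b t")
      case True
      define z' where "z' = run (c_hold ''z'' ''t'') z"
      have "z' ''z'' 0 = hold a t" unfolding z'_def a_def by (rule run_hold[OF ez tz t]) simp
      moreover have "z' ''t'' 0 = t" "z' ''asg'' = a" using tz by (simp_all add: z'_def a_def run_frame)
      moreover have "z ''b'' t \<noteq> 0" using True senvD(6)[OF ez] by blast
      ultimately have asg: "z1 ''asg'' = a(t := hold a t)"
        using tz by (simp add: z1_def z'_def[symmetric])
      have "hold a t < N \<and> c (hold a t) = s t"
        using pv_less[OF t] by (intro hold_class[OF t True] gd) auto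
      moreover have "hold (a(t := hold a t)) t = hold a t" using pv_less[OF t] by (auto simp: hold_def)
      ultimately have "good (a(t := hold a t)) t" using True by (simp add: good_def)
      then show ?thesis using asg by blast
    next
      case False
      have "\<exists>g<N. c g = s t \<and> (\<forall>t'\<in>{1..T}. t < t' \<and> b t' \<and> pv t' < t \<longrightarrow> hold a t' \<noteq> g) \<and>
          run c_pick z ''asg'' = a(t := g)"
        unfolding a_def by (rule run_pick[OF ez tz t]) (use N NN(1) free_server[OF t False] gd in \<open>auto simp: a_def\<close>)
      then obtain g where g: "g < N" "c g = s t" "\<And>t'. t' \<in> {1..T} \<Longrightarrow> t < t' \<and> b t' \<and> pv t' < t \<Longrightarrow> hold a t' \<noteq> g"
        "run c_pick z ''asg'' = a(t := g)" by blast
      have "z ''b'' t = 0" using False senvD(6)[OF ez] by blast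
      then have asg: "z1 ''asg'' = a(t := g)" using g(4) tz by (simp add: z1_def)
      have "hold (a(t := g)) t' = hold a t'" if "pv t' < t" for t' using that by (auto simp: hold_def)
      then have "good (a(t := g)) t" using g(1-3) False by (auto simp: good_def)
      then show ?thesis using asg by blast
    qed
    then obtain g0 where asg: "z1 ''asg'' = a(t := g0)" and gt: "good (a(t := g0)) t" by blast
    define a' where "a' = a(t := g0)"
    have old: "\<And>t'. t' \<in> {1..t'' } \<Longrightarrow> t'' < t \<Longrightarrow> a' t' = a t'" for t'' by (auto simp: a'_def)
    have good': "good a' t'" if "t' \<in> {1..<Suc t}" for t'
    proof (cases "t' = t")
      case True then show ?thesis using gt by (simp add: a'_def)
    next
      case False
      then show ?thesis using good_cong[of t' a' a] gd[of t'] old[of _ t'] that t by auto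
    qed
    have pos_old: "pos a' g t' = pos a g t'" if "t' < t" for g t' using that by (intro pos_cong old) auto
    have pos_t: "pos a' g t = (if g0 = g then sg t else pos a g (t - 1))" for g
    proof -
      obtain u where u: "t = Suc u" using t by (cases t) auto
      have "pos a' g (Suc u) = (if a' (Suc u) = g then sg (Suc u) else pos a' g u)" by simp
      moreover have "pos a' g u = pos a g u" "a' t = g0" using pos_old[of u g] u by (simp_all add: a'_def)
      ultimately show ?thesis using u by simp
    qed
    define z2 where "z2 = run (Asg ''pos'' (C1 ''asg'' ''t'') (C1 ''sg'' ''t'')) z1"
    have z2: "z2 ''pos'' = (z ''pos'')(g0 := sg t)" "z2 ''t'' 0 = t" "z2 ''out'' = z ''out''" "z2 ''asg'' = a'"
      using f1 asg senvD(3)[OF ez1 t] by (simp_all add: z2_def a'_def)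
    have ez2: "senv z2" using ez1 by (rule senv_frame) (simp_all add: z2_def)
    have pos2: "z2 ''pos'' g = pos a' g t" if "g < N" for g
      using Pz that by (auto simp: z2 pos_t P_def a_def)
    define z3 where "z3 = run c_emit z2"
    have em: "\<forall>g<NN. \<forall>t'\<le>T. z3 ''out'' (oix g t') = (if t' = t then z2 ''pos'' g else z2 ''out'' (oix g t'))"
      "\<forall>x\<le>NN - k. z3 ''out'' x = z2 ''out'' x"
      using run_emit[where s = z2 and t = t, OF senvD(1)[OF ez2] senvD(2)[OF ez2] _ z2(2)] senvD(7)[OF ez2] N t
      unfolding z3_def by auto
    have "z3 ''asg'' = z2 ''asg''" and z3p: "z3 ''pos'' = z2 ''pos''" by (simp_all add: z3_def run_frame)
    then have z3: "z3 ''asg'' = a'" "z3 ''pos'' = z2 ''pos''" using z2(4) by simp_all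
    have "P (Suc t) z3"
      unfolding P_def z3
    proof (intro conjI allI impI ballI)
      show "good a' t'" if "t' \<in> {1..<Suc t}" for t' using good'[OF that] .
      show "z2 ''pos'' g = pos a' g (Suc t - 1)" if "g < N" for g using pos2[OF that] by simp
      show "z3 ''out'' (oix g t') = pos a' g t'" if g: "g < N" and t': "t' < Suc t" "t' \<le> T" for g t'
      proof (cases "t' = t")
        case True then show ?thesis using em(1) g t' N pos2[OF g] by simp
      next
        case False
        then have "t' < t" using t' by simp
        moreover have "z3 ''out'' (oix g t') = z ''out'' (oix g t')" using em(1) g t' N False by (simp add: z2)
        ultimately show ?thesis using Pz g t' pos_old[of t' g] by (simp add: P_def a_def)
      qed
      show "z3 ''out'' x = q ''out'' x" if "x \<le> NN - k" for x using em(2) that Pz by (simp add: z2 P_def)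
    qed
    then show ?case unfolding z_def[symmetric] z3_def z2_def z1_def by (simp only: run.simps(3))
  next
    case (4 z)
    then show ?case by (simp add: P_def)
  qed
  then show ?thesis unfolding P_def by (intro exI[of _ "r ''asg''"]) auto
qed

end

section \<open>Instances: encoding, integral weights and copies of servers\<close>

lemma concat_block_nth:
  assumes "\<And>x. x \<in> set xs \<Longrightarrow> length (f x) = c" "i < length xs" "j < c"
  shows "concat (map f xs) ! (i * c + j) = f (xs ! i) ! j"
  using assms
proof (induction xs arbitrary: i)
  case (Cons x xs)
  have l: "length (f x) = c" using Cons by simp
  show ?case
  proof (cases i)
    case 0
    then show ?thesis using l Cons.prems by (simp add: nth_append)
  next
    case (Suc i')
    then have "concat (map f (x # xs)) ! (i * c + j) = concat (map f xs) ! (i' * c + j)"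
      using l by (simp add: nth_append)
    then show ?thesis using Cons Suc by simp
  qed
qed simp

lemma length_concat_block:
  "(\<And>x. x \<in> set xs \<Longrightarrow> length (f x) = c) \<Longrightarrow> length (concat (map f xs)) = length xs * c"
  by (induction xs) auto

lemma card_mod:
  fixes k :: nat
  assumes "0 < k"
  shows "card {g. g < m * k \<and> P (g mod k)} = m * card {i. i < k \<and> P i}"
proof (induction m)
  case (Suc m)
  have "{g. g < Suc m * k \<and> P (g mod k)} = {g. g < m * k \<and> P (g mod k)} \<union> (\<lambda>i. m * k + i) ` {i. i < k \<and> P i}"
  proof (intro set_eqI iffI)
    fix g assume g: "g \<in> {g. g < Suc m * k \<and> P (g mod k)}"
    show "g \<in> {g. g < m * k \<and> P (g mod k)} \<union> (\<lambda>i. m * k + i) ` {i. i < k \<and> P i}"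
    proof (cases "g < m * k")
      case False
      then have "g = m * k + (g - m * k)" "g - m * k < k" using g by auto
      moreover from this have "g mod k = g - m * k" by (metis mod_less mod_mult_self3)
      ultimately show ?thesis using g by auto
    qed (use g in auto)
  qed auto
  then have "card {g. g < Suc m * k \<and> P (g mod k)} =
      card ({g. g < m * k \<and> P (g mod k)} \<union> (\<lambda>i. m * k + i) ` {i. i < k \<and> P i})" by simp
  also have "\<dots> = card {g. g < m * k \<and> P (g mod k)} + card ((\<lambda>i. m * k + i) ` {i. i < k \<and> P i})"
    by (rule card_Un_disjoint) auto
  also have "card ((\<lambda>i. m * k + i) ` {i. i < k \<and> P i}) = card {i. i < k \<and> P i}"
    by (rule card_image) (auto simp: inj_on_def)
  finally show ?case using Suc by simp
qed simp

locale instance_facts =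
  fixes I :: wks_instance
  assumes valid: "valid_instance I"
begin

abbreviation "kI \<equiv> num_servers I"
abbreviation "TI \<equiv> horizon I"
definition "wI i = fst (servers I ! i)"
definition "pI i = snd (servers I ! i)"
definition "numI i = nat (fst (quotient_of (wI i)))"
definition "denI i = nat (snd (quotient_of (wI i)))"
definition "PI = (\<Prod>a<kI. denI a)"
text \<open>Scaling by the product of all denominators makes the weights integral and preserves
  ratios of costs. The division is exact and comes first, so that the remaining product has an input
  cell as its right factor.\<close>

definition "wtI i = PI div denI i * numI i"
definition "sgI t = requests I ! (t - 1)"
definition "pvI t = prevf sgI (sgI t) t"

lemma kI_pos: "0 < kI"
  using valid by (simp add: valid_instance_def num_servers_def)

lemma server: "i < kI \<Longrightarrow> 0 \<le> wI i \<and> pI i \<in> points I"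
  using valid nth_mem[of i "servers I"]
  by (cases "servers I ! i") (auto simp: valid_instance_def num_servers_def wI_def pI_def)

lemma sgI_points: "t \<in> {1..TI} \<Longrightarrow> sgI t \<in> points I"
  using valid nth_mem[of "t - 1" "requests I"] by (auto simp: valid_instance_def horizon_def sgI_def)

lemma denI_pos: "0 < denI i"
  using quotient_of_denom_pos'[of "wI i"] by (simp add: denI_def)

lemma PI_pos: "0 < PI"
  using denI_pos by (simp add: PI_def prod_pos)

lemma wtI: "i < kI \<Longrightarrow> real (wtI i) = real PI * of_rat (wI i)"
proof -
  assume i: "i < kI"
  obtain a b where q: "quotient_of (wI i) = (a, b)" by fastforce
  have b: "0 < b" using quotient_of_denom_pos[OF q] .
  have w: "wI i = of_int a / of_int b" using quotient_of_div[OF q] .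
  have a: "0 \<le> a" using server[OF i] b unfolding w by (simp add: zero_le_divide_iff)
  have "of_rat (wI i) = (of_int a / of_int b :: real)" unfolding w by (simp add: of_rat_divide)
  moreover have "real (numI i) = of_int a" "real (denI i) = of_int b"
    using a b by (simp_all add: numI_def denI_def q)
  moreover have "denI i dvd PI" unfolding PI_def using i by (intro dvd_prodI) auto
  then have "real (PI div denI i) = real PI / real (denI i)" by (rule real_of_nat_div)
  ultimately show ?thesis by (simp add: wtI_def)
qed

lemma wtI_eq: "i < kI \<Longrightarrow> j < kI \<Longrightarrow> wtI i = wtI j \<longleftrightarrow> wI i = wI j"
  using wtI[of i] wtI[of j] PI_pos by (metis mult_cancel_left of_nat_0_less_iff of_nat_eq_iff of_rat_eq_iff less_irrefl)

lemma clf: "i < n \<Longrightarrow> clf wt i < n \<and> wt (clf wt i) = wt i" for n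
proof -
  assume "i < n"
  have "clf wt i \<le> i" unfolding clf_def by (rule Least_le) simp
  moreover have "wt (clf wt i) = wt i" unfolding clf_def by (rule LeastI[of "\<lambda>a. wt a = wt i" i]) simp
  ultimately show ?thesis using \<open>i < n\<close> by simp
qed

sublocale kserver kI TI sgI wtI pI "clf wtI" pvI
proof
  show "0 < kI" by (rule kI_pos)
  show "clf wtI i < kI" "wtI (clf wtI i) = wtI i" if "i < kI" for i using clf[OF that] by auto
  show "clf wtI i = clf wtI i'" if "wtI i = wtI i'" for i i' using that by (simp add: clf_def)
  show "pvI t < t" if "t \<in> {1..TI}" for t using that by (simp add: pvI_def prevf(1))
  show "sgI (pvI t) = sgI t" if "0 < pvI t" for t using that prevf(2) by (simp add: pvI_def)
  show "sgI \<tau> \<noteq> sgI t" if "pvI t < \<tau>" "\<tau> < t" for t \<tau> using that prevf(3) by (simp add: pvI_def)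
qed

lemma ell_weights: "ell = card (weights I)"
proof -
  have "bij_betw wI reps (weights I)"
    unfolding bij_betw_def
  proof
    show "inj_on wI reps"
    proof (rule inj_onI)
      fix i j assume ij: "i \<in> reps" "j \<in> reps" "wI i = wI j"
      have k: "i < kI" "j < kI" and c: "clf wtI i = i" "clf wtI j = j" using ij(1,2) by (auto simp: reps_def)
      have "wtI i = wtI j" using wtI_eq[OF k] ij(3) by blast
      then have "clf wtI i = clf wtI j" by (rule cl_cong[OF k])
      then show "i = j" unfolding c .
    qed
    have "weights I = wI ` {..<kI}"
      unfolding weights_def wI_def num_servers_def
      by (force simp: set_conv_nth)
    also have "\<dots> = wI ` reps"
    proof
      show "wI ` {..<kI} \<subseteq> wI ` reps"
      proof
        fix x assume "x \<in> wI ` {..<kI}"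
        then obtain i where i: "i < kI" "x = wI i" by auto
        then have "x = wI (clf wtI i)" using wtI_eq[of "clf wtI i" i] clf[of i kI wtI] by auto
        then show "x \<in> wI ` reps" using cl_reps[OF i(1)] by blast
      qed
    qed (auto simp: reps_def)
    finally show "wI ` reps = weights I" ..
  qed
  then show ?thesis unfolding ell_def by (rule bij_betw_same_card)
qed

lemma start_server:
  assumes "i < kI"
  shows "start I ''in'' (i * 3 + 3) = numI i" "start I ''in'' (i * 3 + 4) = denI i" "start I ''in'' (i * 3 + 5) = pI i"
proof -
  let ?c = "concat (map encode_server (servers I))"
  have l: "length (encode_server x) = 3" for x by (cases x) (simp add: encode_server_def)
  have lc: "length ?c = kI * 3" using length_concat_block[of "servers I" encode_server 3] l by (simp add: num_servers_def)
  have "start I ''in'' (i * 3 + (3 + j)) = encode_server (servers I ! i) ! j" if "j < 3" for j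
  proof -
    have "i * 3 + j < length ?c" using assms that lc by linarith
    then have "encode_instance I ! (i * 3 + (3 + j)) = ?c ! (i * 3 + j)" "i * 3 + (3 + j) < length (encode_instance I)"
      using assms that by (simp_all add: encode_instance_def nth_append)
    then show ?thesis using concat_block_nth[of "servers I" encode_server 3 i j] l assms that
      by (simp add: input_store_def num_servers_def)
  qed
  from this[of 0] this[of 1] this[of 2]
  show "start I ''in'' (i * 3 + 3) = numI i" "start I ''in'' (i * 3 + 4) = denI i" "start I ''in'' (i * 3 + 5) = pI i"
    by (simp_all add: encode_server_def numI_def denI_def wI_def pI_def case_prod_beta)
qed

lemma start_request:
  assumes "t \<in> {1..TI}"
  shows "start I ''in'' (kI * 3 + 2 + t) = sgI t"
proof -
  have "length (concat (map encode_server (servers I))) = kI * 3"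
    using length_concat_block[of "servers I" encode_server 3]
    by (simp add: num_servers_def encode_server_def case_prod_beta)
  moreover obtain u where "t = Suc u" "u < TI" using assms by (cases t) auto
  ultimately show ?thesis
    by (simp add: input_store_def length_encode encode_instance_def nth_append sgI_def num_servers_def horizon_def)
qed

definition s_init :: store where
  "s_init = run c_ini (run c_pv (run c_cl (run c_wt (start I))))"

lemma in_init: "s_init ''in'' = start I ''in''"
  by (simp add: s_init_def run_frame)

lemma env_init: "env s_init"
proof -
  define s1 where "s1 = run c_wt (start I)"
  define s2 where "s2 = run c_cl s1"
  define s3 where "s3 = run c_pv s2"
  have si: "s_init = run c_ini s3" by (simp add: s_init_def s1_def s2_def s3_def)
  have i: "s1 ''in'' = start I ''in''" "s2 ''in'' = start I ''in''" "s3 ''in'' = start I ''in''"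
    by (simp_all add: s1_def s2_def s3_def run_frame)
  have wt: "s1 ''wt'' j = wtI j" if "j < kI" for j
    using run_wt[where s = "start I" and k = kI and den = denI and num = numI and i = j] start_server that
    unfolding s1_def wtI_def PI_def by simp
  have cl: "(\<forall>j<kI. s2 ''cl'' j = clf wtI j) \<and> s2 ''ell'' 0 = card {j. j < kI \<and> clf wtI j = j}"
    unfolding s2_def by (rule run_cl) (use wt i in simp_all)
  have pv: "\<forall>t\<in>{1..TI}. s3 ''sg'' t = sgI t \<and> s3 ''pv'' t = prevf sgI (sgI t) t"
    unfolding s3_def by (rule run_pv[where k = kI]) (use start_request i in simp_all)
  have ini: "(\<exists>i<kI. clf wtI i = j \<and> pI i = sgI t \<and> s_init ''ini'' (t * kI + j) = Suc i) \<or>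
    s_init ''ini'' (t * kI + j) = 0 \<and> (\<forall>i<kI. clf wtI i = j \<longrightarrow> pI i \<noteq> sgI t)" if "t \<in> {1..TI}" "j < kI" for t j
    unfolding si
  proof (rule run_ini[OF _ _ _ _ _ _ that])
    show "s3 ''cl'' i = clf wtI i" if "i < kI" for i using cl that by (simp add: s3_def run_frame)
    show "s3 ''in'' (i * 3 + 5) = pI i" if "i < kI" for i using start_server(3)[OF that] by (simp add: i)
  qed (use i pv cl_less in simp_all)
  have e: "s_init ''sg'' = s3 ''sg''" "s_init ''pv'' = s3 ''pv''" "s_init ''wt'' = s1 ''wt''"
    "s_init ''cl'' = s2 ''cl''" "s_init ''ell'' = s2 ''ell''"
    by (simp_all add: si s3_def s2_def run_frame)
  show ?thesis
    unfolding env_def e in_init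
  proof (intro conjI ballI allI impI)
    show "s2 ''ell'' 0 = ell" using cl by (simp add: ell_def reps_def)
    show "(\<exists>i<kI. clf wtI i = j \<and> pI i = sgI t \<and> s_init ''ini'' (t * kI + j) = Suc i) \<or>
      s_init ''ini'' (t * kI + j) = 0 \<and> \<not> ini t j" if "t \<in> {1..TI}" "j < kI" for t j
      using ini[OF that] unfolding ini_def by blast
  qed (use wt cl pv in \<open>simp_all add: pvI_def\<close>)
qed

definition csI :: "nat list" where "csI = map (\<lambda>x. x mod kI) [0..<NN - kI]"

lemma augmented: "num_servers (augment I csI) = NN" "g < NN \<Longrightarrow> servers (augment I csI) ! g = servers I ! (g mod kI)"
  "horizon (augment I csI) = TI" "points (augment I csI) = points I" "requests (augment I csI) = requests I"
proof -
  have N: "kI \<le> NN" by (rule NN(2))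
  show "num_servers (augment I csI) = NN" using N by (simp add: num_servers_def augment_def csI_def)
  show "servers (augment I csI) ! g = servers I ! (g mod kI)" if "g < NN"
  proof (cases "g < kI")
    case True then show ?thesis by (simp add: augment_def nth_append num_servers_def)
  next
    case False
    then have "g - kI < NN - kI" using that by simp
    moreover have "(g - kI) mod kI = g mod kI" using False by (simp add: le_mod_geq)
    ultimately show ?thesis using False by (simp add: augment_def nth_append num_servers_def[symmetric] csI_def)
  qed
qed (simp_all add: augment_def horizon_def points_def)

lemma servers_augmented:
  "servers_of_weight (augment I csI) W = 2 * ell * servers_of_weight I W"
proof -
  have "servers_of_weight (augment I csI) W = card {g. g < 2 * ell * kI \<and> wI (g mod kI) = W}"
    unfolding servers_of_weight_def augmented(1) wI_def
    by (rule arg_cong[where f = card]) (auto simp: augmented(2) NN_def)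
  also have "\<dots> = 2 * ell * card {i. i < kI \<and> wI i = W}" by (rule card_mod[OF kI_pos])
  finally show ?thesis by (simp add: servers_of_weight_def wI_def)
qed

lemma sum_moves: "(\<Sum>t=1..T. of_bool (f t \<noteq> f (t - 1)) :: real) = real (card {t \<in> {1..T}. f t \<noteq> f (t - 1)})"
  for f :: "nat \<Rightarrow> nat" and T :: nat
  by (subst sum_of_bool_eq) (auto intro!: arg_cong[where f = card])

text \<open>Costs of plans are \<open>2 * PI\<close> times as large as \<open>cost\<close>: the
  weights are scaled by \<open>PI\<close>, and \<open>cost\<close> carries the factor 1/2. This
  factor appears for the optimal and for the computed solution and cancels.\<close>

lemma main_correct:
  "\<exists>f. (\<forall>i<length (encode_solution I csI f). run c_main (start I) ''out'' i = encode_solution I csI f ! i) \<and>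
    is_solution (augment I csI) f \<and> cost (augment I csI) f \<le> 4 * opt_cost I"
proof -
  obtain fo where fo: "is_solution I fo" "cost I fo = opt_cost I"
    using opt_cost_attained(1)[OF valid] by blast
  have "\<exists>so bo. plan so bo \<and> (\<forall>j \<tau>. \<tau> \<in> {1..TI} \<longrightarrow> load so bo j \<tau> \<le> kk j) \<and>
    fcost so bo \<le> (\<Sum>i<kI. wtI i * card {t \<in> {1..TI}. fo i t \<noteq> fo i (t - 1)})"
    by (rule plan_of_solution) (use fo(1) in \<open>auto simp: is_solution_def pI_def sgI_def\<close>)
  then obtain so bo where so: "plan so bo" "\<And>j \<tau>. \<tau> \<in> {1..TI} \<Longrightarrow> load so bo j \<tau> \<le> kk j"
    "fcost so bo \<le> (\<Sum>i<kI. wtI i * card {t \<in> {1..TI}. fo i t \<noteq> fo i (t - 1)})" by blast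
  have "real (\<Sum>i<kI. wtI i * card {t \<in> {1..TI}. fo i t \<noteq> fo i (t - 1)}) =
      (\<Sum>i<kI. real PI * of_rat (wI i) * real (card {t \<in> {1..TI}. fo i t \<noteq> fo i (t - 1)}))"
    unfolding of_nat_sum of_nat_mult by (intro sum.cong refl) (simp add: wtI)
  also have "\<dots> = 2 * real PI * cost I fo"
    unfolding cost_def sum_moves by (simp add: sum_distrib_left wI_def mult.assoc)
  finally have sum_eq: "real (\<Sum>i<kI. wtI i * card {t \<in> {1..TI}. fo i t \<noteq> fo i (t - 1)}) = 2 * real PI * opt_cost I"
    unfolding fo(2) .
  have fso: "real (fcost so bo) \<le> 2 * real PI * opt_cost I"
    using of_nat_mono[OF so(3), where 'a = real] unfolding sum_eq .
  define r where "r = run c_back (run c_dp (run c_flags (run c_guess s_init)))"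
  define ss where "ss = r ''s''"
  define b where "b t \<longleftrightarrow> r ''b'' t \<noteq> 0" for t
  have fp: "plan ss b" "\<And>\<tau> j. \<tau> \<in> {1..TI} \<Longrightarrow> j \<in> reps \<Longrightarrow> load ss b j \<tau> \<le> 2 * ell * kk j"
    "fcost ss b \<le> 4 * fcost so bo"
    using final_plan_correct[OF env_init so(1,2)] unfolding r_def[symmetric] ss_def b_def by blast+
  have envr: "env r" using env_init by (rule env_frame) (simp_all add: r_def run_frame c_guess_def)
  have inr: "r ''in'' = start I ''in''" using in_init by (simp add: r_def run_frame c_guess_def)
  define hini where "hini t = r ''ini'' (t * kI + ss t) - 1" for t
  define c where "c g = clf wtI (g mod kI)" for g
  define p where "p g = pI (g mod kI)" for g
  interpret sv: serving kI TI sgI wtI pI "clf wtI" pvI ss b NN c p hini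
  proof
    show "plan ss b" by (rule fp(1))
    show "load ss b j \<tau> \<le> card {g. g < NN \<and> c g = j}" if "\<tau> \<in> {1..TI}" "j \<in> reps" for \<tau> j
      using fp(2)[OF that] card_mod[OF kI_pos, of "2 * ell" "\<lambda>i. clf wtI i = j"]
      by (simp add: NN_def c_def kk_def)
    fix t assume t: "t \<in> {1..TI}" "b t" "pvI t = 0"
    have j: "ss t < kI" using fp(1) t(1) by (auto simp: plan_def reps_def)
    have "ini t (ss t)" using fp(1) t by (auto simp: plan_def)
    then obtain i where i: "i < kI" "clf wtI i = ss t" "pI i = sgI t" "r ''ini'' (t * kI + ss t) = Suc i"
      using env_ini[OF envr t(1) j] by blast
    then show "hini t < NN \<and> c (hini t) = ss t \<and> p (hini t) = sgI t"
      using NN(2) by (simp add: hini_def c_def p_def)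
  qed
  define s5 where "s5 = run c_prep r"
  define s6 where "s6 = upd ''t'' 0 0 s5"
  define s7 where "s7 = run c_emit s6"
  define s8 where "s8 = run c_serve s7"
  have main: "run c_main (start I) = s8"
    by (simp add: c_main_def s8_def s7_def s6_def s5_def r_def s_init_def)
  have prep: "s5 ''gn'' 0 = NN" "s5 ''out'' 0 = NN - kI" "\<And>x. x < NN - kI \<Longrightarrow> s5 ''out'' (Suc x) = x mod kI"
    "\<And>g. g < NN \<Longrightarrow> s5 ''pos'' g = p g \<and> s5 ''gc'' g = c g"
    using run_prep[OF envr] start_server(3) unfolding s5_def[symmetric] p_def c_def inr by blast+
  have env6: "env s6" using envr by (rule env_frame) (simp_all add: s6_def s5_def run_frame)
  have "s6 ''gn'' 0 = NN" "s6 ''t'' 0 = 0" using prep(1) by (simp_all add: s6_def)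
  then have em: "(\<forall>g<NN. \<forall>t'\<le>TI. s7 ''out'' (oix g t') = (if t' = 0 then s6 ''pos'' g else s6 ''out'' (oix g t'))) \<and>
    (\<forall>x\<le>NN - kI. s7 ''out'' x = s6 ''out'' x)"
    unfolding s7_def using envD(1,2)[OF env6] by (intro run_emit) auto
  have env7: "env s7" using env6 by (rule env_frame) (simp_all add: s7_def run_frame)
  have e7: "s7 ''s'' = ss" "s7 ''b'' = r ''b''" "s7 ''gn'' 0 = NN" "s7 ''gc'' = s5 ''gc''" "s7 ''ini'' = r ''ini''"
    "s7 ''pos'' = s5 ''pos''"
    using prep(1) by (simp_all add: s7_def s6_def s5_def run_frame ss_def)
  have senv: "sv.senv s7"
    unfolding sv.senv_def using env7 e7 prep(4) by (simp add: b_def hini_def)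
  have "\<exists>a. (\<forall>t\<in>{1..TI}. sv.good a t) \<and> (\<forall>g<NN. \<forall>t\<le>TI. s8 ''out'' (oix g t) = sv.pos a g t) \<and>
    (\<forall>x\<le>NN - kI. s8 ''out'' x = s7 ''out'' x)"
    unfolding s8_def by (rule sv.run_serve[OF senv refl]) (use em prep(4) e7 in \<open>simp_all add: s6_def\<close>)
  then obtain a where a: "\<And>t. t \<in> {1..TI} \<Longrightarrow> sv.good a t"
    "\<And>g t. g < NN \<Longrightarrow> t \<le> TI \<Longrightarrow> s8 ''out'' (oix g t) = sv.pos a g t"
    "\<And>x. x \<le> NN - kI \<Longrightarrow> s8 ''out'' x = s7 ''out'' x" by blast
  define f where "f = sv.pos a"
  have pos_points: "sv.pos a g t \<in> points I" if "t \<le> TI" for g t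
    using that
  proof (induction t)
    case 0
    show ?case unfolding sv.pos.simps(1) unfolding p_def using server[of "g mod kI"] kI_pos by simp
  next
    case (Suc t)
    then show ?case using sgI_points[of "Suc t"] by simp
  qed
  have "is_solution (augment I csI) f"
    unfolding is_solution_def augmented(1,3,4,5)
  proof (intro conjI allI impI ballI)
    show "f g 0 = snd (servers (augment I csI) ! g)" if "g < NN" for g
      using that by (simp add: f_def p_def augmented(2) pI_def)
    show "f g t \<in> points I" if "t \<le> TI" for g t using pos_points[OF that] by (simp add: f_def)
    show "\<exists>g<NN. f g t = requests I ! (t - 1)" if "t \<in> {1..TI}" for t
      unfolding sgI_def[symmetric]
    proof (intro exI conjI)
      show "a t < NN" using a(1)[OF that] by (simp add: sv.good_def)
      show "f (a t) t = sgI t" unfolding f_def by (rule sv.pos_serves[OF a(1) that])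
    qed
  qed
  moreover have "cost (augment I csI) f \<le> 4 * opt_cost I"
  proof -
    have "(\<Sum>g<NN. wtI (g mod kI) * card {t \<in> {1..TI}. sv.pos a g t \<noteq> sv.pos a g (t - 1)}) \<le> fcost ss b"
    proof (rule sv.pos_cost[OF a(1)])
      show "wtI (a t mod kI) = wtI (ss t)" if "t \<in> {1..TI}" for t
        using a(1)[OF that] wt_cl[of "a t mod kI"] kI_pos by (auto simp: sv.good_def c_def)
    qed
    also have "\<dots> \<le> 4 * fcost so bo" by (rule fp(3))
    finally have "real (\<Sum>g<NN. wtI (g mod kI) * card {t \<in> {1..TI}. f g t \<noteq> f g (t - 1)}) \<le> real (4 * fcost so bo)"
      unfolding f_def by (rule of_nat_mono)
    also have "\<dots> \<le> 4 * (2 * real PI * opt_cost I)"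
      unfolding of_nat_mult of_nat_numeral using fso by linarith
    finally have le: "real (\<Sum>g<NN. wtI (g mod kI) * card {t \<in> {1..TI}. f g t \<noteq> f g (t - 1)}) \<le> 4 * (2 * real PI * opt_cost I)" .
    have "real (\<Sum>g<NN. wtI (g mod kI) * card {t \<in> {1..TI}. f g t \<noteq> f g (t - 1)}) =
        (\<Sum>g<NN. real PI * of_rat (wI (g mod kI)) * real (card {t \<in> {1..TI}. f g t \<noteq> f g (t - 1)}))"
      unfolding of_nat_sum of_nat_mult using kI_pos by (intro sum.cong refl) (simp add: wtI)
    also have "\<dots> = 2 * real PI * cost (augment I csI) f"
      unfolding cost_def sum_moves augmented(1,3)
      by (simp add: sum_distrib_left wI_def mult.assoc augmented(2))
    finally have "2 * real PI * cost (augment I csI) f \<le> 2 * real PI * (4 * opt_cost I)" using le by simp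
    then show ?thesis using PI_pos by simp
  qed
  moreover have "s8 ''out'' i = encode_solution I csI f ! i" if i: "i < length (encode_solution I csI f)" for i
  proof -
    let ?bl = "concat (map (\<lambda>g. map (f g) [0..<TI + 1]) [0..<NN])"
    have es: "encode_solution I csI f = [NN - kI] @ csI @ ?bl"
      unfolding encode_solution_def augmented(1) by (simp add: csI_def)
    have lcs: "length csI = NN - kI" by (simp add: csI_def)
    have lb: "length ?bl = NN * (TI + 1)"
      using length_concat_block[of "[0..<NN]" "\<lambda>g. map (f g) [0..<TI + 1]" "TI + 1"] by simp
    consider "i = 0" | x where "i = Suc x" "x < NN - kI" | y where "i = NN - kI + 1 + y" "y < NN * (TI + 1)"
    proof -
      have "i < 1 + (NN - kI) + NN * (TI + 1)" using i unfolding es by (simp only: length_append lcs lb) simp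
      then have "i = 0 \<or> (\<exists>x. i = Suc x \<and> x < NN - kI) \<or> (\<exists>y. i = NN - kI + 1 + y \<and> y < NN * (TI + 1))"
      proof (cases i)
        case (Suc x)
        assume lt: "i < 1 + (NN - kI) + NN * (TI + 1)"
        show ?thesis
        proof (cases "x < NN - kI")
          case False
          then have "i = NN - kI + 1 + (x - (NN - kI)) \<and> x - (NN - kI) < NN * (TI + 1)" using Suc lt by linarith
          then show ?thesis by blast
        qed (use Suc in auto)
      qed simp
      then show thesis using that by blast
    qed
    then show ?thesis
    proof cases
      case 1
      then show ?thesis using a(3)[of 0] em prep(2) by (simp add: es s6_def)
    next
      case (2 x)
      then have "s8 ''out'' i = x mod kI" using a(3)[of i] em prep(3)[of x] by (simp add: s6_def)
      moreover have "csI ! x = x mod kI" using 2 by (simp add: csI_def)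
      ultimately show ?thesis using 2 lcs by (simp add: es nth_append)
    next
      case (3 y)
      define g where "g = y div (TI + 1)"
      define t where "t = y mod (TI + 1)"
      have y: "y = g * (TI + 1) + t" unfolding g_def t_def by (rule div_mult_mod_eq[symmetric])
      have t: "t < TI + 1" by (simp add: t_def)
      have g: "g < NN" unfolding g_def using 3(2) by (simp add: less_mult_imp_div_less)
      have "encode_solution I csI f ! i = ?bl ! y" using 3 lcs by (simp add: es nth_append)
      also have "\<dots> = map (f ([0..<NN] ! g)) [0..<TI + 1] ! t"
        unfolding y by (rule concat_block_nth) (use g t in auto)
      also have "\<dots> = f g t" using g t by (simp del: upt_Suc)
      also have "\<dots> = s8 ''out'' i" using a(2)[OF g, of t] t 3(1) y by (simp add: f_def oix_def)
      finally show ?thesis ..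
    qed
  qed
  ultimately show ?thesis unfolding main by blast
qed

end

theorem theorem1p3:
  shows "\<exists>C::real. C > 0 \<and>
    (\<forall>\<epsilon>::real. 0 < \<epsilon> \<and> \<epsilon> < 1 \<longrightarrow>
      (\<exists>(alg :: program) (q :: nat poly). \<forall>I. valid_instance I \<longrightarrow>
        (\<exists>\<tau> cs f.
          outputs_in_time alg (encode_instance I) \<tau> (encode_solution I cs f) \<and>
          \<tau> \<le> poly q (instance_size I) \<and>
          set cs \<subseteq> {..<num_servers I} \<and>
          is_solution (augment I cs) f \<and>
          (\<forall>W \<in> weights I. real (servers_of_weight (augment I cs) W)
             \<le> 2 * (1 + \<epsilon>) * real (card (weights I)) * real (servers_of_weight I W)) \<and>
          cost (augment I cs) f \<le> C / \<epsilon> * opt_cost I)))"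
proof (intro exI[of _ 4] conjI allI impI)
  fix \<epsilon> :: real assume \<epsilon>: "0 < \<epsilon> \<and> \<epsilon> < 1"
  obtain q :: "nat poly" where q: "\<And>I. \<exists>\<tau> \<le> poly q (instance_size I). exec (compile c_main) (start I) \<tau> (run c_main (start I))"
    using compile_poly_time[OF wf_main] by blast
  show "\<exists>(alg :: program) (q :: nat poly). \<forall>I. valid_instance I \<longrightarrow>
        (\<exists>\<tau> cs f.
          outputs_in_time alg (encode_instance I) \<tau> (encode_solution I cs f) \<and>
          \<tau> \<le> poly q (instance_size I) \<and>
          set cs \<subseteq> {..<num_servers I} \<and>
          is_solution (augment I cs) f \<and>
          (\<forall>W \<in> weights I. real (servers_of_weight (augment I cs) W)
             \<le> 2 * (1 + \<epsilon>) * real (card (weights I)) * real (servers_of_weight I W)) \<and>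
          cost (augment I cs) f \<le> 4 / \<epsilon> * opt_cost I)"
  proof (intro exI[of _ "compile c_main"] exI[of _ q] allI impI)
    fix I assume valid: "valid_instance I"
    interpret instance_facts I by standard (rule valid)
    obtain \<tau> where \<tau>: "\<tau> \<le> poly q (instance_size I)" "exec (compile c_main) (start I) \<tau> (run c_main (start I))"
      using q by blast
    obtain f where f: "\<forall>i<length (encode_solution I csI f). run c_main (start I) ''out'' i = encode_solution I csI f ! i"
      "is_solution (augment I csI) f" "cost (augment I csI) f \<le> 4 * opt_cost I" using main_correct by blast
    \<comment> \<open>Nonnegativity of the optimum allows the factor 4 to be weakened to
      \<open>4 / \<epsilon>\<close>.\<close>
    have "0 \<le> cost I g" for g
      unfolding cost_def using server by (intro mult_nonneg_nonneg sum_nonneg) (auto simp: wI_def)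
    then have "0 \<le> opt_cost I" using opt_cost_attained(1)[OF valid] by metis
    then have "4 * opt_cost I \<le> 4 / \<epsilon> * opt_cost I"
      using \<epsilon> by (intro mult_right_mono) (auto simp: field_simps)
    then have "cost (augment I csI) f \<le> 4 / \<epsilon> * opt_cost I" using f(3) by linarith
    moreover have "real (servers_of_weight (augment I csI) W)
        \<le> 2 * (1 + \<epsilon>) * real (card (weights I)) * real (servers_of_weight I W)" for W
      unfolding servers_augmented ell_weights of_nat_mult using \<epsilon> by (intro mult_right_mono) auto
    moreover have "set csI \<subseteq> {..<num_servers I}" using kI_pos by (auto simp: csI_def)
    moreover have "outputs_in_time (compile c_main) (encode_instance I) \<tau> (encode_solution I csI f)"
      unfolding outputs_in_time_def using \<tau>(2) f(1) by blast
    ultimately show "\<exists>\<tau> cs f.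
          outputs_in_time (compile c_main) (encode_instance I) \<tau> (encode_solution I cs f) \<and>
          \<tau> \<le> poly q (instance_size I) \<and>
          set cs \<subseteq> {..<num_servers I} \<and>
          is_solution (augment I cs) f \<and>
          (\<forall>W \<in> weights I. real (servers_of_weight (augment I cs) W)
             \<le> 2 * (1 + \<epsilon>) * real (card (weights I)) * real (servers_of_weight I W)) \<and>
          cost (augment I cs) f \<le> 4 / \<epsilon> * opt_cost I"
      using \<tau>(1) f(2) by blast
  qed
qed simp

end
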